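(* Let $u:\mathbb{R}^n\times[0,T)\to\mathbb{R}$ be a smooth solution of $$\frac{\partial u}{\partial t}=\frac{1}{\sqrt{-1}}\log\frac{\det(I+\sqrt{-1}\,D^2u)}{\sqrt{\det(I+(D^2u)^2)}},$$ and suppose that $u(\cdot,t)$ is $2$-convex for all $t\in[0,T)$. Then, in the parametric form of the mean curvature flow, $\log( *\Omega)$ satisfies $$\Big(\frac{\partial}{\partial t}-\Delta\Big)\log( *\Omega)\ \ge\ \frac1n\,\big|\nabla\log( *\Omega)\big|^2 .$$
   Context: $D$ denotes the spatial derivative in $x\in\mathbb{R}^n$. If $\lambda_1,\dots,\lambda_n$ are the eigenvalues of $D^2u$, the right-hand side of the evolution equation is $\sum_i\arctan\lambda_i$. A $C^2$ function $u:\mathbb{R}^n\to\mathbb{R}$ is $2$-convex if at every point the eigenvalues $\lambda_1,\dots,\lambda_n$ of $D^2u$ satisfy $\lambda_i+\lambda_j\ge0$ and $1+\lambda_i\lambda_j\ge0$ for all $i\ne j$. For a function $u$ on $\mathbb{R}^n$ the graph of the gradient $L_u=\{(x,Du(x)):x\in\mathbb{R}^n\}\subset\mathbb{R}^n\oplus\mathbb{R}^n=\mathbb{R}^{2n}$ is a Lagrangian submanifold, equipped with the metric induced from the Euclidean metric. $\Omega$ is the parallel $n$-form on $\mathbb{R}^{2n}$ given by the volume form of the first factor $\mathbb{R}^n\oplus\{0\}$, and $*\Omega$ is the function on $L_u$ obtained by applying the Hodge star of the induced metric to $\Omega|_{L_u}$; at $(x,Du(x))$ it equals $\prod_{i=1}^n(1+\lambda_i^2)^{-1/2}$,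 with $\lambda_i$ the eigenvalues of $D^2u(x)$. Parametric form: $F(x,t)=(\phi_t(x),Du(\phi_t(x),t))$, where $\phi_t$ is a time-dependent family of diffeomorphisms such that $\frac{\partial}{\partial t}F=H$, with $H$ the mean curvature vector of $L_{u(\cdot,t)}$ in $\mathbb{R}^{2n}$. The function $*\Omega$ is regarded as a function of $(x,t)$ via $F$; $\partial/\partial t$ is taken at fixed $x$, and $\Delta$, $\nabla$, $|\cdot|$ are the Laplace–Beltrami operator, gradient and norm of the metric induced by $F(\cdot,t)$. *)

theory Defs
  imports
    "HOL-Analysis.Analysis"
    "HOL-Computational_Algebra.Fundamental_Theorem_Algebra"
begin

section \<open>Smooth functions and partial derivatives\<close>

text \<open>
  Derivatives are taken within \<open>S\<close>; on \<open>S = UNIV \<times> {0..<T}\<close> they are one-sided in time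
  at \<open>t = 0\<close>. On such a set, and on \<open>UNIV\<close>, the derivative \<open>f'\<close> is unique.
\<close>

primrec Ck_on :: "nat \<Rightarrow> ('a::euclidean_space \<Rightarrow> 'b::real_normed_vector) \<Rightarrow> 'a set \<Rightarrow> bool" where
  "Ck_on 0 f S \<longleftrightarrow> continuous_on S f"
| "Ck_on (Suc k) f S \<longleftrightarrow>
     (\<exists>f'. (\<forall>x\<in>S. (f has_derivative f' x) (at x within S)) \<and> (\<forall>v. Ck_on k (\<lambda>x. f' x v) S))"

definition smooth_on :: "('a::euclidean_space \<Rightarrow> 'b::real_normed_vector) \<Rightarrow> 'a set \<Rightarrow> bool" where
  "smooth_on f S \<longleftrightarrow> (\<forall>k. Ck_on k f S)"

definition diffeomorphism :: "(real^'n \<Rightarrow> real^'n) \<Rightarrow> bool" where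
  "diffeomorphism f \<longleftrightarrow> bij f \<and> smooth_on f UNIV \<and> smooth_on (inv f) UNIV"

definition partial :: "(real^'n \<Rightarrow> 'b::real_normed_vector) \<Rightarrow> 'n \<Rightarrow> real^'n \<Rightarrow> 'b" where
  "partial f i x = frechet_derivative f (at x) (axis i 1)"

definition grad :: "(real^'n \<Rightarrow> real) \<Rightarrow> real^'n \<Rightarrow> real^'n" where
  "grad f x = (\<chi> i. partial f i x)"

definition hessian :: "(real^'n \<Rightarrow> real) \<Rightarrow> real^'n \<Rightarrow> real^'n^'n" where
  "hessian f x = (\<chi> i j. partial (partial f j) i x)"


section \<open>Eigenvalues and 2-convexity\<close>

definition charpoly :: "'a::comm_ring_1^'n^'n \<Rightarrow> 'a poly" where
  "charpoly A = det (\<chi> i j. if i = j then [:- (A$i$j), 1:] else [:- (A$i$j):])"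

text \<open>Eigenvalues are counted with algebraic multiplicity.\<close>

definition eigenvalues :: "real^'n^'n \<Rightarrow> real multiset" where
  "eigenvalues A = proots (charpoly A)"

text \<open>
  \<open>{#l, m#} \<subseteq># eigenvalues A\<close> says that \<open>l\<close> and \<open>m\<close> are \<open>\<lambda>\<^sub>i\<close> and \<open>\<lambda>\<^sub>j\<close> for some \<open>i \<noteq> j\<close>.
\<close>

definition two_convex :: "(real^'n \<Rightarrow> real) \<Rightarrow> bool" where
  "two_convex f \<longleftrightarrow> Ck_on 2 f UNIV \<and>
     (\<forall>x l m. {#l, m#} \<subseteq># eigenvalues (hessian f x) \<longrightarrow> l + m \<ge> 0 \<and> 1 + l * m \<ge> 0)"


section \<open>The right-hand side of the evolution equation\<close>

definition cmat :: "real^'n^'n \<Rightarrow> complex^'n^'n" where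
  "cmat A = (\<chi> i j. complex_of_real (A$i$j))"

definition phase :: "real^'n^'n \<Rightarrow> complex" where
  "phase A = det (mat 1 + (\<chi> i j. \<i> * cmat A $ i $ j)) / complex_of_real (sqrt (det (mat 1 + A ** A)))"

text \<open>
  For symmetric \<open>A\<close> the number \<open>phase A\<close> lies on the unit circle. Its logarithm is the continuous
  branch with value \<open>0\<close> at the zero matrix, followed along \<open>s \<mapsto> s A\<close>; the principal branch would
  jump, since the angle ranges over \<open>(-n\<pi>/2, n\<pi>/2)\<close>. Lemma \<open>log_phase_eq_arctan\<close> below identifies
  the result with \<open>\<i> (arctan \<lambda>\<^sub>1 + \<dots> + arctan \<lambda>\<^sub>n)\<close>.
\<close>

definition log_phase :: "real^'n^'n \<Rightarrow> complex" where
  "log_phase A = (THE w. \<exists>\<gamma>. continuous_on {0..1} \<gamma> \<and> \<gamma> 0 = 0 \<and> \<gamma> 1 = w \<and>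
     (\<forall>s\<in>{0..1::real}. exp (\<gamma> s) = phase (s *\<^sub>R A)))"


section \<open>Riemannian geometry of immersions of Euclidean space\<close>

definition induced_metric :: "(real^'n \<Rightarrow> 'b::real_inner) \<Rightarrow> real^'n \<Rightarrow> real^'n^'n" where
  "induced_metric F x = (\<chi> i j. partial F i x \<bullet> partial F j x)"

definition metric_grad :: "(real^'n \<Rightarrow> real^'n^'n) \<Rightarrow> (real^'n \<Rightarrow> real) \<Rightarrow> real^'n \<Rightarrow> real^'n" where
  "metric_grad g f x = matrix_inv (g x) *v grad f x"

definition metric_norm :: "real^'n^'n \<Rightarrow> real^'n \<Rightarrow> real" where
  "metric_norm G v = sqrt (v \<bullet> (G *v v))"

definition laplace_beltrami :: "(real^'n \<Rightarrow> real^'n^'n) \<Rightarrow> (real^'n \<Rightarrow> real) \<Rightarrow> real^'n \<Rightarrow> real" where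
  "laplace_beltrami g f x =
     (\<Sum>i\<in>UNIV. partial (\<lambda>y. sqrt (det (g y)) * metric_grad g f y $ i) i x) / sqrt (det (g x))"

definition tangential_part :: "(real^'n \<Rightarrow> 'b::real_inner) \<Rightarrow> real^'n \<Rightarrow> 'b \<Rightarrow> 'b" where
  "tangential_part F x v = (\<Sum>k\<in>UNIV. \<Sum>l\<in>UNIV.
     (matrix_inv (induced_metric F x) $ k $ l * (v \<bullet> partial F k x)) *\<^sub>R partial F l x)"

definition second_fundamental_form ::
    "(real^'n \<Rightarrow> 'b::real_inner) \<Rightarrow> real^'n \<Rightarrow> 'n \<Rightarrow> 'n \<Rightarrow> 'b" where
  "second_fundamental_form F x i j =
     partial (partial F j) i x - tangential_part F x (partial (partial F j) i x)"

text \<open>The mean curvature vector is the trace, not the average, of the second fundamental form.\<close>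

definition mean_curvature_vector :: "(real^'n \<Rightarrow> 'b::real_inner) \<Rightarrow> real^'n \<Rightarrow> 'b" where
  "mean_curvature_vector F x = (\<Sum>i\<in>UNIV. \<Sum>j\<in>UNIV.
     matrix_inv (induced_metric F x) $ i $ j *\<^sub>R second_fundamental_form F x i j)"


section \<open>The graph of the gradient\<close>

text \<open>
  \<open>\<real>\<^sup>2\<^sup>n\<close> is \<open>real^'n \<times> real^'n\<close>, whose inner product is the sum of the two inner products.
  The graph is oriented by \<open>gradient_graph f\<close>.
\<close>

definition gradient_graph :: "(real^'n \<Rightarrow> real) \<Rightarrow> real^'n \<Rightarrow> (real^'n) \<times> (real^'n)" where
  "gradient_graph f y = (y, grad f y)"

definition Omega :: "('n \<Rightarrow> (real^'n) \<times> (real^'n)) \<Rightarrow> real" where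
  "Omega v = det (\<chi> i j. fst (v j) $ i)"

text \<open>
  The Hodge star of an \<open>n\<close>-form on an \<open>n\<close>-manifold is its quotient by the volume form, i.e. its
  value on the coordinate frame divided by \<open>sqrt (det g)\<close>. The value at \<open>y\<close> belongs to the point
  \<open>(y, Df(y))\<close> of the graph.
\<close>

definition star_Omega :: "(real^'n \<Rightarrow> real) \<Rightarrow> real^'n \<Rightarrow> real" where
  "star_Omega f y = Omega (\<lambda>i. partial (gradient_graph f) i y)
     / sqrt (det (induced_metric (gradient_graph f) y))"


section \<open>Flows\<close>

definition lagrangian_flow_solution :: "(real^'n \<Rightarrow> real \<Rightarrow> real) \<Rightarrow> real \<Rightarrow> bool" where
  "lagrangian_flow_solution u T \<longleftrightarrow>
     smooth_on (\<lambda>(x, t). u x t) (UNIV \<times> {0..<T}) \<and>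
     (\<forall>x. \<forall>t\<in>{0..<T}. \<exists>u'. ((\<lambda>s. u x s) has_real_derivative u') (at t within {0..<T}) \<and>
        complex_of_real u' = 1 / \<i> * log_phase (hessian (\<lambda>y. u y t) x))"

definition parametric_position ::
    "(real^'n \<Rightarrow> real \<Rightarrow> real) \<Rightarrow> (real^'n \<Rightarrow> real \<Rightarrow> real^'n) \<Rightarrow> real^'n \<Rightarrow> real \<Rightarrow> (real^'n) \<times> (real^'n)" where
  "parametric_position u \<phi> x t = (\<phi> x t, grad (\<lambda>y. u y t) (\<phi> x t))"

definition parametric_flow ::
    "(real^'n \<Rightarrow> real \<Rightarrow> real) \<Rightarrow> (real^'n \<Rightarrow> real \<Rightarrow> real^'n) \<Rightarrow> real \<Rightarrow> bool" where
  "parametric_flow u \<phi> T \<longleftrightarrow>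
     smooth_on (\<lambda>(x, t). \<phi> x t) (UNIV \<times> {0..<T}) \<and>
     (\<forall>t\<in>{0..<T}. diffeomorphism (\<lambda>x. \<phi> x t)) \<and>
     (\<forall>x. \<forall>t\<in>{0..<T}. ((\<lambda>s. parametric_position u \<phi> x s) has_vector_derivative
        mean_curvature_vector (gradient_graph (\<lambda>y. u y t)) (\<phi> x t)) (at t within {0..<T}))"

definition log_star_Omega ::
    "(real^'n \<Rightarrow> real \<Rightarrow> real) \<Rightarrow> (real^'n \<Rightarrow> real \<Rightarrow> real^'n) \<Rightarrow> real^'n \<Rightarrow> real \<Rightarrow> real" where
  "log_star_Omega u \<phi> x t = ln (star_Omega (\<lambda>y. u y t) (\<phi> x t))"


section \<open>The branch of the logarithm and the value of the Hodge star\<close>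

lemma poly_det: "poly (det M) x = det (\<chi> i j. poly (M$i$j) x)"
  by (simp add: det_def poly_sum poly_prod)

lemma poly_charpoly: "poly (charpoly A) x = det (mat x - A)"
  unfolding charpoly_def poly_det by (intro arg_cong[where f = det]) (auto simp: vec_eq_iff mat_def)

lemma charpoly_degree:
  fixes A :: "'a::idom^'n^'n"
  shows "degree (charpoly A) = CARD('n)" "lead_coeff (charpoly A) = 1"
proof -
  let ?M = "(\<chi> i j. if i = j then [:- (A$i$j), 1:] else [:- (A$i$j):]) :: 'a poly^'n^'n"
  let ?P = "{p. p permutes (UNIV::'n set)}"
  let ?t = "\<lambda>p. of_int (sign p) * (\<Prod>i\<in>UNIV. ?M$i$p i)"
  have dM: "degree (?M$i$j) \<le> (if i = j then 1 else 0)" for i j by simp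
  have small: "degree (?t p) < CARD('n)" if p: "p \<in> ?P - {id}" for p
  proof -
    obtain k where k: "p k \<noteq> k" using p by (auto simp: fun_eq_iff)
    have "degree (?t p) \<le> degree (of_int (sign p) :: 'a poly) + degree (\<Prod>i\<in>UNIV. ?M$i$p i)"
      by (rule degree_mult_le)
    also have "\<dots> = degree (\<Prod>i\<in>UNIV. ?M$i$p i)" by simp
    also have "\<dots> \<le> sum (degree \<circ> (\<lambda>i. ?M$i$p i)) UNIV" by (rule degree_prod_sum_le) simp
    also have "\<dots> < (\<Sum>i\<in>(UNIV::'n set). 1)"
    proof (rule sum_strict_mono_ex1)
      show "\<exists>a\<in>UNIV. (degree \<circ> (\<lambda>i. ?M$i$p i)) a < 1" using k by (intro bexI[of _ k]) auto
    qed auto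
    finally show ?thesis by simp
  qed
  have main: "?t id = (\<Prod>i\<in>UNIV. [:- (A$i$i), 1:])" by simp
  have dm: "degree (?t id) = CARD('n)" unfolding main by (subst degree_prod_sum_eq) auto
  have lm: "coeff (?t id) (CARD('n)) = 1"
    using dm lead_coeff_prod[of "\<lambda>i. [:- (A$i$i), 1:]" "UNIV::'n set"] unfolding main by simp
  have split: "charpoly A = ?t id + (\<Sum>p\<in>?P - {id}. ?t p)"
    unfolding charpoly_def det_def
    by (rule sum.remove) (auto simp: permutes_id finite_permutations)
  have fin: "finite ?P" by (simp add: finite_permutations)
  have dr: "degree (\<Sum>p\<in>?P - {id}. ?t p) < CARD('n)"
    by (rule degree_sum_less) (use small in auto)
  show d: "degree (charpoly A) = CARD('n)"
    unfolding split using dr dm by (subst degree_add_eq_left) auto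
  show "lead_coeff (charpoly A) = 1"
    unfolding d using dr lm by (simp add: split coeff_eq_0)
qed

lemma of_real_det: "complex_of_real (det A) = det (cmat A)"
  by (simp add: det_def cmat_def)

lemma symmetric_nth: "transpose A = A \<Longrightarrow> A$i$j = A$j$i"
  by (metis transpose_def vec_lambda_beta)

lemma real_roots_symmetric:
  fixes A :: "real^'n^'n"
  assumes sym: "transpose A = A" and root: "poly (charpoly (cmat A)) z = 0"
  shows "z \<in> \<real>"
proof -
  have A: "A$i$j = A$j$i" for i j by (rule symmetric_nth[OF sym])
  have "\<not> invertible (mat z - cmat A)"
    using root by (simp add: poly_charpoly invertible_det_nz)
  then obtain v where v: "(mat z - cmat A) *v v = 0" "v \<noteq> 0"
    unfolding invertible_left_inverse matrix_left_invertible_ker by blast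
  have ev: "(\<Sum>j\<in>UNIV. complex_of_real (A$i$j) * v$j) = z * v$i" for i
  proof -
    have "cmat A *v v = mat z *v v" using v(1) by (simp add: matrix_vector_mult_diff_rdistrib)
    hence "(cmat A *v v) $ i = (mat z *v v) $ i" by simp
    thus ?thesis
      by (simp add: matrix_vector_mult_def cmat_def mat_def if_distrib if_distribR cong: if_cong)
  qed
  define N where "N = (\<Sum>i\<in>UNIV. cnj (v$i) * v$i)"
  define Q where "Q = (\<Sum>i\<in>UNIV. \<Sum>j\<in>UNIV. cnj (v$i) * (complex_of_real (A$i$j) * v$j))"
  have Q: "Q = z * N" unfolding Q_def N_def
    by (simp add: sum_distrib_left[symmetric] ev) (simp add: sum_distrib_left mult_ac)
  have "cnj Q = (\<Sum>i\<in>UNIV. \<Sum>j\<in>UNIV. cnj (v$j) * (complex_of_real (A$j$i) * v$i))"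
    unfolding Q_def by (simp add: mult_ac A)
  also have "\<dots> = Q" unfolding Q_def by (rule sum.swap)
  finally have cQ: "cnj Q = Q" .
  have N: "N = complex_of_real (\<Sum>i\<in>UNIV. (cmod (v$i))\<^sup>2)"
    unfolding N_def by (simp only: of_real_sum complex_norm_square mult.commute)
  obtain k where "v$k \<noteq> 0" using v(2) by (auto simp: vec_eq_iff)
  hence "(\<Sum>i\<in>UNIV. (cmod (v$i))\<^sup>2) > 0" by (intro sum_pos2[of _ k]) auto
  hence "N \<noteq> 0" unfolding N using of_real_eq_0_iff by (metis less_irrefl)
  moreover have "cnj N = N" unfolding N by simp
  ultimately have "cnj z = z" using cQ unfolding Q by simp
  thus ?thesis by (simp add: complex_is_Real_iff complex_eq_iff)
qed

lemma charpoly_cmat_eigenvalues: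
  fixes A :: "real^'n^'n"
  assumes sym: "transpose A = A"
  shows "charpoly (cmat A) = (\<Prod>r\<in>#eigenvalues A. [:- complex_of_real r, 1:])"
    and "size (eigenvalues A) = CARD('n)"
proof -
  let ?P = "charpoly (cmat A)"
  define M where "M = image_mset Re (proots ?P)"
  have P0: "?P \<noteq> 0" using charpoly_degree(2)[of "cmat A"] by auto
  have roots: "z \<in> \<real>" if "z \<in># proots ?P" for z
    using that P0 real_roots_symmetric[OF sym] by simp
  have P: "?P = (\<Prod>z\<in>#proots ?P. [:-z, 1:])"
    using complex_poly_decompose_multiset[of ?P] charpoly_degree(2)[of "cmat A"] by simp
  also have "\<dots> = (\<Prod>z\<in>#proots ?P. [:-complex_of_real (Re z), 1:])"
    using roots by (intro arg_cong[where f = prod_mset] image_mset_cong) (auto simp: complex_is_Real_iff complex_eq_iff)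
  finally have PM: "?P = (\<Prod>r\<in>#M. [:-complex_of_real r, 1:])"
    unfolding M_def by (simp add: multiset.map_comp o_def)
  have "poly (charpoly A) x = poly (\<Prod>r\<in>#M. [:-r, 1:]) x" for x
  proof -
    have "complex_of_real (poly (charpoly A) x) = det (cmat (mat x - A))"
      by (simp add: poly_charpoly of_real_det)
    also have "cmat (mat x - A) = mat (complex_of_real x) - cmat A"
      by (simp add: cmat_def mat_def vec_eq_iff)
    also have "det \<dots> = poly ?P (complex_of_real x)" by (simp add: poly_charpoly)
    also have "\<dots> = complex_of_real (poly (\<Prod>r\<in>#M. [:-r, 1:]) x)"
      unfolding PM by (induction M) auto
    finally show ?thesis using of_real_eq_iff by blast
  qed
  hence "charpoly A = (\<Prod>r\<in>#M. [:-r, 1:])" by (simp add: poly_eq_poly_eq_iff[symmetric] fun_eq_iff)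
  moreover have "proots (\<Prod>r\<in>#M. [:-r, 1:]) = M"
  proof (induction M)
    case (add r M)
    have "(\<Prod>r\<in>#M. [:-r, 1:]) \<noteq> 0" by (auto simp: prod_mset_zero_iff)
    with add show ?case by (simp add: proots_mult del: mult_pCons_left)
  qed simp
  ultimately have ME: "eigenvalues A = M" by (simp add: eigenvalues_def)
  show "?P = (\<Prod>r\<in>#eigenvalues A. [:- complex_of_real r, 1:])" unfolding ME by (rule PM)
  show "size (eigenvalues A) = CARD('n)"
    unfolding ME M_def by (simp add: size_proots_complex charpoly_degree)
qed

lemma det_one_plus:
  fixes A :: "real^'n^'n"
  assumes sym: "transpose A = A"
  shows "det (mat 1 + (\<chi> i j. c * cmat A $ i $ j)) = (\<Prod>r\<in>#eigenvalues A. 1 + c * complex_of_real r)"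
proof (cases "c = 0")
  case True
  have "mat 1 + (\<chi> i j. c * cmat A $ i $ j) = mat 1" using True by (simp add: vec_eq_iff)
  thus ?thesis using True by simp
next
  case False
  have "mat 1 + (\<chi> i j. c * cmat A $ i $ j) = (\<chi> i. (-c) *s (mat (-1/c) - cmat A) $ i)"
    using False by (auto simp: vec_eq_iff mat_def field_simps)
  hence "det (mat 1 + (\<chi> i j. c * cmat A $ i $ j)) = det (\<chi> i. (-c) *s (mat (-1/c) - cmat A) $ i)"
    by (rule arg_cong)
  also have "\<dots> = (-c) ^ CARD('n) * poly (charpoly (cmat A)) (-1/c)"
    unfolding det_rows_mul poly_charpoly by (simp only: vec_nth_inverse prod_constant)
  also have "\<dots> = (-c) ^ size (eigenvalues A) * (\<Prod>r\<in>#eigenvalues A. -1/c - complex_of_real r)"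
    unfolding charpoly_cmat_eigenvalues[OF sym] poly_prod_mset
    by (simp only: multiset.map_comp o_def poly_pCons poly_0 mult_zero_right add_0_right mult_1_right
        diff_conv_add_uminus add.commute)
  also have "(-c) ^ size M * (\<Prod>r\<in>#M. -1/c - complex_of_real r) = (\<Prod>r\<in>#M. 1 + c * complex_of_real r)" for M
    using False
  proof (induction M)
    case (add x M)
    have "(-c) ^ size (add_mset x M) * (\<Prod>r\<in>#add_mset x M. -1/c - complex_of_real r) =
        (-c * (-1/c - complex_of_real x)) * ((-c) ^ size M * (\<Prod>r\<in>#M. -1/c - complex_of_real r))"
      by simp
    also have "-c * (-1/c - complex_of_real x) = 1 + c * complex_of_real x"
      using False by (simp add: field_simps)
    finally show ?case using add by simp
  qed simp
  finally show ?thesis .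
qed

lemma det_one_plus_square:
  fixes A :: "real^'n^'n"
  assumes sym: "transpose A = A"
  shows "det (mat 1 + (s *\<^sub>R A) ** (s *\<^sub>R A)) = (\<Prod>r\<in>#eigenvalues A. 1 + (s * r)\<^sup>2)"
proof -
  let ?B = "\<lambda>c. mat 1 + (\<chi> i j. c * cmat A $ i $ j)"
  let ?c = "\<i> * complex_of_real s"
  have "cmat (mat 1 + (s *\<^sub>R A) ** (s *\<^sub>R A)) = ?B ?c ** ?B (- ?c)"
  proof -
    have "?B ?c ** ?B (- ?c) = mat 1 - (\<chi> i j. ?c * cmat A $ i $ j) ** (\<chi> i j. ?c * cmat A $ i $ j)"
    proof -
      define C where "C = (\<chi> i j. ?c * cmat A $ i $ j)"
      have "(\<chi> i j. - ?c * cmat A $ i $ j) = - C" by (simp add: C_def vec_eq_iff)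
      moreover have "(mat 1 + C) ** (mat 1 + (-C)) = mat 1 - C ** C"
      proof -
        have "C ** (- C) = - (C ** C)"
          by (simp add: matrix_matrix_mult_def vec_eq_iff sum_negf)
        moreover have "(mat 1 + C) ** (mat 1 + (-C)) = (mat 1 ** mat 1 + mat 1 ** (-C)) + (C ** mat 1 + C ** (-C))"
          by (simp add: matrix_matrix_mult_def vec_eq_iff sum.distrib[symmetric] algebra_simps)
        ultimately show ?thesis by (simp del: mult_minus_right)
      qed
      ultimately show ?thesis by (simp add: C_def)
    qed
    also have "\<dots> = cmat (mat 1 + (s *\<^sub>R A) ** (s *\<^sub>R A))"
      by (simp add: vec_eq_iff cmat_def mat_def matrix_matrix_mult_def mult_ac sum_negf[symmetric])
    finally show ?thesis by simp
  qed
  hence "complex_of_real (det (mat 1 + (s *\<^sub>R A) ** (s *\<^sub>R A))) = det (?B ?c) * det (?B (- ?c))"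
    by (simp add: of_real_det det_mul)
  also have "\<dots> = (\<Prod>r\<in>#eigenvalues A. 1 + ?c * complex_of_real r) *
      (\<Prod>r\<in>#eigenvalues A. 1 + (- ?c) * complex_of_real r)"
    by (simp only: det_one_plus[OF sym])
  also have "(\<Prod>r\<in>#M. 1 + ?c * complex_of_real r) * (\<Prod>r\<in>#M. 1 + (- ?c) * complex_of_real r)
     = complex_of_real (\<Prod>r\<in>#M. 1 + (s * r)\<^sup>2)" for M
  proof (induction M)
    case (add r M)
    have e: "(1 + ?c * complex_of_real r) * (1 + (- ?c) * complex_of_real r) = complex_of_real (1 + (s * r)\<^sup>2)"
      by (simp add: algebra_simps power2_eq_square)
    have "(\<Prod>r\<in>#add_mset r M. 1 + ?c * complex_of_real r) * (\<Prod>r\<in>#add_mset r M. 1 + (- ?c) * complex_of_real r)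
      = ((1 + ?c * complex_of_real r) * (1 + (- ?c) * complex_of_real r)) *
       ((\<Prod>r\<in>#M. 1 + ?c * complex_of_real r) * (\<Prod>r\<in>#M. 1 + (- ?c) * complex_of_real r))"
      by (simp only: image_mset_add_mset prod_mset.add_mset mult_ac)
    thus ?case unfolding e add by simp
  qed simp
  finally show ?thesis using of_real_eq_iff by blast
qed

lemma phase_scaled:
  fixes A :: "real^'n^'n"
  assumes sym: "transpose A = A"
  shows "phase (s *\<^sub>R A) = exp (\<i> * complex_of_real (\<Sum>r\<in>#eigenvalues A. arctan (s * r)))"
proof -
  have "(\<chi> i j. \<i> * cmat (s *\<^sub>R A) $ i $ j) = (\<chi> i j. (\<i> * complex_of_real s) * cmat A $ i $ j)"
    by (simp add: vec_eq_iff cmat_def)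
  hence "phase (s *\<^sub>R A) = (\<Prod>r\<in>#eigenvalues A. 1 + \<i> * complex_of_real s * complex_of_real r) /
      complex_of_real (sqrt (\<Prod>r\<in>#eigenvalues A. 1 + (s * r)\<^sup>2))"
    unfolding phase_def det_one_plus_square[OF sym] by (simp only: det_one_plus[OF sym])
  also have "(\<Prod>r\<in>#M. 1 + \<i> * complex_of_real s * complex_of_real r) /
      complex_of_real (sqrt (\<Prod>r\<in>#M. 1 + (s * r)\<^sup>2)) =
      exp (\<i> * complex_of_real (\<Sum>r\<in>#M. arctan (s * r)))" for M
  proof (induction M)
    case (add r M)
    have e: "(1 + \<i> * complex_of_real s * complex_of_real r) / complex_of_real (sqrt (1 + (s * r)\<^sup>2)) =
        exp (\<i> * complex_of_real (arctan (s * r)))"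
      unfolding cis_conv_exp[symmetric]
      by (simp add: complex_eq_iff cos_arctan sin_arctan)
    have "(\<Prod>r\<in>#add_mset r M. 1 + \<i> * complex_of_real s * complex_of_real r) /
      complex_of_real (sqrt (\<Prod>r\<in>#add_mset r M. 1 + (s * r)\<^sup>2)) =
      ((1 + \<i> * complex_of_real s * complex_of_real r) / complex_of_real (sqrt (1 + (s * r)\<^sup>2))) *
      ((\<Prod>r\<in>#M. 1 + \<i> * complex_of_real s * complex_of_real r) /
      complex_of_real (sqrt (\<Prod>r\<in>#M. 1 + (s * r)\<^sup>2)))"
      by (simp add: real_sqrt_mult)
    thus ?case unfolding e add by (simp add: exp_add[symmetric] distrib_left)
  qed simp
  finally show ?thesis .
qed

lemma continuous_log_unique:
  fixes \<gamma> \<delta> :: "real \<Rightarrow> complex"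
  assumes c: "continuous_on {0..1} \<gamma>" "continuous_on {0..1} \<delta>" and z: "\<gamma> 0 = \<delta> 0"
    and e: "\<And>s. s \<in> {0..1} \<Longrightarrow> exp (\<gamma> s) = exp (\<delta> s)"
  shows "\<gamma> 1 = \<delta> 1"
proof -
  let ?d = "\<lambda>s. \<gamma> s - \<delta> s"
  have d: "\<exists>n::int. ?d s = complex_of_real (2 * of_int n * pi) * \<i>" if "s \<in> {0..1}" for s
    using e[OF that] unfolding exp_eq by (auto simp: algebra_simps)
  have "?d constant_on {0..1}"
  proof (rule continuous_discrete_range_constant)
    fix x :: real assume x: "x \<in> {0..1}"
    show "\<exists>e>0. \<forall>y. y \<in> {0..1} \<and> ?d y \<noteq> ?d x \<longrightarrow> e \<le> norm (?d y - ?d x)"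
    proof (intro exI[of _ "2 * pi"] conjI allI impI)
      fix y assume y: "y \<in> {0..1} \<and> ?d y \<noteq> ?d x"
      obtain m n :: int where m: "?d y = complex_of_real (2 * of_int m * pi) * \<i>"
        and n: "?d x = complex_of_real (2 * of_int n * pi) * \<i>"
        using d x y by meson
      have "?d y - ?d x = complex_of_real (2 * pi * of_int (m - n)) * \<i>"
        unfolding m n by (simp add: algebra_simps)
      hence "norm (?d y - ?d x) = 2 * pi * \<bar>of_int (m - n)\<bar>"
        by (simp only: norm_mult norm_of_real norm_ii) (simp add: abs_mult)
      moreover have "m \<noteq> n" using y m n by auto
      hence "1 \<le> \<bar>real_of_int (m - n)\<bar>" by linarith
      ultimately show "2 * pi \<le> norm (?d y - ?d x)" by simp
    qed simp
  qed (auto intro!: continuous_on_diff c)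
  then obtain k where "\<And>s. s \<in> {0..1} \<Longrightarrow> ?d s = k" unfolding constant_on_def by blast
  from this[of 0] this[of 1] show ?thesis using z by simp
qed

lemma log_phase_eq_arctan:
  fixes A :: "real^'n^'n"
  assumes sym: "transpose A = A"
  shows "1 / \<i> * log_phase A = complex_of_real (\<Sum>r\<in>#eigenvalues A. arctan r)"
proof -
  let ?g = "\<lambda>s. \<i> * complex_of_real (\<Sum>r\<in>#eigenvalues A. arctan (s * r))"
  have cont: "continuous_on {0..1} (\<lambda>s::real. \<Sum>r\<in>#M. arctan (s * r))" for M
    by (induction M) (auto intro!: continuous_intros)
  have g: "continuous_on {0..1} ?g" by (intro continuous_intros cont)
  have "log_phase A = ?g 1"
    unfolding log_phase_def
  proof (rule the_equality)
    show "\<exists>\<gamma>. continuous_on {0..1} \<gamma> \<and> \<gamma> 0 = 0 \<and> \<gamma> 1 = ?g 1 \<and>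
        (\<forall>s\<in>{0..1::real}. exp (\<gamma> s) = phase (s *\<^sub>R A))"
      by (intro exI[of _ ?g] conjI g) (simp_all add: phase_scaled[OF sym])
  next
    fix w assume "\<exists>\<gamma>. continuous_on {0..1} \<gamma> \<and> \<gamma> 0 = 0 \<and> \<gamma> 1 = w \<and>
        (\<forall>s\<in>{0..1::real}. exp (\<gamma> s) = phase (s *\<^sub>R A))"
    then obtain \<gamma> where "continuous_on {0..1} \<gamma>" "\<gamma> 0 = 0" "\<gamma> 1 = w"
        "\<And>s. s \<in> {0..1::real} \<Longrightarrow> exp (\<gamma> s) = phase (s *\<^sub>R A)" by blast
    thus "w = ?g 1"
      using continuous_log_unique[OF _ g, of \<gamma>] by (simp add: phase_scaled[OF sym])
  qed
  thus ?thesis by simp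
qed

lemma star_Omega_eq:
  fixes f :: "real^'n \<Rightarrow> real"
  assumes diff: "(grad f has_derivative D) (at y)" and sym: "transpose (hessian f y) = hessian f y"
  shows "star_Omega f y = (\<Prod>r\<in>#eigenvalues (hessian f y). 1 / sqrt (1 + r\<^sup>2))"
proof -
  let ?A = "hessian f y"
  have A: "?A$i$j = ?A$j$i" for i j by (rule symmetric_nth[OF sym])
  have comp: "D (axis i 1) $ j = ?A $ i $ j" for i j
  proof -
    have "((\<lambda>z. grad f z $ j) has_derivative (\<lambda>v. D v $ j)) (at y)"
      by (rule bounded_linear.has_derivative[OF bounded_linear_vec_nth diff])
    hence "(partial f j has_derivative (\<lambda>v. D v $ j)) (at y)" by (simp add: grad_def)
    hence "frechet_derivative (partial f j) (at y) = (\<lambda>v. D v $ j)"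
      by (rule frechet_derivative_at[symmetric])
    thus ?thesis by (simp add: hessian_def partial_def)
  qed
  have "(gradient_graph f has_derivative (\<lambda>v. (v, D v))) (at y)"
    unfolding gradient_graph_def[abs_def] by (intro has_derivative_Pair has_derivative_ident diff)
  hence "frechet_derivative (gradient_graph f) (at y) = (\<lambda>v. (v, D v))"
    by (rule frechet_derivative_at[symmetric])
  hence p: "partial (gradient_graph f) i y = (axis i 1, D (axis i 1))" for i
    by (simp add: partial_def)
  have "D (axis i 1) \<bullet> D (axis j 1) = (?A ** ?A) $ i $ j" for i j
    by (simp add: inner_vec_def comp matrix_matrix_mult_def A[of _ j])
  moreover have "axis i 1 \<bullet> axis j (1::real) = (mat 1 :: real^'n^'n) $ i $ j" for i j :: 'n
    by (simp add: inner_axis_axis mat_def)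
  ultimately have "induced_metric (gradient_graph f) y = mat 1 + (1 *\<^sub>R ?A) ** (1 *\<^sub>R ?A)"
    unfolding induced_metric_def p by (simp add: vec_eq_iff)
  hence d: "det (induced_metric (gradient_graph f) y) = (\<Prod>r\<in>#eigenvalues ?A. 1 + r\<^sup>2)"
    using det_one_plus_square[OF sym, of 1] by simp
  have "(\<chi> i j. fst (axis j 1 :: real^'n, D (axis j 1)) $ i) = (mat 1 :: real^'n^'n)"
    by (simp add: vec_eq_iff mat_def axis_def)
  hence o: "Omega (\<lambda>i. partial (gradient_graph f) i y) = 1"
    unfolding Omega_def p by simp
  have "1 / sqrt (\<Prod>r\<in>#M. 1 + r\<^sup>2) = (\<Prod>r\<in>#M. 1 / sqrt (1 + r\<^sup>2))" for M :: "real multiset"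
  proof (induction M)
    case (add x M)
    have "1 / sqrt (\<Prod>r\<in>#add_mset x M. 1 + r\<^sup>2) = 1 / sqrt (1 + x\<^sup>2) * (1 / sqrt (\<Prod>r\<in>#M. 1 + r\<^sup>2))"
      by (simp add: real_sqrt_mult)
    thus ?case unfolding add by simp
  qed simp
  thus ?thesis by (simp add: star_Omega_def o d)
qed

end

theory Submission
  imports Defs
begin

text \<open>
Fix a time and use the base point \<open>y\<close> as coordinate on the graph. Write \<open>a = D\<^sup>2u\<close> for the symmetric
Hessian, \<open>1 + a\<^sup>2\<close> for the induced metric, \<open>G\<close> for its inverse, \<open>\<theta> = u\<^sub>t\<close> for the Lagrangian angle, and
\<open>w = log *\<Omega> = -1/2 ln det (1 + a\<^sup>2)\<close>. Three facts reduce the claim to an inequality for numbers.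

First, the transport term is harmless. The tangential part of \<open>(0, D\<theta>)\<close> makes the points of the graph
move with base velocity \<open>\<phi>\<^sub>t = -G a D\<theta>\<close>, and the divergence form of the Laplacian of the metric
\<open>1 + a\<^sup>2\<close> is \<open>\<Delta>w = tr (G D\<^sup>2w) + Dw \<cdot> (-G a D\<theta>)\<close>, with the same first-order term. Since the Laplacian does
not depend on coordinates (lemma \<open>laplace_beltrami_pullback\<close>), the parametric expression
\<open>(\<partial>\<^sub>t - \<Delta>) w\<close> equals \<open>w\<^sub>t - tr (G D\<^sup>2w)\<close> with \<open>w\<^sub>t\<close> taken at fixed \<open>y\<close>
(lemmas \<open>laplace_log_Omega\<close> and \<open>drift_cancels\<close>).

Second, \<open>Dw = -tr (G a Da)\<close>, while differentiating \<open>exp (i \<theta>) sqrt (det (1 + a\<^sup>2)) = det (1 + i a)\<close> gives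
\<open>D\<theta> = tr (G Da)\<close>. As \<open>\<partial>\<^sub>t a = D\<^sup>2\<theta>\<close>, the fourth derivatives of \<open>u\<close> enter \<open>w\<^sub>t\<close> and \<open>tr (G D\<^sup>2w)\<close> through the
same contraction and cancel (lemma \<open>fourth_order_cancels\<close>). What is left is quadratic in \<open>D\<^sup>3u\<close>.

Third, in an orthonormal eigenbasis of \<open>a\<close> with eigenvalues \<open>\<lambda>\<^sub>i\<close>, with \<open>g\<^sub>i = 1 / (1 + \<lambda>\<^sub>i\<^sup>2)\<close> and the components
\<open>x\<^sub>i\<^sub>j\<^sub>c\<close> of \<open>D\<^sup>3u\<close>, the remainder is \<open>\<Sum> g\<^sub>i g\<^sub>j g\<^sub>c (1 + \<lambda>\<^sub>i \<lambda>\<^sub>j) x\<^sub>i\<^sub>j\<^sub>c\<^sup>2\<close>. By 2-convexity the terms with \<open>i \<noteq> j\<close> are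
nonnegative; the terms with \<open>i = j\<close> dominate \<open>1/n |\<nabla>w|\<^sup>2 = 1/n \<Sum> g\<^sub>c (\<Sum> g\<^sub>i \<lambda>\<^sub>i x\<^sub>i\<^sub>i\<^sub>c)\<^sup>2\<close> by the
Cauchy-Schwarz inequality (lemmas \<open>cubic_form_inequality\<close> and \<open>symmetric_contraction_inequality\<close>).
\<close>


section \<open>Matrix calculus\<close>

lemma bounded_linear_axis: "bounded_linear (axis i :: 'b::real_normed_vector \<Rightarrow> 'b^'n)"
proof (rule bounded_linear_intro[where K = 1])
  fix x :: 'b
  have "norm (axis i x :: 'b^'n) \<le> (\<Sum>k\<in>UNIV. norm ((axis i x :: 'b^'n) $ k))"
    unfolding norm_vec_def by (rule L2_set_le_sum) simp
  also have "\<dots> = norm x" by (simp add: axis_def if_distrib cong: if_cong)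
  finally show "norm (axis i x :: 'b^'n) \<le> norm x * 1" by simp
qed (auto simp: axis_def vec_eq_iff)

lemma has_derivative_vec_iff:
  fixes f :: "'a::real_normed_vector \<Rightarrow> 'b::real_normed_vector^'n"
  shows "(f has_derivative f') (at x within S) \<longleftrightarrow>
    (\<forall>i. ((\<lambda>x. f x $ i) has_derivative (\<lambda>v. f' v $ i)) (at x within S))"
proof safe
  fix i assume "(f has_derivative f') (at x within S)"
  thus "((\<lambda>x. f x $ i) has_derivative (\<lambda>v. f' v $ i)) (at x within S)"
    by (rule bounded_linear.has_derivative[OF bounded_linear_vec_nth])
next
  assume *: "\<forall>i. ((\<lambda>x. f x $ i) has_derivative (\<lambda>v. f' v $ i)) (at x within S)"
  have e: "z = (\<Sum>i\<in>UNIV. axis i (z $ i))" for z :: "'b^'n"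
    by (simp add: vec_eq_iff axis_def if_distrib cong: if_cong)
  have "((\<lambda>x. \<Sum>i\<in>UNIV. axis i (f x $ i)) has_derivative (\<lambda>v. \<Sum>i\<in>UNIV. axis i (f' v $ i)))
      (at x within S)"
    by (intro has_derivative_sum bounded_linear.has_derivative[OF bounded_linear_axis] *[rule_format])
  thus "(f has_derivative f') (at x within S)"
    by (simp add: e[symmetric])
qed

lemma matrix_add_rdistrib: "((A::'a::ring_1^'m^'n) + B) ** C = A ** C + B ** C"
  by (simp add: matrix_matrix_mult_def vec_eq_iff sum.distrib distrib_right)

lemma matrix_diff_distribs:
  fixes A :: "'a::ring_1^'m^'n"
  shows "(A - B) ** C = A ** C - B ** C" "A ** (D - E) = A ** D - A ** E"
  by (simp_all add: matrix_matrix_mult_def vec_eq_iff sum_subtractf left_diff_distrib right_diff_distrib)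

lemma matrix_minus_mult:
  fixes A :: "'a::ring_1^'m^'n"
  shows "(- A) ** C = - (A ** C)" "A ** (- C) = - (A ** C)"
  by (simp_all add: matrix_matrix_mult_def vec_eq_iff sum_negf)

lemma matrix_vector_minus: "(- A) *v x = - (A *v x)" for A :: "'a::ring_1^'m^'n"
  by (simp add: matrix_vector_mult_def vec_eq_iff sum_negf)

lemma matrix_zero_mult [simp]:
  shows "(0 :: 'a::ring_1^'m^'n) ** C = 0" "A ** (0 :: 'a::ring_1^'m^'n) = 0"
  by (simp_all add: matrix_matrix_mult_def vec_eq_iff)

lemma scaleR_matrix_mult:
  fixes A :: "real^'m^'n"
  shows "(c *\<^sub>R A) ** B = c *\<^sub>R (A ** B)" "A ** (c *\<^sub>R C) = c *\<^sub>R (A ** C)"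
  by (simp_all add: matrix_matrix_mult_def vec_eq_iff sum_distrib_left mult_ac)

lemma trace_scaleR: "trace (c *\<^sub>R (A :: real^'n^'n)) = c * trace A"
  by (simp add: trace_def sum_distrib_left)

lemma has_derivative_matrix_mult:
  fixes M :: "'a::real_normed_vector \<Rightarrow> 'b::real_normed_field^'m^'n" and N :: "'a \<Rightarrow> 'b^'k^'m"
  assumes "(M has_derivative M') (at x within S)" "(N has_derivative N') (at x within S)"
  shows "((\<lambda>x. M x ** N x) has_derivative (\<lambda>v. M x ** N' v + M' v ** N x)) (at x within S)"
proof -
  have 1: "((\<lambda>x. M x $ i $ j) has_derivative (\<lambda>v. M' v $ i $ j)) (at x within S)" for i j
    using assms(1) by (simp add: has_derivative_vec_iff)
  have 2: "((\<lambda>x. N x $ i $ j) has_derivative (\<lambda>v. N' v $ i $ j)) (at x within S)" for i j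
    using assms(2) by (simp add: has_derivative_vec_iff)
  show ?thesis
    unfolding has_derivative_vec_iff
    by (auto simp: matrix_matrix_mult_def sum.distrib[symmetric]
        intro!: has_derivative_sum has_derivative_mult 1 2)
qed

lemma has_derivative_matrix_vector_mult:
  fixes M :: "'a::real_normed_vector \<Rightarrow> 'b::real_normed_field^'m^'n" and w :: "'a \<Rightarrow> 'b^'m"
  assumes "(M has_derivative M') (at x within S)" "(w has_derivative w') (at x within S)"
  shows "((\<lambda>x. M x *v w x) has_derivative (\<lambda>v. M x *v w' v + M' v *v w x)) (at x within S)"
proof -
  have 1: "((\<lambda>x. M x $ i $ j) has_derivative (\<lambda>v. M' v $ i $ j)) (at x within S)" for i j
    using assms(1) by (simp add: has_derivative_vec_iff)
  have 2: "((\<lambda>x. w x $ i) has_derivative (\<lambda>v. w' v $ i)) (at x within S)" for i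
    using assms(2) by (simp add: has_derivative_vec_iff)
  show ?thesis
    unfolding has_derivative_vec_iff
    by (auto simp: matrix_vector_mult_def sum.distrib[symmetric]
        intro!: has_derivative_sum has_derivative_mult 1 2)
qed

lemma has_derivative_trace:
  fixes M :: "'a::real_normed_vector \<Rightarrow> 'b::real_normed_field^'n^'n"
  assumes "(M has_derivative M') (at x within S)"
  shows "((\<lambda>x. trace (M x)) has_derivative (\<lambda>v. trace (M' v))) (at x within S)"
  unfolding trace_def using assms
  by (intro has_derivative_sum) (simp add: has_derivative_vec_iff)

lemma matrix_inv:
  fixes A :: "'a::field^'n^'n"
  assumes "invertible A"
  shows "A ** matrix_inv A = mat 1" "matrix_inv A ** A = mat 1"
  using someI_ex[OF assms[unfolded invertible_def]] unfolding matrix_inv_def by auto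

lemma matrix_inv_unique:
  fixes A :: "'a::field^'n^'n"
  assumes "A ** B = mat 1"
  shows "invertible A" "matrix_inv A = B"
proof -
  show inv: "invertible A" using assms invertible_right_inverse by blast
  have "matrix_inv A = matrix_inv A ** (A ** B)" by (simp add: assms)
  also have "\<dots> = B" by (simp add: matrix_mul_assoc matrix_inv[OF inv])
  finally show "matrix_inv A = B" .
qed

lemma has_derivative_det:
  fixes M :: "'a::real_normed_vector \<Rightarrow> 'b::real_normed_field^'n^'n"
  assumes M: "(M has_derivative M') (at x within S)"
  shows "((\<lambda>x. det (M x)) has_derivative
    (\<lambda>v. \<Sum>i\<in>UNIV. det (\<chi> r. if r = i then M' v $ i else M x $ r))) (at x within S)"
proof -
  have 1: "((\<lambda>x. M x $ i $ j) has_derivative (\<lambda>v. M' v $ i $ j)) (at x within S)" for i j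
    using M by (simp add: has_derivative_vec_iff)
  have "((\<lambda>x. det (M x)) has_derivative (\<lambda>v. \<Sum>p\<in>{p. p permutes UNIV}. of_int (sign p) *
      (\<Sum>i\<in>UNIV. M' v $ i $ p i * (\<Prod>j\<in>UNIV - {i}. M x $ j $ p j)))) (at x within S)"
    unfolding det_def
    by (intro has_derivative_sum has_derivative_mult_right has_derivative_prod 1)
  moreover have "(\<Sum>p\<in>{p. p permutes UNIV}. of_int (sign p) *
      (\<Sum>i\<in>UNIV. N $ i $ p i * (\<Prod>j\<in>UNIV - {i}. M x $ j $ p j)))
      = (\<Sum>i\<in>UNIV. det (\<chi> r. if r = i then N $ i else M x $ r))" for N
  proof -
    have p: "(\<Prod>r\<in>UNIV. (\<chi> r. if r = i then N $ i else M x $ r) $ r $ p r) =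
        N $ i $ p i * (\<Prod>j\<in>UNIV - {i}. M x $ j $ p j)" for p i
      by (subst prod.remove[of _ i]) auto
    show ?thesis unfolding det_def p sum_distrib_left
      by (rule sum.swap)
  qed
  ultimately show ?thesis by simp
qed

text \<open>
Expanding the derivative of the determinant row by row produces determinants in which one row of \<open>M\<close> is
replaced by the same row of \<open>M' = X M\<close>, that is, by a combination of all rows of \<open>M\<close>. Only the multiple
\<open>X\<^sub>i\<^sub>i\<close> of the row itself survives, so the sum is \<open>det M\<close> times the trace of \<open>X\<close>.
\<close>

lemma jacobi_formula:
  fixes M :: "'a::real_normed_vector \<Rightarrow> 'b::real_normed_field^'n^'n"
  assumes M: "(M has_derivative M') (at x within S)" and inv: "invertible (M x)"
  shows "((\<lambda>x. det (M x)) has_derivative (\<lambda>v. det (M x) * trace (matrix_inv (M x) ** M' v))) (at x within S)"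
proof -
  have "(\<Sum>i\<in>UNIV. det (\<chi> r. if r = i then N $ i else M x $ r)) =
      det (M x) * trace (matrix_inv (M x) ** N)" for N
  proof -
    define X where "X = N ** matrix_inv (M x)"
    have N: "N = X ** M x"
      unfolding X_def by (simp add: matrix_mul_assoc[symmetric] matrix_inv[OF inv])
    have "N $ i = (\<Sum>k\<in>UNIV. X $ i $ k *s row k (M x))" for i
      unfolding N by (simp add: vec_eq_iff matrix_matrix_mult_def row_def)
    hence "det (\<chi> r. if r = i then N $ i else M x $ r) = X $ i $ i * det (M x)" for i
      using cramer_lemma_transpose[of i "X $ i" "M x"] by (simp add: row_def vec_lambda_eta cong: if_cong)
    hence "(\<Sum>i\<in>UNIV. det (\<chi> r. if r = i then N $ i else M x $ r)) = det (M x) * trace X"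
      by (simp add: trace_def sum_distrib_left mult.commute)
    also have "trace X = trace (matrix_inv (M x) ** N)" unfolding X_def by (rule trace_mul_sym)
    finally show ?thesis .
  qed
  thus ?thesis using has_derivative_det[OF M] by simp
qed

lemma matrix_inv_cramer:
  fixes A :: "'a::field^'n^'n"
  assumes "invertible A"
  shows "matrix_inv A $ k $ l =
    det (\<chi> i j. if j = k then axis l 1 $ i else A $ i $ j) / det A"
proof -
  have "A *v (matrix_inv A *v axis l 1) = axis l 1"
    by (simp add: matrix_vector_mul_assoc matrix_inv[OF assms])
  hence "matrix_inv A *v axis l 1 = (\<chi> k. det (\<chi> i j. if j = k then axis l 1 $ i else A $ i $ j) / det A)"
    using cramer[of A] assms by (simp add: invertible_det_nz)
  moreover have "(matrix_inv A *v axis l 1) $ k = matrix_inv A $ k $ l"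
    by (simp add: matrix_vector_mult_def axis_def if_distrib cong: if_cong)
  ultimately show ?thesis by simp
qed

text \<open>
Cramer's rule shows that the inverse is differentiable. On a set \<open>S\<close> where derivatives may fail to be unique,
differentiating \<open>M M\<^sup>-\<^sup>1 = 1\<close> would not determine the derivative; the formula is read off instead from
\<open>M(y)\<^sup>-\<^sup>1 = M(x)\<^sup>-\<^sup>1 - M(x)\<^sup>-\<^sup>1 (M(y) - M(x)) M(y)\<^sup>-\<^sup>1\<close>, where the unknown derivative is multiplied by zero.
\<close>

lemma has_derivative_matrix_inv:
  fixes M :: "'a::real_normed_vector \<Rightarrow> 'b::real_normed_field^'n^'n"
  assumes M: "(M has_derivative M') (at x within S)" and x: "x \<in> S"
    and inv: "\<And>y. y \<in> S \<Longrightarrow> invertible (M y)"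
  shows "((\<lambda>x. matrix_inv (M x)) has_derivative
    (\<lambda>v. - (matrix_inv (M x) ** M' v ** matrix_inv (M x)))) (at x within S)"
proof -
  let ?C = "\<lambda>k l y. (\<chi> i j. if j = k then axis l 1 $ i else M y $ i $ j) :: 'b^'n^'n"
  have 1: "((\<lambda>x. M x $ i $ j) has_derivative (\<lambda>v. M' v $ i $ j)) (at x within S)" for i j
    using M by (simp add: has_derivative_vec_iff)
  have C: "(?C k l has_derivative (\<lambda>v. \<chi> i j. if j = k then 0 else M' v $ i $ j)) (at x within S)" for k l
    unfolding has_derivative_vec_iff
  proof (intro allI)
    fix i j show "((\<lambda>y. ?C k l y $ i $ j) has_derivative
        (\<lambda>v. (\<chi> i j. if j = k then 0 else M' v $ i $ j) $ i $ j)) (at x within S)"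
      using 1[of i j] by (cases "j = k") auto
  qed
  have "\<exists>D. ((\<lambda>y. matrix_inv (M y) $ k $ l) has_derivative D) (at x within S)" for k l
  proof -
    have nz: "det (M x) \<noteq> 0" using inv[OF x] by (simp add: invertible_det_nz)
    have "\<exists>D. ((\<lambda>y. det (?C k l y) / det (M y)) has_derivative D) (at x within S)"
      using has_derivative_divide[OF has_derivative_det[OF C[of k l]] has_derivative_det[OF M] nz] by blast
    then obtain D where D: "((\<lambda>y. det (?C k l y) / det (M y)) has_derivative D) (at x within S)" by blast
    have "((\<lambda>y. matrix_inv (M y) $ k $ l) has_derivative D) (at x within S)"
      by (rule has_derivative_transform[OF x _ D]) (simp add: matrix_inv_cramer[OF inv])
    thus ?thesis by blast
  qed
  then obtain D where "\<And>k l. ((\<lambda>y. matrix_inv (M y) $ k $ l) has_derivative D k l) (at x within S)"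
    by metis
  hence D: "((\<lambda>y. matrix_inv (M y)) has_derivative (\<lambda>v. \<chi> k l. D k l v)) (at x within S)"
    by (simp add: has_derivative_vec_iff)
  define E where "E = (\<lambda>v. \<chi> k l. D k l v)"
  let ?I = "matrix_inv (M x)"
  \<comment> \<open>The derivative \<open>E\<close> is known to exist; this identity determines it.\<close>
  have e: "?I - ?I ** ((M y - M x) ** matrix_inv (M y)) = matrix_inv (M y)" if "y \<in> S" for y
  proof -
    have "(M y - M x) ** matrix_inv (M y) = mat 1 - M x ** matrix_inv (M y)"
      by (simp add: matrix_diff_distribs matrix_inv[OF inv[OF that]])
    thus ?thesis by (simp add: matrix_diff_distribs matrix_mul_assoc matrix_inv[OF inv[OF x]])
  qed
  have "((\<lambda>y. ?I - ?I ** ((M y - M x) ** matrix_inv (M y))) has_derivative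
      (\<lambda>v. 0 - (?I ** ((M x - M x) ** E v + (M' v - 0) ** ?I) + 0 ** ((M x - M x) ** ?I)))) (at x within S)"
    unfolding E_def by (intro has_derivative_diff has_derivative_matrix_mult has_derivative_const M D)
  hence "((\<lambda>y. ?I - ?I ** ((M y - M x) ** matrix_inv (M y))) has_derivative
      (\<lambda>v. - (?I ** M' v ** ?I))) (at x within S)"
    by (simp add: matrix_mul_assoc)
  thus ?thesis
    by (rule has_derivative_transform[OF x, rotated]) (simp add: e)
qed


section \<open>The spectral theorem and the cubic form\<close>

lemma quadratic_le_imp_zero:
  fixes b c :: real
  assumes "\<And>t. t * b \<le> t\<^sup>2 * c"
  shows "b = 0"
proof (rule ccontr)
  assume b: "b \<noteq> 0"
  \<comment> \<open>Small enough for the linear term to win over \<open>t\<^sup>2 c\<close>.\<close>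
  define t where "t = b / (1 + \<bar>c\<bar>)"
  have "t * b \<le> t\<^sup>2 * \<bar>c\<bar>"
    using assms[of t] mult_left_mono[of c "\<bar>c\<bar>" "t\<^sup>2"] by (meson abs_ge_self order_trans zero_le_power2)
  also have "\<dots> = t * b * (\<bar>c\<bar> / (1 + \<bar>c\<bar>))"
    unfolding t_def by (simp add: power2_eq_square)
  also have "\<dots> < t * b * 1"
  proof (rule mult_strict_left_mono)
    have "t * b = b\<^sup>2 / (1 + \<bar>c\<bar>)" by (simp add: t_def power2_eq_square)
    thus "0 < t * b" using b by simp
  qed simp
  finally show False by simp
qed

lemma symmetric_inner:
  fixes a :: "real^'n^'n"
  assumes "transpose a = a"
  shows "(a *v x) \<bullet> y = x \<bullet> (a *v y)"
  using assms by (metis dot_lmul_matrix vector_transpose_matrix)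

text \<open>
A maximum of the quadratic form on the unit sphere of the orthogonal complement of \<open>B\<close> is an eigenvector:
the first variation vanishes in all directions of the complement, which \<open>a\<close> maps into itself.
\<close>

lemma eigenvector_orthogonal_to:
  fixes a :: "real^'n^'n" and B :: "(real^'n) set"
  assumes sym: "transpose a = a" and eig: "\<And>b. b \<in> B \<Longrightarrow> \<exists>l. a *v b = l *\<^sub>R b"
    and ne: "\<exists>x. x \<noteq> 0 \<and> (\<forall>b\<in>B. x \<bullet> b = 0)"
  shows "\<exists>x l. norm x = 1 \<and> (\<forall>b\<in>B. x \<bullet> b = 0) \<and> a *v x = l *\<^sub>R x"
proof -
  define V where "V = {x. \<forall>b\<in>B. x \<bullet> b = 0}"
  have V: "x + y \<in> V" "c *\<^sub>R x \<in> V" "x - y \<in> V" "a *v x \<in> V" if "x \<in> V" "y \<in> V" for x y c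
  proof -
    show "x + y \<in> V" "c *\<^sub>R x \<in> V" "x - y \<in> V" using that by (auto simp: V_def inner_left_distrib inner_diff_left)
    have "(a *v x) \<bullet> b = 0" if "b \<in> B" for b
      using eig[OF that] \<open>x \<in> V\<close> that by (auto simp: symmetric_inner[OF sym] V_def)
    thus "a *v x \<in> V" by (simp add: V_def)
  qed
  let ?Q = "\<lambda>x. x \<bullet> (a *v x)"
  have "V = (\<Inter>b\<in>B. {x. x \<bullet> b = 0})" by (auto simp: V_def)
  hence "closed V" by (auto intro!: closed_INT closed_Collect_eq continuous_intros)
  hence "compact (sphere 0 1 \<inter> V)" by (intro compact_Int_closed) auto
  moreover have "sphere 0 1 \<inter> V \<noteq> {}"
  proof -
    obtain x where "x \<noteq> 0" "x \<in> V" using ne by (auto simp: V_def)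
    hence "(1 / norm x) *\<^sub>R x \<in> sphere 0 1 \<inter> V" using V(2) by auto
    thus ?thesis by blast
  qed
  moreover have "continuous_on (sphere 0 1 \<inter> V) ?Q"
    by (intro continuous_intros linear_continuous_on) (simp add: matrix_vector_mul_bounded_linear)
  ultimately obtain x where "x \<in> sphere 0 1 \<inter> V" "\<forall>y\<in>sphere 0 1 \<inter> V. ?Q y \<le> ?Q x"
    using continuous_attains_sup[of "sphere 0 1 \<inter> V" ?Q] by blast
  hence x: "norm x = 1" "x \<in> V" and max: "\<And>y. norm y = 1 \<Longrightarrow> y \<in> V \<Longrightarrow> ?Q y \<le> ?Q x"
    by auto
  define l where "l = ?Q x"
  have le: "?Q y \<le> l * (y \<bullet> y)" if y: "y \<in> V" for y
  proof (cases "y = 0")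
    case False
    have "?Q ((1 / norm y) *\<^sub>R y) \<le> l"
      unfolding l_def using False y V(2) by (intro max) auto
    hence "?Q y / (norm y * norm y) \<le> l" by (simp add: matrix_vector_mult_scaleR)
    thus ?thesis using False by (simp add: field_simps power2_norm_eq_inner[symmetric] power2_eq_square)
  qed simp
  have xx: "x \<bullet> x = 1" using x(1) by (simp add: norm_eq_1)
  have orth: "(a *v x - l *\<^sub>R x) \<bullet> y = 0" if y: "y \<in> V" for y
  proof (rule quadratic_le_imp_zero)
    fix t
    have "?Q (x + (t/2) *\<^sub>R y) \<le> l * ((x + (t/2) *\<^sub>R y) \<bullet> (x + (t/2) *\<^sub>R y))"
      by (intro le V(1) x V(2)[OF y y])
    moreover have "x \<bullet> (a *v y) = (a *v x) \<bullet> y" by (simp add: symmetric_inner[OF sym])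
    moreover have "y \<bullet> (a *v x) = (a *v x) \<bullet> y" by (rule inner_commute)
    ultimately show "t * ((a *v x - l *\<^sub>R x) \<bullet> y) \<le> t\<^sup>2 * ((l * (y \<bullet> y) - ?Q y) / 4)"
      by (simp add: matrix_vector_right_distrib matrix_vector_mult_scaleR inner_left_distrib inner_right_distrib
        inner_diff_left xx l_def[symmetric] inner_commute[of y x] algebra_simps power2_eq_square)
  qed
  have "a *v x - l *\<^sub>R x \<in> V" using V x by blast
  from orth[OF this] have "a *v x = l *\<^sub>R x" by simp
  thus ?thesis using x by (auto simp: V_def)
qed

text \<open>
Unit eigenvectors are added one at a time, each orthogonal to the previous ones, until they fill the space.
\<close>

theorem symmetric_eigenbasis:
  fixes a :: "real^'n^'n"
  assumes sym: "transpose a = a"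
  obtains q :: "'n \<Rightarrow> real^'n" and l where "\<And>i j. q i \<bullet> q j = (if i = j then 1 else 0)" "\<And>i. a *v q i = l i *\<^sub>R q i"
proof -
  have "\<exists>B. finite B \<and> card B = k \<and> pairwise orthogonal B \<and>
      (\<forall>b\<in>B. norm b = 1 \<and> (\<exists>l. a *v b = l *\<^sub>R b))" if "k \<le> CARD('n)" for k
    using that
  proof (induction k)
    case (Suc k)
    then obtain B where B: "finite B" "card B = k" "pairwise orthogonal B"
      "\<And>b. b \<in> B \<Longrightarrow> norm b = 1" "\<And>b. b \<in> B \<Longrightarrow> \<exists>l. a *v b = l *\<^sub>R b" by auto
    have "dim B < DIM(real^'n)" using dim_le_card'[OF B(1)] B(2) Suc.prems by simp
    then obtain x where "x \<noteq> 0" "\<And>y. y \<in> span B \<Longrightarrow> orthogonal x y"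
      using orthogonal_to_subspace_exists by blast
    hence "\<exists>x. x \<noteq> 0 \<and> (\<forall>b\<in>B. x \<bullet> b = 0)" by (auto simp: orthogonal_def span_base)
    from eigenvector_orthogonal_to[OF sym B(5) this] obtain x l
      where x: "norm x = 1" "\<And>b. b \<in> B \<Longrightarrow> x \<bullet> b = 0" "a *v x = l *\<^sub>R x" by blast
    have "pairwise (\<lambda>x y. x \<bullet> y = 0) B" using B(3) by (simp add: orthogonal_def[abs_def])
    moreover have "x \<notin> B" using x(1,2) by (metis norm_eq_1 zero_neq_one)
    ultimately show ?case using B x
      by (intro exI[of _ "insert x B"]) (auto simp: pairwise_insert orthogonal_def inner_commute[of _ x])
  qed (intro exI[of _ "{}"], auto)
  from this[of "CARD('n)"] obtain B :: "(real^'n) set" where B: "finite B" "card B = CARD('n)" "pairwise orthogonal B"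
    "\<And>b. b \<in> B \<Longrightarrow> norm b = 1" "\<And>b. b \<in> B \<Longrightarrow> \<exists>l. a *v b = l *\<^sub>R b" by auto
  obtain q where q: "bij_betw q (UNIV :: 'n set) B"
    using finite_same_card_bij[of "UNIV :: 'n set" B] B by auto
  obtain L where L: "\<And>b. b \<in> B \<Longrightarrow> a *v b = L b *\<^sub>R b" using B(5) by metis
  have qB: "q i \<in> B" for i using q by (auto simp: bij_betw_def)
  show ?thesis
  proof (rule that[of q "L \<circ> q"])
    fix i j
    show "q i \<bullet> q j = (if i = j then 1 else 0)"
    proof (cases "i = j")
      case False
      hence "q i \<noteq> q j" using q by (auto simp: bij_betw_def inj_on_def)
      thus ?thesis using B(3) qB False by (auto simp: pairwise_def orthogonal_def)
    qed (use B(4)[OF qB] in \<open>simp add: norm_eq_1\<close>)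
  qed (simp add: L[OF qB])
qed

definition frame_matrix :: "('n \<Rightarrow> real^'n) \<Rightarrow> real^'n^'n" where
  "frame_matrix q = (\<chi> i j. q j $ i)"

lemma orthonormal_frame_matrix:
  fixes q :: "'n \<Rightarrow> real^'n"
  assumes "\<And>i j. q i \<bullet> q j = (if i = j then 1 else 0)"
  shows "transpose (frame_matrix q) ** frame_matrix q = mat 1" "frame_matrix q ** transpose (frame_matrix q) = mat 1"
proof -
  show *: "transpose (frame_matrix q) ** frame_matrix q = mat 1"
    using assms by (simp add: frame_matrix_def transpose_def matrix_matrix_mult_def vec_eq_iff mat_def inner_vec_def)
  show "frame_matrix q ** transpose (frame_matrix q) = mat 1"
    using * matrix_left_right_inverse by blast
qed

lemma orthonormal_entry:
  fixes X :: "real^'n^'n"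
  shows
  "(transpose (frame_matrix q) ** X ** frame_matrix q) $ i $ j = q i \<bullet> (X *v q j)"
proof -
  have "transpose (frame_matrix q) ** X ** frame_matrix q = transpose (frame_matrix q) ** (X ** frame_matrix q)"
    by (simp add: matrix_mul_assoc)
  thus ?thesis
  by (simp add: frame_matrix_def transpose_def matrix_matrix_mult_def matrix_vector_mult_def inner_vec_def)
qed

lemma eigenvalues_eigenbasis:
  fixes a :: "real^'n^'n" and q :: "'n \<Rightarrow> real^'n"
  assumes q: "\<And>i j. q i \<bullet> q j = (if i = j then 1 else 0)" and l: "\<And>i. a *v q i = l i *\<^sub>R q i"
  shows "eigenvalues a = image_mset l (mset_set UNIV)"
proof -
  let ?Q = "frame_matrix q"
  have "poly (charpoly a) x = poly (\<Prod>i\<in>UNIV. [:- l i, 1:]) x" for x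
  proof -
    have dQ: "det (transpose ?Q) * det ?Q = 1"
      using orthonormal_frame_matrix(1)[of q, OF q] by (metis det_I det_mul)
    have "det (mat x - a) = det (transpose ?Q) * det (mat x - a) * det ?Q" using dQ by (simp add: mult_ac)
    also have "\<dots> = det (transpose ?Q ** (mat x - a) ** ?Q)" by (simp add: det_mul)
    also have "transpose ?Q ** (mat x - a) ** ?Q = (\<chi> i j. if i = j then x - l i else 0)"
    proof -
      have *: "mat x *v v = x *\<^sub>R v" for v :: "real^'n"
        by (simp add: vec_eq_iff matrix_vector_mult_def mat_def if_distrib if_distribR cong: if_cong)
      thus ?thesis
        by (simp add: vec_eq_iff[where 'b = 'n] orthonormal_entry matrix_vector_mult_diff_rdistrib l inner_diff_right q *)
    qed
    also have "det \<dots> = (\<Prod>i\<in>UNIV. x - l i)" by (subst det_diagonal) auto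
    finally show ?thesis by (simp add: poly_charpoly poly_prod)
  qed
  hence "charpoly a = (\<Prod>i\<in>UNIV. [:- l i, 1:])" by (simp add: poly_eq_poly_eq_iff[symmetric] fun_eq_iff)
  moreover have "proots (\<Prod>i\<in>S. [:- l i, 1:]) = image_mset l (mset_set S)" if "finite S" for S
    using that
  proof (induction S)
    case (insert i S)
    have "(\<Prod>i\<in>S. [:- l i, 1:]) \<noteq> 0" using insert by auto
    with insert show ?case by (simp add: proots_mult del: mult_pCons_left)
  qed simp
  ultimately show ?thesis by (simp add: eigenvalues_def)
qed

text \<open>
Connects the eigenbasis with the multiset that occurs in the definition of 2-convexity.
\<close>

lemma eigenvalue_pair:
  fixes a :: "real^'n^'n" and q :: "'n \<Rightarrow> real^'n"
  assumes q: "\<And>i j. q i \<bullet> q j = (if i = j then 1 else 0)" and l: "\<And>i. a *v q i = l i *\<^sub>R q i" and "i \<noteq> j"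
  shows "{#l i, l j#} \<subseteq># eigenvalues a"
proof -
  have "{#i, j#} \<subseteq># mset_set UNIV"
    using subset_imp_msubset_mset_set[of "{i, j}" "UNIV :: 'n set"] \<open>i \<noteq> j\<close> by simp
  from image_mset_subseteq_mono[OF this, of l] show ?thesis
    by (simp add: eigenvalues_eigenbasis[OF q l])
qed


lemma trace_eigenbasis:
  fixes q :: "'n \<Rightarrow> real^'n"
  assumes q: "\<And>i j. q i \<bullet> q j = (if i = j then 1 else 0)"
  shows "trace X = (\<Sum>i\<in>UNIV. q i \<bullet> (X *v q i))"
proof -
  let ?Q = "frame_matrix q"
  have "(\<Sum>i\<in>UNIV. q i \<bullet> (X *v q i)) = trace (transpose ?Q ** X ** ?Q)"
    unfolding trace_def orthonormal_entry ..
  also have "\<dots> = trace (?Q ** (transpose ?Q ** X))" by (rule trace_mul_sym)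
  also have "\<dots> = trace X"
    by (simp add: matrix_mul_assoc orthonormal_frame_matrix(2)[of q, OF q])
  finally show ?thesis ..
qed

lemma entry_mult_eigenbasis:
  fixes q :: "'n \<Rightarrow> real^'n"
  assumes q: "\<And>i j. q i \<bullet> q j = (if i = j then 1 else 0)"
  shows "q i \<bullet> ((X ** Y) *v q j) = (\<Sum>k\<in>UNIV. (q i \<bullet> (X *v q k)) * (q k \<bullet> (Y *v q j)))"
proof -
  let ?Q = "frame_matrix q"
  have "transpose ?Q ** (X ** Y) ** ?Q = transpose ?Q ** X ** (?Q ** transpose ?Q) ** Y ** ?Q"
    by (simp add: matrix_mul_assoc orthonormal_frame_matrix(2)[of q, OF q])
  also have "\<dots> = (transpose ?Q ** X ** ?Q) ** (transpose ?Q ** Y ** ?Q)"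
    by (simp add: matrix_mul_assoc)
  finally have "(transpose ?Q ** (X ** Y) ** ?Q) $ i $ j =
      ((transpose ?Q ** X ** ?Q) ** (transpose ?Q ** Y ** ?Q)) $ i $ j" by simp
  thus ?thesis
    by (simp only: orthonormal_entry) (simp add: matrix_matrix_mult_def[of "transpose ?Q ** X ** ?Q"] orthonormal_entry)
qed

text \<open>
Contracting a bilinear form with \<open>M = \<Sum> m\<^sub>c q\<^sub>c q\<^sub>c\<^sup>T\<close> evaluates it on the pairs \<open>(q\<^sub>c, q\<^sub>c)\<close>. All contractions with
\<open>G\<close> and \<open>G a\<close> below are brought to diagonal form in this way.
\<close>

lemma bilinear_contraction_eigenbasis:
  fixes q :: "'n \<Rightarrow> real^'n" and B :: "real^'n \<Rightarrow> real^'n \<Rightarrow> real"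
  assumes q: "\<And>i j. q i \<bullet> q j = (if i = j then 1 else 0)"
    and M: "\<And>i. M *v q i = m i *\<^sub>R q i" and B: "bilinear B"
  shows "(\<Sum>k\<in>UNIV. \<Sum>l\<in>UNIV. M $ k $ l * B (axis k 1) (axis l 1)) = (\<Sum>c\<in>UNIV. m c * B (q c) (q c))"
proof -
  let ?Q = "frame_matrix q"
  have e: "v = (\<Sum>k\<in>UNIV. (v $ k) *\<^sub>R axis k 1)" for v :: "real^'n"
    using basis_expansion[of v] by (simp add: scalar_mult_eq_scaleR)
  have "M ** ?Q = (\<chi> i j. m j * q j $ i)"
  proof -
    have "(M ** ?Q) $ i $ j = (M *v q j) $ i" for i j
      by (simp add: frame_matrix_def matrix_matrix_mult_def matrix_vector_mult_def)
    thus ?thesis by (simp add: vec_eq_iff M)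
  qed
  moreover have "M = M ** ?Q ** transpose ?Q"
    by (simp add: matrix_mul_assoc[symmetric] orthonormal_frame_matrix(2)[of q, OF q])
  ultimately have "M = (\<chi> i j. m j * q j $ i) ** transpose ?Q" by simp
  hence "M $ k $ l = ((\<chi> i j. m j * q j $ i) ** transpose ?Q) $ k $ l" for k l by simp
  hence Mkl: "M $ k $ l = (\<Sum>c\<in>UNIV. m c * q c $ k * q c $ l)" for k l
    by (simp add: matrix_matrix_mult_def transpose_def frame_matrix_def)
  have Bq: "B v w = (\<Sum>k\<in>UNIV. \<Sum>l\<in>UNIV. v $ k * w $ l * B (axis k 1) (axis l 1))" for v w
  proof -
    have "B v w = B (\<Sum>k\<in>UNIV. (v $ k) *\<^sub>R axis k 1) (\<Sum>l\<in>UNIV. (w $ l) *\<^sub>R axis l 1)"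
      using e by metis
    also have "\<dots> = (\<Sum>(k, l)\<in>UNIV \<times> UNIV. B ((v $ k) *\<^sub>R axis k 1) ((w $ l) *\<^sub>R axis l 1))"
      by (rule bilinear_sum[OF B])
    finally show ?thesis
      by (simp add: sum.cartesian_product bilinear_lmul[OF B] bilinear_rmul[OF B] mult_ac)
  qed
  have "(\<Sum>k\<in>UNIV. \<Sum>l\<in>UNIV. M $ k $ l * B (axis k 1) (axis l 1)) =
      (\<Sum>k\<in>UNIV. \<Sum>l\<in>UNIV. \<Sum>c\<in>UNIV. m c * (q c $ k * q c $ l * B (axis k 1) (axis l 1)))"
    by (simp add: Mkl sum_distrib_right mult.assoc)
  also have "\<dots> = (\<Sum>k\<in>UNIV. \<Sum>c\<in>UNIV. \<Sum>l\<in>UNIV. m c * (q c $ k * q c $ l * B (axis k 1) (axis l 1)))"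
    by (intro sum.cong refl sum.swap)
  also have "\<dots> = (\<Sum>c\<in>UNIV. \<Sum>k\<in>UNIV. \<Sum>l\<in>UNIV. m c * (q c $ k * q c $ l * B (axis k 1) (axis l 1)))"
    by (rule sum.swap)
  also have "\<dots> = (\<Sum>c\<in>UNIV. m c * B (q c) (q c))"
    by (simp add: Bq[of "q _"] sum_distrib_left)
  finally show ?thesis .
qed

lemma det_sum_square_pos:
  fixes a :: "real^'n^'n"
  assumes sym: "transpose a = a"
  shows "det (mat 1 + a ** a) > 0"
proof -
  have "(\<Prod>r\<in>#R. 1 + r\<^sup>2) > 0" for R :: "real multiset"
    by (induction R) (auto intro!: mult_pos_pos add_pos_nonneg)
  thus ?thesis using det_one_plus_square[OF sym, of 1] by simp
qed

text \<open>
With \<open>w\<^sub>c\<^sub>i\<^sub>j = g\<^sub>c g\<^sub>i g\<^sub>j x\<^sub>i\<^sub>j\<^sub>c\<^sup>2\<close> the left-hand side is the sum of \<open>w\<^sub>c\<^sub>i\<^sub>j (1 + \<lambda>\<^sub>c\<lambda>\<^sub>i + \<lambda>\<^sub>c\<lambda>\<^sub>j - \<lambda>\<^sub>i\<lambda>\<^sub>j)\<close>. As \<open>w\<close> is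
symmetric in all indices, the three products have the same sum, so the bracket may be replaced by
\<open>1 + \<lambda>\<^sub>i\<lambda>\<^sub>j\<close>. Its terms with \<open>i \<noteq> j\<close> are dropped, and Cauchy-Schwarz is applied to those with \<open>i = j\<close>.
\<close>

lemma cubic_form_inequality:
  fixes x :: "'n::finite \<Rightarrow> 'n \<Rightarrow> 'n \<Rightarrow> real" and l :: "'n \<Rightarrow> real"
  assumes sym: "\<And>i j c. x i j c = x j i c" "\<And>i j c. x i j c = x i c j"
    and cvx: "\<forall>i j. i \<noteq> j \<longrightarrow> 1 + l i * l j \<ge> 0"
  defines "g \<equiv> \<lambda>i. 1 / (1 + (l i)\<^sup>2)"
  shows "(\<Sum>c\<in>UNIV. \<Sum>i\<in>UNIV. \<Sum>j\<in>UNIV. g c * l c * (g i * (l i + l j) * g j * (x i j c)\<^sup>2)) +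
     (\<Sum>c\<in>UNIV. \<Sum>i\<in>UNIV. \<Sum>j\<in>UNIV. g c * (g i * (x i j c)\<^sup>2 - g i * (l i + l j) * g j * l j * (x i j c)\<^sup>2))
     \<ge> 1 / real CARD('n) * (\<Sum>c\<in>UNIV. g c * (\<Sum>i\<in>UNIV. g i * l i * x i i c)\<^sup>2)"
proof -
  have pos: "1 + (l i)\<^sup>2 > 0" for i by (simp add: add_pos_nonneg)
  have g: "g i > 0" "g i * (1 + (l i)\<^sup>2) = 1" for i using pos[of i] by (auto simp: g_def)
  define w where "w c i j = g c * g i * g j * (x i j c)\<^sup>2" for c i j
  have w: "w c i j = w c j i" "w c i j = w i c j" for c i j
    using sym unfolding w_def by (simp_all add: mult_ac)
  have w0: "w c i j \<ge> 0" for c i j using g by (simp add: w_def less_imp_le)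
  have s: "(\<Sum>c\<in>UNIV. \<Sum>i\<in>UNIV. \<Sum>j\<in>UNIV. w c i j * (l c * l i)) =
      (\<Sum>c\<in>UNIV. \<Sum>i\<in>UNIV. \<Sum>j\<in>UNIV. w c i j * (l c * l j))"
  proof (rule sum.cong[OF refl])
    fix c
    have "(\<Sum>i\<in>UNIV. \<Sum>j\<in>UNIV. w c i j * (l c * l i)) = (\<Sum>i\<in>UNIV. \<Sum>j\<in>UNIV. w c j i * (l c * l i))"
      by (simp add: w(1))
    also have "\<dots> = (\<Sum>i\<in>UNIV. \<Sum>j\<in>UNIV. w c i j * (l c * l j))" by (rule sum.swap)
    finally show "(\<Sum>i\<in>UNIV. \<Sum>j\<in>UNIV. w c i j * (l c * l i)) = (\<Sum>i\<in>UNIV. \<Sum>j\<in>UNIV. w c i j * (l c * l j))" .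
  qed
  have "(\<Sum>c\<in>UNIV. \<Sum>i\<in>UNIV. \<Sum>j\<in>UNIV. w c i j * (l i * l j)) =
      (\<Sum>i\<in>UNIV. \<Sum>c\<in>UNIV. \<Sum>j\<in>UNIV. w c i j * (l i * l j))" by (rule sum.swap)
  also have "\<dots> = (\<Sum>i\<in>UNIV. \<Sum>c\<in>UNIV. \<Sum>j\<in>UNIV. w i c j * (l i * l j))"
    by (simp add: w(2)[of _ _ _])
  finally have s2: "(\<Sum>c\<in>UNIV. \<Sum>i\<in>UNIV. \<Sum>j\<in>UNIV. w c i j * (l i * l j)) =
      (\<Sum>c\<in>UNIV. \<Sum>i\<in>UNIV. \<Sum>j\<in>UNIV. w c i j * (l c * l j))" .
  have t: "g c * l c * (g i * (l i + l j) * g j * (x i j c)\<^sup>2) +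
      g c * (g i * (x i j c)\<^sup>2 - g i * (l i + l j) * g j * l j * (x i j c)\<^sup>2) =
      w c i j + w c i j * (l c * l i) + w c i j * (l c * l j) - w c i j * (l i * l j)" for c i j
  proof -
    \<comment> \<open>Makes the only term with two factors \<open>g\<close> homogeneous with the others.\<close>
    have "g c * g i * (x i j c)\<^sup>2 = g c * g i * (x i j c)\<^sup>2 * (g j * (1 + (l j)\<^sup>2))" by (simp add: g)
    thus ?thesis by (simp add: w_def algebra_simps power2_eq_square)
  qed
  have "(\<Sum>c\<in>UNIV. \<Sum>i\<in>UNIV. \<Sum>j\<in>UNIV. g c * l c * (g i * (l i + l j) * g j * (x i j c)\<^sup>2)) +
     (\<Sum>c\<in>UNIV. \<Sum>i\<in>UNIV. \<Sum>j\<in>UNIV. g c * (g i * (x i j c)\<^sup>2 - g i * (l i + l j) * g j * l j * (x i j c)\<^sup>2))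
    = (\<Sum>c\<in>UNIV. \<Sum>i\<in>UNIV. \<Sum>j\<in>UNIV. w c i j + w c i j * (l c * l i) + w c i j * (l c * l j) - w c i j * (l i * l j))"
    unfolding t[symmetric] by (simp only: sum.distrib)
  also have "\<dots> = (\<Sum>c\<in>UNIV. \<Sum>i\<in>UNIV. \<Sum>j\<in>UNIV. w c i j + w c i j * (l i * l j))"
    unfolding sum.distrib sum_subtractf s s2 by simp
  also have "\<dots> \<ge> (\<Sum>c\<in>UNIV. \<Sum>i\<in>UNIV. \<Sum>j\<in>UNIV. if i = j then w c i i * (1 + (l i)\<^sup>2) else 0)"
  proof (intro sum_mono)
    fix c i j
    have "w c i j * (1 + l i * l j) \<ge> 0" if "i \<noteq> j" using cvx that w0 by simp
    thus "(if i = j then w c i i * (1 + (l i)\<^sup>2) else 0) \<le> w c i j + w c i j * (l i * l j)"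
      by (auto simp: algebra_simps power2_eq_square)
  qed
  also have "(\<Sum>c\<in>UNIV. \<Sum>i\<in>UNIV. \<Sum>j\<in>UNIV. if i = j then w c i i * (1 + (l i)\<^sup>2) else 0) =
     (\<Sum>c\<in>UNIV. \<Sum>i\<in>UNIV. w c i i * (1 + (l i)\<^sup>2))"
    by simp
  also have "\<dots> \<ge> (\<Sum>c\<in>UNIV. 1 / real CARD('n) * (g c * (\<Sum>i\<in>UNIV. g i * l i * x i i c)\<^sup>2))"
  proof (rule sum_mono)
    fix c
    have "(\<Sum>i\<in>UNIV. g i * l i * x i i c)\<^sup>2 \<le> real CARD('n) * (\<Sum>i\<in>UNIV. (g i * l i * x i i c)\<^sup>2)"
      using sum_squared_le_sum_of_squares[of "\<lambda>i. g i * l i * x i i c" UNIV] by (simp add: mult.commute)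
    hence "1 / real CARD('n) * (g c * (\<Sum>i\<in>UNIV. g i * l i * x i i c)\<^sup>2) \<le> g c * (\<Sum>i\<in>UNIV. (g i * l i * x i i c)\<^sup>2)"
      using g(1)[of c] by (simp add: field_simps)
    also have "\<dots> \<le> (\<Sum>i\<in>UNIV. w c i i * (1 + (l i)\<^sup>2))"
      unfolding sum_distrib_left
    proof (rule sum_mono)
      fix i
      have "(g i * l i * x i i c)\<^sup>2 \<le> g i * g i * (x i i c)\<^sup>2 * (1 + (l i)\<^sup>2)"
      proof -
        have "g i * g i * (x i i c)\<^sup>2 \<ge> 0" using g(1)[of i] by simp
        thus ?thesis by (simp add: power_mult_distrib algebra_simps power2_eq_square)
      qed
      from mult_left_mono[OF this, of "g c"] show "g c * (g i * l i * x i i c)\<^sup>2 \<le> w c i i * (1 + (l i)\<^sup>2)"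
        using g(1)[of c] by (simp add: w_def mult_ac)
    qed
    finally show "1 / real CARD('n) * (g c * (\<Sum>i\<in>UNIV. g i * l i * x i i c)\<^sup>2) \<le> (\<Sum>i\<in>UNIV. w c i i * (1 + (l i)\<^sup>2))" .
  qed
  finally show ?thesis by (simp add: sum_distrib_left)
qed


lemma entry_mult_diagonal:
  fixes q :: "'n \<Rightarrow> real^'n"
  assumes q: "\<And>i j. q i \<bullet> q j = (if i = j then 1 else 0)" and D: "\<And>i. D *v q i = d i *\<^sub>R q i"
  shows "q i \<bullet> ((X ** D) *v q j) = (q i \<bullet> (X *v q j)) * d j"
    "q i \<bullet> ((D ** X) *v q j) = d i * (q i \<bullet> (X *v q j))"
  by (simp_all add: entry_mult_eigenbasis[OF q] D q if_distrib if_distribR cong: if_cong)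

text \<open>
The preceding inequality in invariant form. Here \<open>a\<close> stands for \<open>D\<^sup>2u\<close> at a point and \<open>h v\<close> for its
derivative in the direction \<open>v\<close>, so that symmetry of \<open>h v\<close> and \<open>h v w = h w v\<close> express the total symmetry
of \<open>D\<^sup>3u\<close>. The two sums on the left arise from \<open>w\<^sub>t\<close> and from \<open>tr (G D\<^sup>2w)\<close>.
\<close>

lemma symmetric_contraction_inequality:
  fixes a :: "real^'n^'n" and h :: "real^'n \<Rightarrow> real^'n^'n"
  assumes sym: "transpose a = a" and h: "linear h" and hsym: "\<And>v. transpose (h v) = h v"
    and hcom: "\<And>v w. h v *v w = h w *v v"
    and cvx: "\<forall>l m. {#l, m#} \<subseteq># eigenvalues a \<longrightarrow> 1 + l * m \<ge> 0"
  defines "G \<equiv> matrix_inv (mat 1 + a ** a)"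
  shows "(\<Sum>k\<in>UNIV. \<Sum>l\<in>UNIV. (G ** a) $ k $ l *
        trace (G ** (h (axis l 1) ** a + a ** h (axis l 1)) ** G ** h (axis k 1))) +
     (\<Sum>k\<in>UNIV. \<Sum>l\<in>UNIV. G $ k $ l *
        trace ((G ** h (axis l 1) - G ** (h (axis l 1) ** a + a ** h (axis l 1)) ** G ** a) ** h (axis k 1)))
     \<ge> 1 / real CARD('n) * (\<Sum>k\<in>UNIV. \<Sum>l\<in>UNIV. G $ k $ l *
        (trace (G ** a ** h (axis k 1)) * trace (G ** a ** h (axis l 1))))"
proof -
  obtain q :: "'n \<Rightarrow> real^'n" and l where q: "\<And>i j. q i \<bullet> q j = (if i = j then 1 else 0)"
    and l: "\<And>i. a *v q i = l i *\<^sub>R q i"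
    using symmetric_eigenbasis[OF sym] by blast
  define g where "g i = 1 / (1 + (l i)\<^sup>2)" for i
  have "invertible (mat 1 + a ** a)"
    using det_sum_square_pos[OF sym] by (simp add: invertible_det_nz)
  hence inv: "G ** (mat 1 + a ** a) = mat 1"
    unfolding G_def by (rule matrix_inv(2))
  have Gq: "G *v q i = g i *\<^sub>R q i" for i
  proof -
    have pos: "1 + (l i)\<^sup>2 > 0" by (simp add: add_pos_nonneg)
    have "(mat 1 + a ** a) *v q i = (1 + (l i)\<^sup>2) *\<^sub>R q i"
      by (simp add: matrix_vector_mult_add_rdistrib matrix_vector_mul_assoc[symmetric] l
        matrix_vector_mult_scaleR scaleR_left_distrib power2_eq_square)
    hence "(1 + (l i)\<^sup>2) *\<^sub>R (G *v q i) = G *v ((mat 1 + a ** a) *v q i)"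
      by (simp add: matrix_vector_mult_scaleR)
    also have "\<dots> = q i" by (simp add: matrix_vector_mul_assoc inv)
    finally have "g i *\<^sub>R ((1 + (l i)\<^sup>2) *\<^sub>R (G *v q i)) = g i *\<^sub>R q i" by simp
    thus ?thesis using pos by (simp add: g_def)
  qed
  have Gaq: "(G ** a) *v q i = (g i * l i) *\<^sub>R q i" for i
    by (simp add: matrix_vector_mul_assoc[symmetric] l Gq matrix_vector_mult_scaleR mult.commute)
  note E = entry_mult_diagonal[where D = G, OF q Gq] entry_mult_diagonal[where D = a, OF q l]
  define x where "x i j c = q i \<bullet> (h (q c) *v q j)" for i j c
  have xs: "x i j c = x j i c" "x i j c = x i c j" for i j c
  proof -
    show "x i j c = x j i c"
      unfolding x_def using symmetric_inner[OF hsym, of "q c" "q i" "q j"] by (simp add: inner_commute)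
    show "x i j c = x i c j" unfolding x_def by (simp add: hcom)
  qed
  note lin = linear_add[OF h] linear_scale[OF h]
  note alg = matrix_add_ldistrib matrix_add_rdistrib matrix_diff_distribs scaleR_matrix_mult
    trace_add trace_sub trace_scaleR scaleR_right_diff_distrib[symmetric]
  have B1: "bilinear (\<lambda>v w. trace (G ** (h w ** a + a ** h w) ** G ** h v))"
    unfolding bilinear_def linear_iff by (simp add: lin alg algebra_simps)
  have B2: "bilinear (\<lambda>v w. trace ((G ** h w - G ** (h w ** a + a ** h w) ** G ** a) ** h v))"
    unfolding bilinear_def linear_iff by (simp add: lin alg algebra_simps)
  have B3: "bilinear (\<lambda>v w. trace (G ** a ** h v) * trace (G ** a ** h w))"
    unfolding bilinear_def linear_iff by (simp add: lin alg algebra_simps)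
  have 1: "trace (G ** (h (q c) ** a + a ** h (q c)) ** G ** h (q c)) =
      (\<Sum>i\<in>UNIV. \<Sum>j\<in>UNIV. g i * (l i + l j) * g j * (x i j c)\<^sup>2)" for c
    unfolding trace_eigenbasis[OF q] entry_mult_eigenbasis[OF q, where X = "G ** (h (q c) ** a + a ** h (q c)) ** G"]
      E matrix_vector_mult_add_rdistrib inner_right_distrib x_def[symmetric]
    by (intro sum.cong refl) (simp add: xs(1) power2_eq_square algebra_simps)
  have 2: "trace ((G ** h (q c) - G ** (h (q c) ** a + a ** h (q c)) ** G ** a) ** h (q c)) =
      (\<Sum>i\<in>UNIV. \<Sum>j\<in>UNIV. g i * (x i j c)\<^sup>2 - g i * (l i + l j) * g j * l j * (x i j c)\<^sup>2)" for c
    unfolding trace_eigenbasis[OF q] entry_mult_eigenbasis[OF q, where X = "G ** h (q c) - G ** (h (q c) ** a + a ** h (q c)) ** G ** a"]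
      E matrix_vector_mult_add_rdistrib matrix_vector_mult_diff_rdistrib inner_right_distrib inner_diff_right x_def[symmetric]
    by (intro sum.cong refl) (simp add: xs(1) power2_eq_square algebra_simps)
  have 3: "trace (G ** a ** h (q c)) = (\<Sum>i\<in>UNIV. g i * l i * x i i c)" for c
    unfolding trace_eigenbasis[OF q] matrix_mul_assoc[symmetric] E x_def[symmetric] by (simp add: mult.assoc)
  have "\<forall>i j. i \<noteq> j \<longrightarrow> 1 + l i * l j \<ge> 0"
    using cvx eigenvalue_pair[OF q l] by blast
  from cubic_form_inequality[of x l, OF xs this, folded g_def]
  show ?thesis
    unfolding bilinear_contraction_eigenbasis[OF q Gaq B1] bilinear_contraction_eigenbasis[OF q Gq B2]
      bilinear_contraction_eigenbasis[OF q Gq B3] 1 2 3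
    by (simp only: sum_distrib_left power2_eq_square)
qed


section \<open>Symmetry of mixed derivatives up to the initial time\<close>

lemma Ck_on_cong:
  assumes "Ck_on k f S" "\<And>x. x \<in> S \<Longrightarrow> g x = f x"
  shows "Ck_on k g S"
proof (cases k)
  case 0
  with assms show ?thesis using continuous_on_eq[of S f g] by fastforce
next
  case (Suc m)
  then obtain f' where f': "\<And>x. x \<in> S \<Longrightarrow> (f has_derivative f' x) (at x within S)"
    "\<And>v. Ck_on m (\<lambda>x. f' x v) S" using assms by auto
  have "(g has_derivative f' x) (at x within S)" if "x \<in> S" for x
    using has_derivative_transform[OF that assms(2) f'(1)[OF that]] .
  thus ?thesis using Suc f' by auto
qed

lemma Ck_on_bounded_linear:
  assumes "bounded_linear L" "Ck_on k f S"
  shows "Ck_on k (\<lambda>x. L (f x)) S"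
  using assms(2)
proof (induction k arbitrary: f)
  case 0
  thus ?case using bounded_linear.continuous_on[OF assms(1)] by simp
next
  case (Suc k)
  then obtain f' where f': "\<And>x. x \<in> S \<Longrightarrow> (f has_derivative f' x) (at x within S)"
    "\<And>v. Ck_on k (\<lambda>x. f' x v) S" by auto
  have "((\<lambda>x. L (f x)) has_derivative (\<lambda>v. L (f' x v))) (at x within S)" if "x \<in> S" for x
    by (rule bounded_linear.has_derivative[OF assms(1) f'(1)[OF that]])
  moreover have "Ck_on k (\<lambda>x. L (f' x v)) S" for v by (rule Suc.IH[OF f'(2)])
  ultimately show ?case by (auto intro!: exI[of _ "\<lambda>x v. L (f' x v)"])
qed

lemma smooth_on_bounded_linear:
  "bounded_linear L \<Longrightarrow> smooth_on f S \<Longrightarrow> smooth_on (\<lambda>x. L (f x)) S"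
  by (simp add: smooth_on_def Ck_on_bounded_linear)

text \<open>
A condition under which a derivative within \<open>S\<close> is unique. It holds on the half-open slab of space and
time, whose points at the initial time are not interior.
\<close>

definition axis_approachable :: "'a::euclidean_space set \<Rightarrow> bool" where
  "axis_approachable S \<longleftrightarrow>
     (\<forall>x\<in>S. \<forall>b\<in>Basis. \<forall>e>0. \<exists>d. 0 < \<bar>d\<bar> \<and> \<bar>d\<bar> < e \<and> x + d *\<^sub>R b \<in> S)"

lemma axis_approachable_UNIV: "axis_approachable UNIV"
  unfolding axis_approachable_def
proof (intro ballI allI impI)
  fix x b :: 'a and e :: real
  assume "e > 0"
  thus "\<exists>d. 0 < \<bar>d\<bar> \<and> \<bar>d\<bar> < e \<and> x + d *\<^sub>R b \<in> UNIV"
    by (intro exI[of _ "e / 2"]) auto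
qed

lemma axis_approachable_spacetime:
  "axis_approachable ((UNIV :: 'a::euclidean_space set) \<times> {0..<T::real})"
  unfolding axis_approachable_def
proof (intro ballI allI impI)
  fix p b :: "'a \<times> real" and e :: real
  assume p: "p \<in> (UNIV :: 'a set) \<times> {0..<T}" and b: "b \<in> Basis" and e: "e > 0"
  define d where "d = min (e / 2) ((T - snd p) / 2)"
  have d: "0 < d" "d < e" "snd p + d < T" using p e by (auto simp: d_def min_def field_simps)
  have "p + d *\<^sub>R b \<in> UNIV \<times> {0..<T}"
    using b p d by (auto simp: Basis_prod_def mem_Times_iff)
  thus "\<exists>d. 0 < \<bar>d\<bar> \<and> \<bar>d\<bar> < e \<and> p + d *\<^sub>R b \<in> UNIV \<times> {0..<T}"
    using d by (intro exI[of _ d]) auto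
qed

definition dir_deriv :: "'a::euclidean_space set \<Rightarrow> ('a \<Rightarrow> 'b::real_normed_vector) \<Rightarrow> 'a \<Rightarrow> 'a \<Rightarrow> 'b" where
  "dir_deriv S f v x = frechet_derivative f (at x within S) v"

lemma dir_deriv_cong:
  assumes "x \<in> S" "\<And>y. y \<in> S \<Longrightarrow> f y = g y"
  shows "dir_deriv S f v x = dir_deriv S g v x"
proof -
  have "(f has_derivative D) (at x within S) \<longleftrightarrow> (g has_derivative D) (at x within S)" for D
    using has_derivative_transform[OF assms(1), of f g D] has_derivative_transform[OF assms(1), of g f D]
      assms(2) by metis
  thus ?thesis by (simp add: dir_deriv_def frechet_derivative_def)
qed

lemma has_derivative_dir_deriv:
  assumes S: "axis_approachable S" and x: "x \<in> S" and f: "(f has_derivative f') (at x within S)"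
  shows "f' = (\<lambda>v. dir_deriv S f v x)"
proof -
  have "(f has_derivative frechet_derivative f (at x within S)) (at x within S)"
    using f frechet_derivative_works by (auto simp: differentiable_def)
  hence "f' = frechet_derivative f (at x within S)"
    using S x by (intro frechet_derivative_unique_within[OF f]) (auto simp: axis_approachable_def)
  thus ?thesis by (simp add: dir_deriv_def)
qed

lemma smooth_on_dir_deriv:
  assumes S: "axis_approachable S" and f: "smooth_on f S"
  shows "x \<in> S \<Longrightarrow> (f has_derivative (\<lambda>v. dir_deriv S f v x)) (at x within S)"
    and "smooth_on (dir_deriv S f v) S"
proof -
  have *: "(\<forall>x\<in>S. (f has_derivative (\<lambda>v. dir_deriv S f v x)) (at x within S)) \<and> Ck_on k (dir_deriv S f v) S" for k
  proof -
    have "Ck_on (Suc k) f S" using f by (simp only: smooth_on_def)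
    then obtain f' where f': "\<And>x. x \<in> S \<Longrightarrow> (f has_derivative f' x) (at x within S)"
      "\<And>v. Ck_on k (\<lambda>x. f' x v) S" by auto
    have e: "f' x = (\<lambda>v. dir_deriv S f v x)" if "x \<in> S" for x
      by (rule has_derivative_dir_deriv[OF S that f'(1)[OF that]])
    have "Ck_on k (dir_deriv S f v) S"
      by (rule Ck_on_cong[OF f'(2)[of v]]) (simp add: e)
    thus ?thesis using f'(1) e by auto
  qed
  show "x \<in> S \<Longrightarrow> (f has_derivative (\<lambda>v. dir_deriv S f v x)) (at x within S)" using * by blast
  show "smooth_on (dir_deriv S f v) S" using * by (simp add: smooth_on_def)
qed

lemma smooth_on_continuous_on:
  assumes "smooth_on f S"
  shows "continuous_on S f"
proof -
  have "Ck_on 0 f S" using assms by (simp only: smooth_on_def)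
  thus ?thesis by simp
qed

lemma dir_deriv_along_segment:
  fixes f :: "'a::euclidean_space \<Rightarrow> real"
  assumes S: "axis_approachable S" and f: "smooth_on f S"
    and seg: "\<And>s. s \<in> {0..h} \<Longrightarrow> y + s *\<^sub>R v \<in> S" and h: "0 < h"
  obtains s where "0 < s" "s < h" "f (y + h *\<^sub>R v) - f y = h * dir_deriv S f v (y + s *\<^sub>R v)"
proof -
  have d: "((\<lambda>s. f (y + s *\<^sub>R v)) has_derivative (\<lambda>r. r * dir_deriv S f v (y + s *\<^sub>R v))) (at s within {0..h})"
    if s: "s \<in> {0..h}" for s
  proof -
    have 1: "(f has_derivative (\<lambda>u. dir_deriv S f u (y + s *\<^sub>R v))) (at (y + s *\<^sub>R v) within (\<lambda>s. y + s *\<^sub>R v) ` {0..h})"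
      using smooth_on_dir_deriv(1)[OF S f seg[OF s]] by (rule has_derivative_subset) (use seg in auto)
    have 2: "((\<lambda>s. y + s *\<^sub>R v) has_derivative (\<lambda>r. r *\<^sub>R v)) (at s within {0..h})"
      by (auto intro!: derivative_eq_intros)
    have "((\<lambda>s. f (y + s *\<^sub>R v)) has_derivative (\<lambda>r. dir_deriv S f (r *\<^sub>R v) (y + s *\<^sub>R v))) (at s within {0..h})"
      by (rule has_derivative_in_compose[OF 2 1])
    moreover have "dir_deriv S f (r *\<^sub>R v) (y + s *\<^sub>R v) = r * dir_deriv S f v (y + s *\<^sub>R v)" for r
      using linear_scale[OF has_derivative_linear[OF smooth_on_dir_deriv(1)[OF S f seg[OF s]]]] by simp
    ultimately show ?thesis by simp
  qed
  have "continuous_on {0..h} (\<lambda>s. f (y + s *\<^sub>R v))"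
    using d has_derivative_continuous continuous_on_eq_continuous_within by blast
  moreover have "((\<lambda>s. f (y + s *\<^sub>R v)) has_derivative (\<lambda>r. r * dir_deriv S f v (y + s *\<^sub>R v))) (at s)"
    if "0 < s" "s < h" for s
    using d[of s] that at_within_interior[of s "{0..h}"] by simp
  ultimately obtain s where "0 < s" "s < h"
    "f (y + h *\<^sub>R v) - f (y + 0 *\<^sub>R v) = (h - 0) * dir_deriv S f v (y + s *\<^sub>R v)"
    using mvt[OF h, of "\<lambda>s. f (y + s *\<^sub>R v)" "\<lambda>s r. r * dir_deriv S f v (y + s *\<^sub>R v)"] by blast
  thus ?thesis using that by simp
qed

text \<open>
The mean value theorem in each of the two directions. The second difference is symmetric in \<open>v\<close> and \<open>w\<close>, which
makes the mixed derivatives commute in the limit \<open>h \<rightarrow> 0\<close>.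
\<close>

lemma second_difference:
  fixes f :: "'a::euclidean_space \<Rightarrow> real"
  assumes S: "axis_approachable S" and f: "smooth_on f S" and h: "0 < h"
    and sq: "\<And>s r. s \<in> {0..h} \<Longrightarrow> r \<in> {0..h} \<Longrightarrow> x + s *\<^sub>R v + r *\<^sub>R w \<in> S"
  obtains s r where "0 < s" "s < h" "0 < r" "r < h"
    "f (x + h *\<^sub>R v + h *\<^sub>R w) - f (x + h *\<^sub>R w) - (f (x + h *\<^sub>R v) - f x) =
      h\<^sup>2 * dir_deriv S (dir_deriv S f v) w (x + s *\<^sub>R v + r *\<^sub>R w)"
proof -
  have "\<exists>s. 0 < s \<and> s < h \<and>
     f (x + h *\<^sub>R v + h *\<^sub>R w) - f (x + h *\<^sub>R w) - (f (x + h *\<^sub>R v) - f x) =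
     h * (dir_deriv S f v (x + s *\<^sub>R v + h *\<^sub>R w) - dir_deriv S f v (x + s *\<^sub>R v))"
  proof -
    have d: "((\<lambda>s. f (x + s *\<^sub>R v + r *\<^sub>R w)) has_derivative (\<lambda>k. k * dir_deriv S f v (x + s *\<^sub>R v + r *\<^sub>R w))) (at s within {0..h})"
      if s: "s \<in> {0..h}" and r: "r \<in> {0..h}" for s r
    proof -
      let ?p = "x + s *\<^sub>R v + r *\<^sub>R w"
      have 1: "(f has_derivative (\<lambda>v. dir_deriv S f v ?p)) (at ?p within (\<lambda>s. x + s *\<^sub>R v + r *\<^sub>R w) ` {0..h})"
        by (rule has_derivative_subset[OF smooth_on_dir_deriv(1)[OF S f sq[OF s r]]]) (use sq r in auto)
      have 2: "((\<lambda>s. x + s *\<^sub>R v + r *\<^sub>R w) has_derivative (\<lambda>k. k *\<^sub>R v)) (at s within {0..h})"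
        by (auto intro!: derivative_eq_intros)
      have "((\<lambda>s. f (x + s *\<^sub>R v + r *\<^sub>R w)) has_derivative (\<lambda>k. dir_deriv S f (k *\<^sub>R v) ?p)) (at s within {0..h})"
        by (rule has_derivative_in_compose[OF 2 1])
      moreover have "dir_deriv S f (k *\<^sub>R v) ?p = k * dir_deriv S f v ?p" for k
        using linear_scale[OF has_derivative_linear[OF smooth_on_dir_deriv(1)[OF S f sq[OF s r]]]] by simp
      ultimately show ?thesis by simp
    qed
    let ?F = "\<lambda>s. f (x + s *\<^sub>R v + h *\<^sub>R w) - f (x + s *\<^sub>R v + 0 *\<^sub>R w)"
    let ?F' = "\<lambda>s k. k * dir_deriv S f v (x + s *\<^sub>R v + h *\<^sub>R w) - k * dir_deriv S f v (x + s *\<^sub>R v + 0 *\<^sub>R w)"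
    have D: "(?F has_derivative ?F' s) (at s within {0..h})" if "s \<in> {0..h}" for s
      using h that by (intro has_derivative_diff d) auto
    have "continuous_on {0..h} ?F"
      using D has_derivative_continuous continuous_on_eq_continuous_within by blast
    moreover have "(?F has_derivative ?F' s) (at s)" if "0 < s" "s < h" for s
      using D[of s] that at_within_interior[of s "{0..h}"] by simp
    ultimately obtain s where "0 < s" "s < h" "?F h - ?F 0 = ?F' s (h - 0)"
      using mvt[OF h, of ?F ?F'] by blast
    thus ?thesis by (intro exI[of _ s]) (simp add: algebra_simps)
  qed
  then obtain s where s: "0 < s" "s < h"
    and 1: "f (x + h *\<^sub>R v + h *\<^sub>R w) - f (x + h *\<^sub>R w) - (f (x + h *\<^sub>R v) - f x) =
     h * (dir_deriv S f v (x + s *\<^sub>R v + h *\<^sub>R w) - dir_deriv S f v (x + s *\<^sub>R v))" by blast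
  obtain r where "0 < r" "r < h"
    "dir_deriv S f v (x + s *\<^sub>R v + h *\<^sub>R w) - dir_deriv S f v (x + s *\<^sub>R v) =
      h * dir_deriv S (dir_deriv S f v) w (x + s *\<^sub>R v + r *\<^sub>R w)"
    using dir_deriv_along_segment[OF S smooth_on_dir_deriv(2)[OF S f, of v], of h "x + s *\<^sub>R v" w] sq s h
    by auto
  with s 1 that show ?thesis by (simp add: power2_eq_square)
qed

text \<open>
Only a small square with corner \<open>x\<close> has to lie in \<open>S\<close>, so the statement covers one-sided time derivatives
at the initial time.
\<close>

theorem mixed_dir_derivs_commute:
  fixes f :: "'a::euclidean_space \<Rightarrow> real"
  assumes S: "axis_approachable S" and f: "smooth_on f S" and e: "0 < e"
    and sq: "\<And>s r. s \<in> {0..e} \<Longrightarrow> r \<in> {0..e} \<Longrightarrow> x + s *\<^sub>R v + r *\<^sub>R w \<in> S"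
  shows "dir_deriv S (dir_deriv S f v) w x = dir_deriv S (dir_deriv S f w) v x"
proof -
  let ?P = "dir_deriv S (dir_deriv S f v) w" and ?Q = "dir_deriv S (dir_deriv S f w) v"
  have x: "x \<in> S" using sq[of 0 0] e by simp
  have cP: "continuous_on S ?P" and cQ: "continuous_on S ?Q"
    by (intro smooth_on_continuous_on smooth_on_dir_deriv[OF S] f)+
  have "\<bar>?P x - ?Q x\<bar> \<le> \<epsilon>" if \<epsilon>: "\<epsilon> > 0" for \<epsilon>
  proof -
    obtain d1 where d1: "d1 > 0" "\<And>y. y \<in> S \<Longrightarrow> dist y x < d1 \<Longrightarrow> dist (?P y) (?P x) < \<epsilon> / 2"
      using cP x half_gt_zero[OF \<epsilon>] unfolding continuous_on_iff by metis
    obtain d2 where d2: "d2 > 0" "\<And>y. y \<in> S \<Longrightarrow> dist y x < d2 \<Longrightarrow> dist (?Q y) (?Q x) < \<epsilon> / 2"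
      using cQ x half_gt_zero[OF \<epsilon>] unfolding continuous_on_iff by metis
    define N where "N = norm v + norm w + 1"
    have N: "N > 0" by (simp add: N_def add_nonneg_pos)
    define h where "h = min e (min d1 d2 / N)"
    have h: "0 < h" "h \<le> e" "h * N \<le> d1" "h * N \<le> d2"
    proof -
      show "0 < h" "h \<le> e" using e d1 d2 N by (auto simp: h_def)
      have "h \<le> min d1 d2 / N" by (simp add: h_def)
      hence "h * N \<le> min d1 d2" using N by (simp add: field_simps)
      thus "h * N \<le> d1" "h * N \<le> d2" by auto
    qed
    have near: "dist (x + s *\<^sub>R v + r *\<^sub>R w) x < h * N" if "0 < s" "s < h" "0 < r" "r < h" for s r
    proof -
      have "dist (x + s *\<^sub>R v + r *\<^sub>R w) x = norm (s *\<^sub>R v + r *\<^sub>R w)" by (simp add: dist_norm add.assoc)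
      also have "\<dots> \<le> s * norm v + r * norm w" using that by (intro order_trans[OF norm_triangle_ineq]) auto
      also have "\<dots> \<le> h * norm v + h * norm w" using that by (intro add_mono mult_right_mono) auto
      also have "\<dots> < h * N" using h(1) by (simp add: N_def algebra_simps)
      finally show ?thesis .
    qed
    have sqh: "x + s *\<^sub>R v + r *\<^sub>R w \<in> S" "x + s *\<^sub>R w + r *\<^sub>R v \<in> S" if "s \<in> {0..h}" "r \<in> {0..h}" for s r
      using sq[of s r] sq[of r s] that h(2) by (auto simp: add_ac)
    obtain s r where p: "0 < s" "s < h" "0 < r" "r < h"
      "f (x + h *\<^sub>R v + h *\<^sub>R w) - f (x + h *\<^sub>R w) - (f (x + h *\<^sub>R v) - f x) =
        h\<^sup>2 * ?P (x + s *\<^sub>R v + r *\<^sub>R w)"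
      using second_difference[OF S f h(1) sqh(1)] by blast
    obtain s' r' where q: "0 < s'" "s' < h" "0 < r'" "r' < h"
      "f (x + h *\<^sub>R w + h *\<^sub>R v) - f (x + h *\<^sub>R v) - (f (x + h *\<^sub>R w) - f x) =
        h\<^sup>2 * ?Q (x + s' *\<^sub>R w + r' *\<^sub>R v)"
      using second_difference[OF S f h(1) sqh(2)] by blast
    have "x + h *\<^sub>R w + h *\<^sub>R v = x + h *\<^sub>R v + h *\<^sub>R w" by (simp add: add_ac)
    note q' = q(5)[unfolded this]
    have "h\<^sup>2 * ?P (x + s *\<^sub>R v + r *\<^sub>R w) = h\<^sup>2 * ?Q (x + s' *\<^sub>R w + r' *\<^sub>R v)"
      using p(5) q' by linarith
    hence "?P (x + s *\<^sub>R v + r *\<^sub>R w) = ?Q (x + s' *\<^sub>R w + r' *\<^sub>R v)" using h(1) by simp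
    moreover have "x + s' *\<^sub>R w + r' *\<^sub>R v = x + r' *\<^sub>R v + s' *\<^sub>R w" by (simp add: add_ac)
    moreover have "dist (?P (x + s *\<^sub>R v + r *\<^sub>R w)) (?P x) < \<epsilon> / 2"
      using near[OF p(1-4)] h p(1-4) by (intro d1 sqh) auto
    moreover have "dist (?Q (x + r' *\<^sub>R v + s' *\<^sub>R w)) (?Q x) < \<epsilon> / 2"
      using near[OF q(3,4,1,2)] h q(1-4) by (intro d2 sqh) auto
    ultimately show ?thesis by (simp only: dist_real_def)
  qed
  hence "\<bar>?P x - ?Q x\<bar> \<le> 0" by (rule field_le_epsilon[of _ 0, simplified])
  thus ?thesis by simp
qed

lemma mixed_dir_derivs_commute_spacetime:
  fixes f :: "'a::euclidean_space \<times> real \<Rightarrow> real" and T :: real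
  defines "S \<equiv> UNIV \<times> {0..<T}"
  assumes f: "smooth_on f S" and p: "p \<in> S" and pos: "snd v \<ge> 0" "snd w \<ge> 0"
  shows "dir_deriv S (dir_deriv S f v) w p = dir_deriv S (dir_deriv S f w) v p"
proof -
  define e where "e = (T - snd p) / (2 * (1 + snd v + snd w))"
  have t: "0 \<le> snd p" "snd p < T" using p by (auto simp: S_def mem_Times_iff)
  have e: "e > 0" "e * (1 + snd v + snd w) = (T - snd p) / 2" using t pos by (auto simp: e_def field_simps)
  show ?thesis
  proof (rule mixed_dir_derivs_commute[OF _ f e(1)])
    show "axis_approachable S" unfolding S_def by (rule axis_approachable_spacetime)
    fix s r assume sr: "s \<in> {0..e}" "r \<in> {0..e}"
    have "s * snd v + r * snd w \<le> e * snd v + e * snd w"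
      using sr pos by (intro add_mono mult_right_mono) auto
    also have "\<dots> \<le> (T - snd p) / 2" using e by (simp add: algebra_simps)
    finally have "snd p + s * snd v + r * snd w < T" using t by (simp add: field_simps)
    moreover have "0 \<le> snd p + s * snd v + r * snd w" using t sr pos by simp
    ultimately show "p + s *\<^sub>R v + r *\<^sub>R w \<in> S" by (simp add: S_def mem_Times_iff)
  qed
qed

lemma mixed_dir_derivs_commute_UNIV:
  fixes f :: "'a::euclidean_space \<Rightarrow> real"
  assumes "smooth_on f UNIV"
  shows "dir_deriv UNIV (dir_deriv UNIV f v) w p = dir_deriv UNIV (dir_deriv UNIV f w) v p"
  by (rule mixed_dir_derivs_commute[OF axis_approachable_UNIV assms zero_less_one]) simp

lemma has_derivative_time_slice:
  fixes f :: "'a::euclidean_space \<times> real \<Rightarrow> 'b::real_normed_vector" and T :: real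
  defines "S \<equiv> UNIV \<times> {0..<T}"
  assumes f: "smooth_on f S" and t: "t \<in> {0..<T}"
  shows "((\<lambda>y. f (y, t)) has_derivative (\<lambda>v. dir_deriv S f (v, 0) (y, t))) (at y)"
proof -
  have S: "axis_approachable S" unfolding S_def by (rule axis_approachable_spacetime)
  have p: "(y, t) \<in> S" using t by (simp add: S_def)
  have 1: "(f has_derivative (\<lambda>v. dir_deriv S f v (y, t))) (at (y, t) within (\<lambda>y. (y, t)) ` UNIV)"
    by (rule has_derivative_subset[OF smooth_on_dir_deriv(1)[OF S f p]]) (use t in \<open>auto simp: S_def\<close>)
  have 2: "((\<lambda>y. (y, t)) has_derivative (\<lambda>v. (v, 0))) (at y)"
    by (auto intro!: derivative_eq_intros)
  show ?thesis using has_derivative_in_compose[OF 2 1] by simp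
qed


section \<open>Coordinate invariance of the Laplacian\<close>

lemma partial_eq: "(f has_derivative D) (at x) \<Longrightarrow> partial f i x = D (axis i 1)"
  unfolding partial_def by (metis frechet_derivative_at)

lemma axis_sum: "v = (\<Sum>i\<in>UNIV. v $ i *\<^sub>R axis i 1)" for v :: "real^'n"
  using basis_expansion[of v] by (simp add: scalar_mult_eq_scaleR)

lemma linear_axis_sum:
  fixes v :: "real^'n"
  assumes "linear D"
  shows "D v = (\<Sum>i\<in>UNIV. v $ i *\<^sub>R D (axis i 1))"
  using arg_cong[OF axis_sum[of v], of D] by (simp add: linear_sum[OF assms] linear_scale[OF assms])

lemma grad_eq: "(f has_derivative D) (at x) \<Longrightarrow> grad f x = (\<chi> i. D (axis i 1))"
  by (simp add: grad_def partial_eq vec_eq_iff)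

lemma has_derivative_grad:
  assumes "(f has_derivative D) (at x)"
  shows "D v = grad f x \<bullet> v"
  using linear_axis_sum[OF has_derivative_linear[OF assms], of v]
  by (simp add: grad_eq[OF assms] inner_vec_def mult.commute)

lemma matrix_mult_axis: "(A *v axis j 1) $ i = A $ i $ j" for A :: "real^'m^'n"
  by (simp add: matrix_vector_mult_def axis_def if_distrib cong: if_cong)

lemma trace_matrix: "linear D \<Longrightarrow> trace (matrix D) = (\<Sum>i\<in>UNIV. D (axis i 1) $ i)" for D :: "real^'n \<Rightarrow> real^'n"
  by (simp add: trace_def matrix_def)

lemma has_derivative_abs_det:
  fixes M :: "'a::real_normed_vector \<Rightarrow> real^'n^'n"
  assumes M: "(M has_derivative M') (at x)" and inv: "invertible (M x)"
  shows "((\<lambda>x. \<bar>det (M x)\<bar>) has_derivative (\<lambda>v. \<bar>det (M x)\<bar> * trace (matrix_inv (M x) ** M' v))) (at x)"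
proof -
  have nz: "det (M x) \<noteq> 0" using inv by (simp add: invertible_det_nz)
  note D = jacobi_formula[OF M inv]
  have "((\<lambda>x. det (M x) * det (M x)) has_derivative
      (\<lambda>v. 2 * det (M x) * (det (M x) * trace (matrix_inv (M x) ** M' v)))) (at x)"
    by (rule has_derivative_eq_rhs[OF has_derivative_mult[OF D D]]) (simp add: algebra_simps)
  hence "((\<lambda>x. (det (M x))\<^sup>2) has_derivative
      (\<lambda>v. 2 * det (M x) * (det (M x) * trace (matrix_inv (M x) ** M' v)))) (at x)"
    by (simp add: power2_eq_square)
  moreover have "(det (M x))\<^sup>2 > 0" using nz by simp
  ultimately have "((\<lambda>x. sqrt ((det (M x))\<^sup>2)) has_derivative (\<lambda>v. (2 * det (M x) * (det (M x) * trace (matrix_inv (M x) ** M' v))) *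
      (inverse (sqrt ((det (M x))\<^sup>2)) / 2))) (at x)"
    by (intro DERIV_compose_FDERIV[of sqrt] DERIV_real_sqrt)
  moreover have "(2 * det (M x) * (det (M x) * c)) * (inverse (sqrt ((det (M x))\<^sup>2)) / 2) = \<bar>det (M x)\<bar> * c" for c
    using nz by (simp add: divide_simps)
  ultimately show ?thesis by (simp only: real_sqrt_abs)
qed

locale metric_pullback =
  fixes g :: "real^'n \<Rightarrow> real^'n^'n" and W :: "real^'n \<Rightarrow> real" and \<psi> :: "real^'n \<Rightarrow> real^'n"
    and J :: "real^'n \<Rightarrow> real^'n^'n"
  assumes d\<psi>: "\<And>y. (\<psi> has_derivative (\<lambda>v. J y *v v)) (at y)"
    and J: "\<And>y. invertible (J y)"
    and g: "\<And>y. det (g y) > 0"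
    and W: "\<And>y. W differentiable (at y)"
begin

definition "pullback y = transpose (J y) ** g (\<psi> y) ** J y"

lemma grad_pullback: "grad (\<lambda>y. W (\<psi> y)) y = transpose (J y) *v grad W (\<psi> y)"
proof -
  obtain D where D: "(W has_derivative D) (at (\<psi> y))" using W by (auto simp: differentiable_def)
  have 1: "((\<lambda>y. W (\<psi> y)) has_derivative (\<lambda>v. D (J y *v v))) (at y)"
    by (rule has_derivative_compose[OF d\<psi> D])
  have "grad (\<lambda>y. W (\<psi> y)) y $ i = (transpose (J y) *v grad W (\<psi> y)) $ i" for i
  proof -
    have "grad (\<lambda>y. W (\<psi> y)) y $ i = grad W (\<psi> y) \<bullet> (J y *v axis i 1)"
      by (simp add: grad_eq[OF 1] has_derivative_grad[OF D])
    also have "\<dots> = (\<Sum>k\<in>UNIV. J y $ k $ i * grad W (\<psi> y) $ k)"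
      by (simp add: inner_vec_def matrix_mult_axis mult.commute)
    finally show ?thesis by (simp add: matrix_vector_mult_def transpose_def)
  qed
  thus ?thesis by (simp add: vec_eq_iff)
qed

lemma metric_grad_pullback:
  "metric_grad pullback (\<lambda>y. W (\<psi> y)) y = matrix_inv (J y) *v metric_grad g W (\<psi> y)"
proof -
  have ig: "invertible (g (\<psi> y))" using g[of "\<psi> y"] by (simp add: invertible_det_nz)
  have tJ: "transpose (J y) ** transpose (matrix_inv (J y)) = mat 1"
    by (simp add: matrix_transpose_mul[symmetric] matrix_inv[OF J] transpose_mat)
  have tJ': "transpose (matrix_inv (J y)) ** transpose (J y) = mat 1"
    by (simp add: matrix_transpose_mul[symmetric] matrix_inv[OF J] transpose_mat)
  have "pullback y ** (matrix_inv (J y) ** matrix_inv (g (\<psi> y)) ** transpose (matrix_inv (J y))) =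
    transpose (J y) ** (g (\<psi> y) ** (J y ** matrix_inv (J y)) ** matrix_inv (g (\<psi> y))) ** transpose (matrix_inv (J y))"
    by (simp add: pullback_def matrix_mul_assoc)
  also have "\<dots> = mat 1" by (simp add: matrix_inv[OF J] matrix_inv[OF ig] tJ)
  finally have "matrix_inv (pullback y) = matrix_inv (J y) ** matrix_inv (g (\<psi> y)) ** transpose (matrix_inv (J y))"
    by (rule matrix_inv_unique)
  hence "matrix_inv (pullback y) *v (transpose (J y) *v v) =
      matrix_inv (J y) *v (matrix_inv (g (\<psi> y)) *v ((transpose (matrix_inv (J y)) ** transpose (J y)) *v v))" for v
    by (simp only: matrix_vector_mul_assoc matrix_mul_assoc)
  thus ?thesis
    unfolding metric_grad_def grad_pullback tJ' by simp
qed

lemma metric_norm_pullback: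
  "metric_norm (pullback y) (metric_grad pullback (\<lambda>y. W (\<psi> y)) y) = metric_norm (g (\<psi> y)) (metric_grad g W (\<psi> y))"
proof -
  let ?w = "metric_grad g W (\<psi> y)" and ?v = "matrix_inv (J y) *v metric_grad g W (\<psi> y)"
  have w: "J y *v ?v = ?w" by (simp add: matrix_vector_mul_assoc matrix_inv[OF J])
  have "pullback y *v ?v = transpose (J y) *v (g (\<psi> y) *v (J y *v ?v))"
    by (simp add: pullback_def matrix_vector_mul_assoc matrix_mul_assoc)
  hence "?v \<bullet> (pullback y *v ?v) = (J y *v ?v) \<bullet> (g (\<psi> y) *v (J y *v ?v))"
    by (metis dot_lmul_matrix vector_transpose_matrix inner_commute)
  thus ?thesis by (simp add: metric_norm_def metric_grad_pullback w)
qed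

lemma sqrt_det_pullback: "sqrt (det (pullback y)) = \<bar>det (J y)\<bar> * sqrt (det (g (\<psi> y)))"
proof -
  have "det (pullback y) = (det (J y))\<^sup>2 * det (g (\<psi> y))"
    by (simp add: pullback_def det_mul power2_eq_square)
  thus ?thesis by (simp add: real_sqrt_mult)
qed

text \<open>
The weighted gradient field \<open>V = sqrt (det g) g\<^sup>-\<^sup>1 DW\<close> transforms into \<open>N (V \<circ> \<psi>)\<close> with
\<open>N = |det J| J\<^sup>-\<^sup>1\<close>. By Jacobi's formula the columns of \<open>N\<close> are divergence free (Piola's identity): the two terms
in the derivative of \<open>N\<close> contract to the same trace because the second derivatives of \<open>\<psi>\<close> are symmetric.
The rest of the divergence is \<open>|det J|\<close> times the divergence of \<open>V\<close>.
\<close>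

lemma laplace_beltrami_pullback:
  assumes J': "(J has_derivative J') (at x)" and sym: "\<And>v w. J' v *v w = J' w *v v"
    and V: "((\<lambda>y. sqrt (det (g y)) *\<^sub>R metric_grad g W y) has_derivative V') (at (\<psi> x))"
  shows "laplace_beltrami pullback (\<lambda>y. W (\<psi> y)) x = laplace_beltrami g W (\<psi> x)"
proof -
  define V where "V y = sqrt (det (g y)) *\<^sub>R metric_grad g W y" for y
  define N where "N y = \<bar>det (J y)\<bar> *\<^sub>R matrix_inv (J y)" for y
  let ?I = "matrix_inv (J x)" and ?d = "\<bar>det (J x)\<bar>"
  define N' where "N' v = ?d *\<^sub>R (- (?I ** J' v ** ?I)) + (?d * trace (?I ** J' v)) *\<^sub>R ?I" for v
  have dN: "(N has_derivative N') (at x)"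
    unfolding N_def[abs_def] N'_def[abs_def]
    by (intro has_derivative_scaleR has_derivative_abs_det J' J has_derivative_matrix_inv) auto
  have dV: "((\<lambda>y. V (\<psi> y)) has_derivative (\<lambda>v. V' (J x *v v))) (at x)"
    using has_derivative_compose[OF d\<psi> V] by (simp add: V_def)
  have dNV: "((\<lambda>y. N y *v V (\<psi> y)) has_derivative (\<lambda>v. N x *v V' (J x *v v) + N' v *v V (\<psi> x))) (at x)"
    by (rule has_derivative_matrix_vector_mult[OF dN dV])
  \<comment> \<open>The weighted gradient field in the new coordinates.\<close>
  have field: "(\<lambda>y. sqrt (det (pullback y)) * metric_grad pullback (\<lambda>y. W (\<psi> y)) y $ i) = (\<lambda>y. (N y *v V (\<psi> y)) $ i)" for i
    by (simp add: fun_eq_iff N_def V_def metric_grad_pullback sqrt_det_pullback matrix_vector_mult_scaleR scaleR_matrix_vector_assoc[symmetric])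
  have part: "partial (\<lambda>y. (N y *v V (\<psi> y)) $ i) i x = (N x *v V' (J x *v axis i 1)) $ i + (N' (axis i 1) *v V (\<psi> x)) $ i" for i
    using dNV by (subst partial_eq[of _ "\<lambda>v. (N x *v V' (J x *v v) + N' v *v V (\<psi> x)) $ i"]) (auto simp: has_derivative_vec_iff)
  have lV: "linear V'" by (rule has_derivative_linear[OF V])
  have lJ: "linear J'" by (rule has_derivative_linear[OF J'])
  have 1: "(\<Sum>i\<in>UNIV. (N x *v V' (J x *v axis i 1)) $ i) = ?d * trace (matrix V')"
  proof -
    have "V' w = matrix V' *v w" for w using lV by (simp add: matrix_works)
    hence "(N x *v V' (J x *v axis i 1)) $ i = (?d *\<^sub>R (?I ** matrix V' ** J x)) $ i $ i" for i
      by (simp add: N_def matrix_vector_mul_assoc matrix_mul_assoc matrix_mult_axis[symmetric] scaleR_matrix_mult scaleR_matrix_vector_assoc[symmetric])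
    hence "(\<Sum>i\<in>UNIV. (N x *v V' (J x *v axis i 1)) $ i) = ?d * trace (?I ** matrix V' ** J x)"
      by (simp add: trace_def sum_distrib_left)
    also have "trace (?I ** matrix V' ** J x) = trace (J x ** (?I ** matrix V'))" by (rule trace_mul_sym)
    finally show ?thesis by (simp add: matrix_mul_assoc matrix_inv[OF J])
  qed
  \<comment> \<open>Piola's identity.\<close>
  have 2: "(\<Sum>i\<in>UNIV. (N' (axis i 1) *v V (\<psi> x)) $ i) = 0"
  proof -
    define w where "w = ?I *v V (\<psi> x)"
    have "(N' (axis i 1) *v V (\<psi> x)) $ i = ?d * (w $ i * trace (?I ** J' (axis i 1)) - (?I ** J' w) $ i $ i)" for i
    proof -
      have "N' (axis i 1) *v V (\<psi> x) = ?d *\<^sub>R (trace (?I ** J' (axis i 1)) *\<^sub>R w - ?I *v (J' (axis i 1) *v w))"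
        unfolding N'_def w_def
        by (simp add: matrix_vector_mult_add_rdistrib scaleR_matrix_vector_assoc[symmetric] scaleR_right_diff_distrib matrix_vector_minus
           matrix_vector_mul_assoc matrix_mul_assoc flip: scaleR_minus_right)
      also have "?I *v (J' (axis i 1) *v w) = (?I ** J' w) *v axis i 1"
        by (simp add: sym[of "axis i 1" w] matrix_vector_mul_assoc)
      finally show ?thesis by (simp add: matrix_mult_axis mult.commute)
    qed
    hence "(\<Sum>i\<in>UNIV. (N' (axis i 1) *v V (\<psi> x)) $ i) =
        ?d * ((\<Sum>i\<in>UNIV. w $ i * trace (?I ** J' (axis i 1))) - trace (?I ** J' w))"
      by (simp add: sum_distrib_left[symmetric] sum_subtractf trace_def[of "?I ** J' w"])
    also have "(\<Sum>i\<in>UNIV. w $ i * trace (?I ** J' (axis i 1))) = trace (?I ** J' w)"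
    proof -
      have "linear (\<lambda>v. trace (?I ** J' v))"
        unfolding linear_iff by (simp add: linear_add[OF lJ] linear_scale[OF lJ] matrix_add_ldistrib trace_add scaleR_matrix_mult trace_scaleR)
      from linear_axis_sum[OF this, of w] show ?thesis by simp
    qed
    finally show ?thesis by simp
  qed
  have 3: "partial (\<lambda>y. sqrt (det (g y)) * metric_grad g W y $ i) i (\<psi> x) = V' (axis i 1) $ i" for i
    using V by (subst partial_eq[of _ "\<lambda>v. V' v $ i"]) (auto simp: has_derivative_vec_iff)
  have "det (J x) \<noteq> 0" using J[of x] by (simp add: invertible_det_nz)
  thus ?thesis
    unfolding laplace_beltrami_def field part sum.distrib 1 2 3
    unfolding sqrt_det_pullback
    by (simp add: trace_matrix[OF lV])
qed

end


section \<open>The graph of the gradient at a fixed time\<close>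

lemma inner_matrix_axis: "axis i 1 \<bullet> (A *v axis j 1) = A $ i $ j" for A :: "real^'m^'n"
  by (simp add: inner_axis' matrix_mult_axis)

lemma inverse_sum_square_commutes:
  fixes c :: "real^'n^'n"
  assumes inv: "invertible (mat 1 + c ** c)"
  shows "matrix_inv (mat 1 + c ** c) ** c = c ** matrix_inv (mat 1 + c ** c)"
proof -
  let ?m = "mat 1 + c ** c"
  have c: "?m ** c = c ** ?m" by (simp add: matrix_add_ldistrib matrix_add_rdistrib matrix_mul_assoc)
  have "matrix_inv ?m ** c = matrix_inv ?m ** c ** (?m ** matrix_inv ?m)" by (simp add: matrix_inv[OF inv])
  also have "\<dots> = matrix_inv ?m ** (?m ** c) ** matrix_inv ?m" by (simp add: matrix_mul_assoc c)
  also have "\<dots> = c ** matrix_inv ?m" by (simp add: matrix_mul_assoc matrix_inv[OF inv])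
  finally show ?thesis .
qed

text \<open>
The two halves of \<open>(c\<^sup>2)' = c c' + c' c\<close> contribute equally to the trace, because \<open>c\<close> commutes with the
inverse of \<open>1 + c\<^sup>2\<close>.
\<close>

lemma has_derivative_det_sum_square:
  fixes c :: "'a::real_normed_vector \<Rightarrow> real^'n^'n"
  assumes c: "(c has_derivative c') (at x within S)" and sym: "transpose (c x) = c x"
  defines "I \<equiv> matrix_inv (mat 1 + c x ** c x)"
  shows "((\<lambda>x. det (mat 1 + c x ** c x)) has_derivative
    (\<lambda>v. det (mat 1 + c x ** c x) * (2 * trace (I ** c x ** c' v)))) (at x within S)"
proof -
  have inv: "invertible (mat 1 + c x ** c x)"
    using det_sum_square_pos[OF sym] by (simp add: invertible_det_nz)
  have tr: "trace (I ** (c x ** H + H ** c x)) = 2 * trace (I ** c x ** H)" for H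
  proof -
    have "trace (I ** (H ** c x)) = trace ((I ** H) ** c x)" by (simp add: matrix_mul_assoc)
    also have "\<dots> = trace (c x ** (I ** H))" by (rule trace_mul_sym)
    also have "\<dots> = trace (I ** c x ** H)"
      unfolding I_def by (simp add: matrix_mul_assoc inverse_sum_square_commutes[OF inv])
    finally show ?thesis by (simp add: matrix_add_ldistrib trace_add matrix_mul_assoc)
  qed
  have "((\<lambda>x. mat 1 + c x ** c x) has_derivative (\<lambda>v. 0 + (c x ** c' v + c' v ** c x))) (at x within S)"
    by (intro has_derivative_add has_derivative_const has_derivative_matrix_mult c)
  from jacobi_formula[OF this inv] show ?thesis
    unfolding add_0_left I_def[symmetric] tr .
qed

lemma has_derivative_ln_det_sum_square:
  fixes c :: "'a::real_normed_vector \<Rightarrow> real^'n^'n"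
  assumes c: "(c has_derivative c') (at x within S)" and sym: "transpose (c x) = c x"
  shows "((\<lambda>x. - ln (det (mat 1 + c x ** c x)) / 2) has_derivative
    (\<lambda>v. - trace (matrix_inv (mat 1 + c x ** c x) ** c x ** c' v))) (at x within S)"
proof -
  let ?d = "det (mat 1 + c x ** c x)" and ?t = "\<lambda>v. trace (matrix_inv (mat 1 + c x ** c x) ** c x ** c' v)"
  have pos: "?d > 0" by (rule det_sum_square_pos[OF sym])
  have "((\<lambda>x. ln (det (mat 1 + c x ** c x))) has_derivative (\<lambda>v. ?d * (2 * ?t v) * (1 / ?d))) (at x within S)"
    using pos by (intro DERIV_compose_FDERIV[OF _ has_derivative_det_sum_square[OF c sym]]) (auto intro!: derivative_eq_intros)
  hence "((\<lambda>x. ln (det (mat 1 + c x ** c x)) * (- 1 / 2)) has_derivative (\<lambda>v. ?d * (2 * ?t v) * (1 / ?d) * (- 1 / 2))) (at x within S)"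
    by (rule has_derivative_mult_left)
  thus ?thesis using pos by simp
qed

lemma cmat_mult: "cmat (A ** B) = cmat A ** cmat B"
  by (simp add: cmat_def matrix_matrix_mult_def vec_eq_iff)

definition icmat :: "real^'n^'n \<Rightarrow> complex^'n^'n" where
  "icmat A = (\<chi> i j. \<i> * cmat A $ i $ j)"

lemma icmat_mult: "icmat A ** cmat B = icmat (A ** B)" "cmat A ** icmat B = icmat (A ** B)"
    "icmat A ** icmat B = - cmat (A ** B)"
  by (simp_all add: icmat_def cmat_def matrix_matrix_mult_def vec_eq_iff sum_distrib_left sum_negf mult_ac
    mult.assoc[of "\<i>" "\<i>", symmetric])

lemma trace_cmat: "trace (cmat A) = complex_of_real (trace A)" "trace (icmat A) = \<i> * complex_of_real (trace A)"
  by (simp_all add: icmat_def cmat_def trace_def sum_distrib_left)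

lemma has_derivative_icmat:
  assumes "(c has_derivative c') (at x)"
  shows "((\<lambda>x. icmat (c x)) has_derivative (\<lambda>v. icmat (c' v))) (at x)"
  using assms unfolding has_derivative_vec_iff icmat_def cmat_def
  by (auto intro!: has_derivative_mult_right has_derivative_of_real)

text \<open>
The derivatives of \<open>u\<close> at a fixed time up to fourth order, as matrices: \<open>a\<close> is the Hessian, \<open>h y v\<close> its
derivative at \<open>y\<close> in the direction \<open>v\<close>, and \<open>k y v w\<close> the derivative of \<open>h y v\<close> in the direction \<open>w\<close>. The last
three assumptions are the symmetries of the third and fourth derivatives; \<open>k_swap\<close> exchanges the two
pairs of indices.
\<close>

locale hessian_jet =
  fixes f :: "real^'n \<Rightarrow> real" and a :: "real^'n \<Rightarrow> real^'n^'n"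
    and h :: "real^'n \<Rightarrow> real^'n \<Rightarrow> real^'n^'n" and k :: "real^'n \<Rightarrow> real^'n \<Rightarrow> real^'n \<Rightarrow> real^'n^'n"
  assumes da0: "\<And>y. (grad f has_derivative (\<lambda>v. a y *v v)) (at y)"
    and da: "\<And>y. (a has_derivative h y) (at y)"
    and dh: "\<And>y v. ((\<lambda>y. h y v) has_derivative k y v) (at y)"
    and a_sym: "\<And>y. transpose (a y) = a y"
    and h_sym: "\<And>y v. transpose (h y v) = h y v"
    and h_swap: "\<And>y v w. h y v *v w = h y w *v v"
    and k_swap: "\<And>y p q i j. k y (axis p 1) (axis q 1) $ j $ i = k y (axis i 1) (axis j 1) $ q $ p"
begin

definition "met y = mat 1 + a y ** a y"
definition "G y = matrix_inv (met y)"
definition "log_Omega y = - ln (det (met y)) / 2"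

lemma det_met_pos: "det (met y) > 0"
  unfolding met_def by (rule det_sum_square_pos[OF a_sym])

lemma met_invertible: "invertible (met y)"
  using det_met_pos[of y] by (simp add: invertible_det_nz)

lemma G: "met y ** G y = mat 1" "G y ** met y = mat 1"
  unfolding G_def by (rule matrix_inv[OF met_invertible])+

lemma met_sym: "transpose (met y) = met y"
  by (simp add: met_def transpose_def vec_eq_iff matrix_matrix_mult_def mat_def symmetric_nth[OF a_sym, of y] mult.commute)

lemma G_sym: "transpose (G y) = G y"
proof -
  have "met y ** transpose (G y) = transpose (G y ** met y)" by (simp add: matrix_transpose_mul met_sym)
  also have "\<dots> = mat 1" by (simp add: G transpose_mat)
  finally show ?thesis unfolding G_def by (rule matrix_inv_unique(2)[symmetric])
qed

lemma h_linear: "linear (h y)" by (rule has_derivative_linear[OF da])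

lemma partial_gradient_graph: "partial (gradient_graph f) i y = (axis i 1, a y *v axis i 1)"
proof -
  have "(gradient_graph f has_derivative (\<lambda>v. (v, a y *v v))) (at y)"
    unfolding gradient_graph_def[abs_def] by (intro has_derivative_Pair has_derivative_ident da0)
  thus ?thesis by (rule partial_eq)
qed

lemma inner_graph: "(v, a y *v v) \<bullet> (w, a y *v w) = v \<bullet> (met y *v w)"
  using symmetric_inner[OF a_sym, of y v "a y *v w"]
  by (simp add: met_def matrix_vector_mult_add_rdistrib matrix_vector_mul_assoc inner_right_distrib)

lemma induced_metric_gradient_graph: "induced_metric (gradient_graph f) y = met y"
  unfolding induced_metric_def partial_gradient_graph inner_graph inner_matrix_axis by simp

lemma induced_metric_reparametrised:
  assumes "(\<psi> has_derivative (\<lambda>v. J *v v)) (at y)"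
  shows "induced_metric (\<lambda>y. (\<psi> y, grad f (\<psi> y))) y = transpose J ** met (\<psi> y) ** J"
proof -
  have "((\<lambda>y. (\<psi> y, grad f (\<psi> y))) has_derivative (\<lambda>v. (J *v v, a (\<psi> y) *v (J *v v)))) (at y)"
    by (intro has_derivative_Pair assms has_derivative_compose[OF assms da0])
  hence p: "partial (\<lambda>y. (\<psi> y, grad f (\<psi> y))) i y = (J *v axis i 1, a (\<psi> y) *v (J *v axis i 1))" for i
    by (rule partial_eq)
  have "(J *v axis i 1) \<bullet> (met (\<psi> y) *v (J *v axis j 1)) = (transpose J ** met (\<psi> y) ** J) $ i $ j" for i j
  proof -
    have "(J *v axis i 1) \<bullet> w = axis i 1 \<bullet> (transpose J *v w)" for w
      by (metis dot_lmul_matrix inner_commute vector_transpose_matrix)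
    hence "(J *v axis i 1) \<bullet> (met (\<psi> y) *v (J *v axis j 1)) = axis i 1 \<bullet> ((transpose J ** met (\<psi> y) ** J) *v axis j 1)"
      by (simp only: matrix_vector_mul_assoc matrix_mul_assoc)
    thus ?thesis by (simp only: inner_matrix_axis)
  qed
  thus ?thesis unfolding induced_metric_def p inner_graph by simp
qed

lemma ln_star_Omega: "ln (star_Omega f y) = log_Omega y"
proof -
  have "Omega (\<lambda>i. partial (gradient_graph f) i y) = det (mat 1 :: real^'n^'n)"
    unfolding Omega_def partial_gradient_graph by (intro arg_cong[where f = det]) (simp add: vec_eq_iff mat_def axis_def)
  hence "star_Omega f y = 1 / sqrt (det (met y))"
    by (simp add: star_Omega_def induced_metric_gradient_graph)
  thus ?thesis using det_met_pos[of y] by (simp add: log_Omega_def ln_div ln_sqrt)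
qed

lemma d_met: "(met has_derivative (\<lambda>v. a y ** h y v + h y v ** a y)) (at y)"
  using has_derivative_add[OF has_derivative_const has_derivative_matrix_mult[OF da da], of "mat 1"]
  by (simp add: met_def[abs_def])

lemma d_G: "(G has_derivative (\<lambda>v. - (G y ** (a y ** h y v + h y v ** a y) ** G y))) (at y)"
  unfolding G_def[abs_def] by (rule has_derivative_matrix_inv[OF d_met]) (auto simp: met_invertible)

lemma d_det_met: "((\<lambda>y. det (met y)) has_derivative (\<lambda>v. det (met y) * (2 * trace (G y ** a y ** h y v)))) (at y)"
  unfolding G_def met_def by (rule has_derivative_det_sum_square[OF da a_sym])

lemma d_log_Omega: "(log_Omega has_derivative (\<lambda>v. - trace (G y ** a y ** h y v))) (at y)"
  unfolding G_def met_def log_Omega_def[abs_def] by (rule has_derivative_ln_det_sum_square[OF da a_sym])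

lemma grad_log_Omega: "grad log_Omega y = (\<chi> i. - trace (G y ** a y ** h y (axis i 1)))"
  by (rule grad_eq[OF d_log_Omega])

lemma d_Gah: "((\<lambda>y. trace (G y ** a y ** h y v)) has_derivative
   (\<lambda>w. trace ((G y ** h y w - G y ** (h y w ** a y + a y ** h y w) ** G y ** a y) ** h y v)
      + trace (G y ** a y ** k y v w))) (at y)"
proof -
  have "((\<lambda>y. trace (G y ** a y ** h y v)) has_derivative
    (\<lambda>w. trace ((G y ** a y) ** k y v w + (G y ** h y w + (- (G y ** (a y ** h y w + h y w ** a y) ** G y)) ** a y) ** h y v))) (at y)"
    by (intro has_derivative_trace has_derivative_matrix_mult d_G da dh)
  thus ?thesis
    by (rule has_derivative_eq_rhs) (simp add: fun_eq_iff trace_add matrix_minus_mult add.commute)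
qed

lemma d_Gh: "((\<lambda>y. trace (G y ** h y v)) has_derivative
   (\<lambda>w. trace (G y ** k y v w) - trace (G y ** (h y w ** a y + a y ** h y w) ** G y ** h y v))) (at y)"
proof -
  have "((\<lambda>y. trace (G y ** h y v)) has_derivative
    (\<lambda>w. trace (G y ** k y v w + (- (G y ** (a y ** h y w + h y w ** a y) ** G y)) ** h y v))) (at y)"
    by (intro has_derivative_trace has_derivative_matrix_mult d_G dh)
  thus ?thesis
    by (rule has_derivative_eq_rhs) (simp add: fun_eq_iff trace_add trace_sub[symmetric] matrix_minus_mult add.commute)
qed

text \<open>
The second derivative of \<open>w = log *\<Omega>\<close>.
\<close>

definition "hess_log_Omega y v w = - (trace ((G y ** h y w - G y ** (h y w ** a y + a y ** h y w) ** G y ** a y) ** h y v)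
      + trace (G y ** a y ** k y v w))"

lemma d_grad_log_Omega: "(grad log_Omega has_derivative (\<lambda>w. \<chi> i. hess_log_Omega y (axis i 1) w)) (at y)"
  unfolding has_derivative_vec_iff grad_log_Omega hess_log_Omega_def
  by (simp only: vec_lambda_beta) (intro allI has_derivative_minus d_Gah)

definition "grad_field y = sqrt (det (met y)) *\<^sub>R metric_grad met log_Omega y"

lemma metric_grad_log_Omega: "metric_grad met log_Omega y = G y *v grad log_Omega y"
  by (simp add: metric_grad_def G_def)

lemma d_sqrt_det_met:
  "((\<lambda>y. sqrt (det (met y))) has_derivative (\<lambda>v. sqrt (det (met y)) * trace (G y ** a y ** h y v))) (at y)"
proof -
  have "((\<lambda>y. sqrt (det (met y))) has_derivative (\<lambda>v. det (met y) * (2 * trace (G y ** a y ** h y v)) * (inverse (sqrt (det (met y))) / 2))) (at y)"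
    using det_met_pos[of y] by (intro DERIV_compose_FDERIV[OF _ d_det_met] DERIV_real_sqrt)
  moreover have "det (met y) * (2 * c) * (inverse (sqrt (det (met y))) / 2) = sqrt (det (met y)) * c" for c
    using det_met_pos[of y] by (simp add: field_simps)
  ultimately show ?thesis by (simp only:)
qed

lemma d_grad_field:
  "(grad_field has_derivative (\<lambda>v. sqrt (det (met y)) *\<^sub>R (G y *v (\<chi> i. hess_log_Omega y (axis i 1) v)
        + (- (G y ** (a y ** h y v + h y v ** a y) ** G y)) *v grad log_Omega y)
      + (sqrt (det (met y)) * trace (G y ** a y ** h y v)) *\<^sub>R (G y *v grad log_Omega y))) (at y)"
proof -
  show ?thesis
    unfolding grad_field_def[abs_def] metric_grad_log_Omega
    by (intro has_derivative_scaleR[OF d_sqrt_det_met] has_derivative_matrix_vector_mult d_G d_grad_log_Omega)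
qed

text \<open>
The divergence of \<open>sqrt (det g) G Dw\<close> has two first-order terms containing \<open>tr (G a h(G Dw))\<close>, one
from the derivative of the volume density and one from half of the derivative of \<open>G\<close>. They cancel because
\<open>h v w = h w v\<close>. The other half of the derivative of \<open>G\<close> remains.
\<close>

lemma laplace_log_Omega:
  "laplace_beltrami met log_Omega y = (\<Sum>p\<in>UNIV. \<Sum>q\<in>UNIV. G y $ p $ q * hess_log_Omega y (axis p 1) (axis q 1))
     - trace (G y ** h y (a y *v (G y *v grad log_Omega y)))"
proof -
  define w where "w = G y *v grad log_Omega y"
  let ?s = "sqrt (det (met y))"
  have s: "?s > 0" using det_met_pos by simp
  have part: "partial (\<lambda>y. sqrt (det (met y)) * metric_grad met log_Omega y $ i) i y =
      ?s * ((G y *v (\<chi> j. hess_log_Omega y (axis j 1) (axis i 1))) $ i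
        - (G y ** h y (a y *v w)) $ i $ i - (G y ** a y ** h y w) $ i $ i
        + w $ i * trace (G y ** a y ** h y (axis i 1)))" for i
  proof -
    have "((\<lambda>y. sqrt (det (met y)) * metric_grad met log_Omega y $ i) has_derivative
      (\<lambda>v. (?s *\<^sub>R (G y *v (\<chi> i. hess_log_Omega y (axis i 1) v)
        + (- (G y ** (a y ** h y v + h y v ** a y) ** G y)) *v grad log_Omega y)
      + (?s * trace (G y ** a y ** h y v)) *\<^sub>R (G y *v grad log_Omega y)) $ i)) (at y)"
      using d_grad_field[of y] by (simp add: has_derivative_vec_iff grad_field_def)
    note p = partial_eq[OF this, of i]
    let ?e = "axis i 1 :: real^'n"
    have "(- (G y ** (a y ** h y ?e + h y ?e ** a y) ** G y)) *v grad log_Omega y =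
        - (G y *v (a y *v (h y ?e *v w)) + G y *v (h y ?e *v (a y *v w)))"
      by (simp add: w_def matrix_vector_minus matrix_vector_mul_assoc matrix_mul_assoc matrix_add_ldistrib
        matrix_add_rdistrib matrix_vector_mult_add_rdistrib matrix_vector_mult_diff_rdistrib)
    also have "\<dots> = - (G y *v (a y *v (h y w *v ?e)) + G y *v (h y (a y *v w) *v ?e))"
      by (simp add: h_swap[of y ?e])
    also have "\<dots> = - ((G y ** a y ** h y w) *v ?e + (G y ** h y (a y *v w)) *v ?e)"
      by (simp add: matrix_vector_mul_assoc matrix_mul_assoc)
    finally have E: "((- (G y ** (a y ** h y ?e + h y ?e ** a y) ** G y)) *v grad log_Omega y) $ i =
       - (G y ** a y ** h y w) $ i $ i - (G y ** h y (a y *v w)) $ i $ i"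
      by (simp add: matrix_mult_axis)
    show ?thesis unfolding p vector_add_component vector_scaleR_component E w_def[symmetric]
      by (simp add: algebra_simps)
  qed
  have lin: "linear (\<lambda>v. trace (G y ** a y ** h y v))"
    unfolding linear_iff by (simp add: linear_add[OF h_linear] linear_scale[OF h_linear] matrix_add_ldistrib trace_add scaleR_matrix_mult trace_scaleR)
  have "laplace_beltrami met log_Omega y = (\<Sum>i\<in>UNIV. (G y *v (\<chi> j. hess_log_Omega y (axis j 1) (axis i 1))) $ i)
      - trace (G y ** h y (a y *v w)) - trace (G y ** a y ** h y w) + (\<Sum>i\<in>UNIV. w $ i * trace (G y ** a y ** h y (axis i 1)))"
    unfolding laplace_beltrami_def part sum_distrib_left[symmetric]
    using s by (simp add: sum.distrib sum_subtractf trace_def[of "G y ** h y (a y *v w)"] trace_def[of "G y ** a y ** h y w"])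
  also have "(\<Sum>i\<in>UNIV. w $ i * trace (G y ** a y ** h y (axis i 1))) = trace (G y ** a y ** h y w)"
    using linear_axis_sum[OF lin, of w] by simp
  also have "(\<Sum>i\<in>UNIV. (G y *v (\<chi> j. hess_log_Omega y (axis j 1) (axis i 1))) $ i) =
      (\<Sum>q\<in>UNIV. \<Sum>p\<in>UNIV. G y $ q $ p * hess_log_Omega y (axis p 1) (axis q 1))"
    by (simp add: matrix_vector_mult_def)
  also have "\<dots> = (\<Sum>p\<in>UNIV. \<Sum>q\<in>UNIV. G y $ p $ q * hess_log_Omega y (axis p 1) (axis q 1))"
    by (subst sum.swap) (simp add: symmetric_nth[OF G_sym, of y])
  finally show ?thesis by (simp add: w_def)
qed

text \<open>
The second derivatives of the graph map are \<open>(0, h(e\<^sub>i) e\<^sub>j)\<close>, so the base component of the mean curvature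
vector comes from subtracting the tangential part. Total symmetry of the third derivatives turns it into
\<open>-G a D\<theta>\<close> with \<open>D\<theta> = tr (G h)\<close>.
\<close>

lemma fst_mean_curvature:
  "fst (mean_curvature_vector (gradient_graph f) y) =
     - (G y *v (\<chi> p. trace (G y ** h y (a y *v axis p 1))))"
proof -
  have pp: "partial (partial (gradient_graph f) j) i y = (0, h y (axis i 1) *v axis j 1)" for i j
  proof -
    have "((\<lambda>y. (axis j 1, a y *v axis j 1)) has_derivative (\<lambda>v. (0, a y *v 0 + h y v *v axis j 1))) (at y)"
      by (intro has_derivative_Pair has_derivative_const has_derivative_matrix_vector_mult da)
    hence "((\<lambda>y. partial (gradient_graph f) j y) has_derivative (\<lambda>v. (0, h y v *v axis j 1))) (at y)"
      by (simp add: partial_gradient_graph)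
    thus ?thesis by (rule partial_eq)
  qed
  have tang: "fst (second_fundamental_form (gradient_graph f) y i j) $ l =
      - (\<Sum>p\<in>UNIV. G y $ l $ p * (h y (a y *v axis p 1)) $ i $ j)" for i j l
  proof -
    have "(h y (axis i 1) *v axis j 1) \<bullet> (a y *v axis p 1) = h y (a y *v axis p 1) $ i $ j" for p
    proof -
      have "(h y (axis i 1) *v axis j 1) \<bullet> (a y *v axis p 1) = (h y (axis j 1) *v axis i 1) \<bullet> (a y *v axis p 1)"
        by (simp add: h_swap[of y "axis i 1"])
      also have "\<dots> = axis i 1 \<bullet> (h y (axis j 1) *v (a y *v axis p 1))" by (rule symmetric_inner[OF h_sym])
      also have "\<dots> = axis i 1 \<bullet> (h y (a y *v axis p 1) *v axis j 1)" by (simp add: h_swap[of y "axis j 1"])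
      finally show ?thesis by (simp add: inner_matrix_axis)
    qed
    hence "tangential_part (gradient_graph f) y (0, h y (axis i 1) *v axis j 1) =
      (\<Sum>p\<in>UNIV. \<Sum>l\<in>UNIV. (G y $ p $ l * h y (a y *v axis p 1) $ i $ j) *\<^sub>R (axis l 1, a y *v axis l 1))"
      by (simp add: tangential_part_def induced_metric_gradient_graph partial_gradient_graph G_def)
    hence "fst (tangential_part (gradient_graph f) y (0, h y (axis i 1) *v axis j 1)) $ l =
      (\<Sum>p\<in>UNIV. \<Sum>l'\<in>UNIV. G y $ p $ l' * h y (a y *v axis p 1) $ i $ j * axis l' 1 $ l)"
      by (simp add: fst_sum)
    also have "\<dots> = (\<Sum>p\<in>UNIV. G y $ l $ p * (h y (a y *v axis p 1)) $ i $ j)"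
      by (simp add: axis_def if_distrib symmetric_nth[OF G_sym, of y _ l] cong: if_cong)
    finally show ?thesis by (simp add: second_fundamental_form_def pp)
  qed
  have "fst (mean_curvature_vector (gradient_graph f) y) $ l =
     - (G y *v (\<chi> p. trace (G y ** h y (a y *v axis p 1)))) $ l" for l
  proof -
    have "fst (mean_curvature_vector (gradient_graph f) y) $ l =
      (\<Sum>i\<in>UNIV. \<Sum>j\<in>UNIV. G y $ i $ j * fst (second_fundamental_form (gradient_graph f) y i j) $ l)"
      by (simp add: mean_curvature_vector_def fst_sum induced_metric_gradient_graph G_def)
    also have "\<dots> = - (\<Sum>i\<in>UNIV. \<Sum>j\<in>UNIV. \<Sum>p\<in>UNIV. G y $ l $ p * (G y $ i $ j * h y (a y *v axis p 1) $ i $ j))"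
      by (simp add: tang sum_negf sum_distrib_left mult_ac)
    also have "(\<Sum>i\<in>UNIV. \<Sum>j\<in>UNIV. \<Sum>p\<in>UNIV. G y $ l $ p * (G y $ i $ j * h y (a y *v axis p 1) $ i $ j)) =
        (\<Sum>i\<in>UNIV. \<Sum>p\<in>UNIV. \<Sum>j\<in>UNIV. G y $ l $ p * (G y $ i $ j * h y (a y *v axis p 1) $ i $ j))"
      by (intro sum.cong refl sum.swap)
    also have "\<dots> = (\<Sum>p\<in>UNIV. \<Sum>i\<in>UNIV. \<Sum>j\<in>UNIV. G y $ l $ p * (G y $ i $ j * h y (a y *v axis p 1) $ i $ j))"
      by (rule sum.swap)
    also have "\<dots> = (\<Sum>p\<in>UNIV. G y $ l $ p * trace (G y ** h y (a y *v axis p 1)))"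
      unfolding trace_def matrix_matrix_mult_def
      by (simp add: sum_distrib_left symmetric_nth[OF h_sym, of y])
    finally show ?thesis by (simp add: matrix_vector_mult_def)
  qed
  thus ?thesis by (simp add: vec_eq_iff)
qed

text \<open>
The derivative of \<open>w\<close> along the base velocity of the flow is exactly the first-order term of the Laplacian
in lemma \<open>laplace_log_Omega\<close>.
\<close>

lemma drift_cancels:
  "grad log_Omega y \<bullet> fst (mean_curvature_vector (gradient_graph f) y) =
     - trace (G y ** h y (a y *v (G y *v grad log_Omega y)))"
proof -
  let ?w = "G y *v grad log_Omega y"
  have lin: "linear (\<lambda>v. trace (G y ** h y (a y *v v)))"
    unfolding linear_iff
    by (simp add: matrix_vector_right_distrib matrix_vector_mult_scaleR linear_add[OF h_linear] linear_scale[OF h_linear]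
      matrix_add_ldistrib trace_add scaleR_matrix_mult trace_scaleR)
  have "grad log_Omega y \<bullet> (G y *v r) = ?w \<bullet> r" for r
    by (simp add: symmetric_inner[OF G_sym])
  hence "grad log_Omega y \<bullet> fst (mean_curvature_vector (gradient_graph f) y) =
     - (?w \<bullet> (\<chi> p. trace (G y ** h y (a y *v axis p 1))))"
    by (simp add: fst_mean_curvature)
  also have "?w \<bullet> (\<chi> p. trace (G y ** h y (a y *v axis p 1))) = trace (G y ** h y (a y *v ?w))"
    using linear_axis_sum[OF lin, of ?w] by (simp add: inner_vec_def)
  finally show ?thesis .
qed

text \<open>
Avoids any differentiability statement about individual eigenvalues: with \<open>\<rho> = sqrt (det (1 + a\<^sup>2))\<close>, take
the logarithmic derivative of \<open>exp (i \<tau>) \<rho> = det (1 + i a)\<close>. Since the inverse of \<open>1 + i a\<close> is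
\<open>(1 - i a) G\<close>, the imaginary part of the right-hand side is \<open>tr (G h)\<close>.
\<close>

lemma angle_derivative:
  assumes \<tau>: "(\<tau> has_derivative \<tau>') (at y)"
    and angle: "\<And>y. exp (\<i> * complex_of_real (\<tau> y)) = phase (a y)"
  shows "\<tau>' v = trace (G y ** h y v)"
proof -
  let ?M = "\<lambda>y. mat 1 + icmat (a y)" and ?\<rho> = "\<lambda>y. sqrt (det (met y))" and ?E = "\<lambda>y. exp (\<i> * complex_of_real (\<tau> y))"
  have \<rho>: "?\<rho> y > 0" for y using det_met_pos by simp
  have eq: "?E y * complex_of_real (?\<rho> y) = det (?M y)" for y
    using \<rho>[of y] unfolding angle phase_def icmat_def[symmetric] met_def[symmetric] by simp
  have "?M y ** ((mat 1 - icmat (a y)) ** cmat (G y)) = (mat 1 + cmat (a y ** a y)) ** cmat (G y)"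
    by (simp add: matrix_mul_assoc matrix_add_rdistrib matrix_add_ldistrib matrix_diff_distribs icmat_mult cmat_mult)
  also have "mat 1 + cmat (a y ** a y) = cmat (met y)"
    by (simp add: met_def cmat_def mat_def vec_eq_iff)
  also have "\<dots> ** cmat (G y) = mat 1"
    unfolding cmat_mult[symmetric] G by (simp add: cmat_def mat_def vec_eq_iff)
  finally have inv: "invertible (?M y)" "matrix_inv (?M y) = (mat 1 - icmat (a y)) ** cmat (G y)"
    by (rule matrix_inv_unique)+
  have dM: "(?M has_derivative (\<lambda>v. 0 + icmat (h y v))) (at y)"
    by (intro has_derivative_add has_derivative_const has_derivative_icmat da)
  note 1 = jacobi_formula[OF dM inv(1)]
  have "((\<lambda>y. \<i> * complex_of_real (\<tau> y)) has_derivative (\<lambda>v. \<i> * complex_of_real (\<tau>' v))) (at y)"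
    by (intro has_derivative_mult_right has_derivative_of_real \<tau>)
  from has_derivative_compose[OF this DERIV_exp[unfolded has_field_derivative_def]]
  have dE: "(?E has_derivative (\<lambda>v. (\<i> * complex_of_real (\<tau>' v)) * ?E y)) (at y)"
    by (simp add: mult.commute)
  have 2: "((\<lambda>y. ?E y * complex_of_real (?\<rho> y)) has_derivative
    (\<lambda>v. ?E y * complex_of_real (?\<rho> y * trace (G y ** a y ** h y v)) + (\<i> * complex_of_real (\<tau>' v)) * ?E y * complex_of_real (?\<rho> y))) (at y)"
    by (intro has_derivative_mult dE has_derivative_of_real d_sqrt_det_met)
  have "?E y * complex_of_real (?\<rho> y * trace (G y ** a y ** h y v)) + (\<i> * complex_of_real (\<tau>' v)) * ?E y * complex_of_real (?\<rho> y) =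
     det (?M y) * trace (matrix_inv (?M y) ** (0 + icmat (h y v)))"
    using fun_cong[OF has_derivative_unique[OF 2[unfolded eq] 1], of v] .
  hence "(?E y * complex_of_real (?\<rho> y)) * (complex_of_real (trace (G y ** a y ** h y v)) + \<i> * complex_of_real (\<tau>' v)) =
     (?E y * complex_of_real (?\<rho> y)) * trace (matrix_inv (?M y) ** icmat (h y v))"
    unfolding eq[symmetric] by (simp add: algebra_simps)
  hence "complex_of_real (trace (G y ** a y ** h y v)) + \<i> * complex_of_real (\<tau>' v) =
     trace (matrix_inv (?M y) ** icmat (h y v))"
    using \<rho>[of y] by (simp only: mult_cancel_left) auto
  also have "matrix_inv (?M y) ** icmat (h y v) = icmat (G y ** h y v) + cmat (a y ** G y ** h y v)"
    unfolding inv(2) by (simp add: matrix_diff_distribs icmat_mult)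
  also have "trace \<dots> = \<i> * complex_of_real (trace (G y ** h y v)) + complex_of_real (trace (a y ** G y ** h y v))"
    by (simp add: trace_add trace_cmat)
  finally have "Im (complex_of_real (trace (G y ** a y ** h y v)) + \<i> * complex_of_real (\<tau>' v)) =
     Im (\<i> * complex_of_real (trace (G y ** h y v)) + complex_of_real (trace (a y ** G y ** h y v)))" by simp
  thus ?thesis by simp
qed

text \<open>
The second derivative of the Lagrangian angle, obtained from \<open>D\<theta> v = tr (G h(v))\<close>.
\<close>

definition "hess_angle y v w = trace (G y ** k y v w) - trace (G y ** (h y w ** a y + a y ** h y w) ** G y ** h y v)"

text \<open>
Both sides are the contraction of \<open>D\<^sup>4u\<close> with \<open>G a\<close> in one pair of indices and with \<open>G\<close> in the other.
\<close>

lemma fourth_order_cancels: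
  "(\<Sum>p\<in>UNIV. \<Sum>q\<in>UNIV. (G y ** a y) $ p $ q * trace (G y ** k y (axis p 1) (axis q 1))) =
   (\<Sum>p\<in>UNIV. \<Sum>q\<in>UNIV. G y $ p $ q * trace (G y ** a y ** k y (axis p 1) (axis q 1)))"
proof -
  define X where "X = G y ** a y"
  let ?K = "\<lambda>p q i j. k y (axis p 1) (axis q 1) $ j $ i"
  have pair: "(\<Sum>p\<in>UNIV. \<Sum>q\<in>UNIV. H p q) = (\<Sum>x\<in>UNIV \<times> UNIV. H (fst x) (snd x))" for H :: "'n \<Rightarrow> 'n \<Rightarrow> real"
    by (simp only: sum.cartesian_product case_prod_unfold)
  have "(\<Sum>p\<in>UNIV. \<Sum>q\<in>UNIV. X $ p $ q * trace (G y ** k y (axis p 1) (axis q 1))) =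
      (\<Sum>p\<in>UNIV. \<Sum>q\<in>UNIV. \<Sum>i\<in>UNIV. \<Sum>j\<in>UNIV. X $ p $ q * (G y $ i $ j * ?K p q i j))"
    by (simp add: trace_def matrix_matrix_mult_def sum_distrib_left)
  also have "\<dots> = (\<Sum>i\<in>UNIV. \<Sum>j\<in>UNIV. \<Sum>p\<in>UNIV. \<Sum>q\<in>UNIV. X $ p $ q * (G y $ i $ j * ?K p q i j))"
    unfolding pair by (rule sum.swap)
  also have "\<dots> = (\<Sum>i\<in>UNIV. \<Sum>j\<in>UNIV. \<Sum>p\<in>UNIV. \<Sum>q\<in>UNIV. G y $ i $ j * (X $ p $ q * ?K i j p q))"
    by (intro sum.cong refl) (simp add: k_swap mult.left_commute)
  also have "\<dots> = (\<Sum>p\<in>UNIV. \<Sum>q\<in>UNIV. G y $ p $ q * trace (X ** k y (axis p 1) (axis q 1)))"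
    by (simp add: trace_def matrix_matrix_mult_def sum_distrib_left)
  finally show ?thesis by (simp add: X_def)
qed

text \<open>
The left-hand side is \<open>w\<^sub>t - tr (G D\<^sup>2w)\<close>, since \<open>w\<^sub>t = -tr (G a \<partial>\<^sub>t a)\<close> and \<open>\<partial>\<^sub>t a = D\<^sup>2\<theta>\<close>.
\<close>

lemma evolution_inequality:
  assumes cvx: "\<forall>l m. {#l, m#} \<subseteq># eigenvalues (a y) \<longrightarrow> 1 + l * m \<ge> 0"
  shows "- (\<Sum>p\<in>UNIV. \<Sum>q\<in>UNIV. (G y ** a y) $ p $ q * hess_angle y (axis p 1) (axis q 1))
       - (\<Sum>p\<in>UNIV. \<Sum>q\<in>UNIV. G y $ p $ q * hess_log_Omega y (axis p 1) (axis q 1))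
     \<ge> 1 / real CARD('n) * (metric_norm (met y) (metric_grad met log_Omega y))\<^sup>2"
proof -
  have n: "(metric_norm (met y) (metric_grad met log_Omega y))\<^sup>2 =
      (\<Sum>p\<in>UNIV. \<Sum>q\<in>UNIV. G y $ p $ q * (trace (G y ** a y ** h y (axis p 1)) * trace (G y ** a y ** h y (axis q 1))))"
  proof -
    let ?w = "G y *v grad log_Omega y"
    have "?w \<bullet> (met y *v ?w) \<ge> 0" unfolding inner_graph[symmetric] by simp
    hence "(metric_norm (met y) (metric_grad met log_Omega y))\<^sup>2 = ?w \<bullet> (met y *v ?w)"
      by (simp add: metric_norm_def metric_grad_log_Omega)
    also have "\<dots> = grad log_Omega y \<bullet> (G y *v grad log_Omega y)"
      by (simp add: matrix_vector_mul_assoc G inner_commute)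
    finally show ?thesis
      by (simp add: inner_vec_def matrix_vector_mult_def grad_log_Omega sum_distrib_left mult_ac)
  qed
  have 1: "- (\<Sum>p\<in>UNIV. \<Sum>q\<in>UNIV. (G y ** a y) $ p $ q * hess_angle y (axis p 1) (axis q 1)) =
     (\<Sum>p\<in>UNIV. \<Sum>q\<in>UNIV. (G y ** a y) $ p $ q * trace (G y ** (h y (axis q 1) ** a y + a y ** h y (axis q 1)) ** G y ** h y (axis p 1)))
    - (\<Sum>p\<in>UNIV. \<Sum>q\<in>UNIV. (G y ** a y) $ p $ q * trace (G y ** k y (axis p 1) (axis q 1)))"
    by (simp add: hess_angle_def right_diff_distrib sum_subtractf)
  have 2: "- (\<Sum>p\<in>UNIV. \<Sum>q\<in>UNIV. G y $ p $ q * hess_log_Omega y (axis p 1) (axis q 1)) =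
    (\<Sum>p\<in>UNIV. \<Sum>q\<in>UNIV. G y $ p $ q * trace ((G y ** h y (axis q 1) - G y ** (h y (axis q 1) ** a y + a y ** h y (axis q 1)) ** G y ** a y) ** h y (axis p 1)))
    + (\<Sum>p\<in>UNIV. \<Sum>q\<in>UNIV. G y $ p $ q * trace (G y ** a y ** k y (axis p 1) (axis q 1)))"
    by (simp only: hess_log_Omega_def mult_minus_right sum_negf minus_minus distrib_left sum.distrib)
  show ?thesis
    using symmetric_contraction_inequality[where h = "h y", OF a_sym h_linear h_sym h_swap cvx]
    unfolding n met_def[symmetric] G_def[symmetric]
    using 1 2 fourth_order_cancels[of y] by linarith
qed

end


section \<open>Regularity in space and time\<close>

lemma at_within_half_open_ne_bot:
  fixes t T :: real
  assumes "t \<in> {0..<T}"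
  shows "at t within {0..<T} \<noteq> bot"
  unfolding trivial_limit_within islimpt_approachable not_not
proof (intro allI impI)
  fix e :: real assume "e > 0"
  thus "\<exists>x'\<in>{0..<T}. x' \<noteq> t \<and> dist x' t < e"
    using assms by (intro bexI[of _ "t + min (e / 2) ((T - t) / 2)"]) (auto simp: dist_real_def min_def field_simps)
qed

text \<open>
The inverse map is differentiable, so its Jacobian inverts \<open>J\<close>. Symmetry of \<open>J'\<close> is the symmetry of the second
derivatives of \<open>\<psi>\<close>, on which Piola's identity rests.
\<close>

lemma diffeomorphism_jacobian:
  fixes \<psi> :: "real^'n \<Rightarrow> real^'n"
  assumes "diffeomorphism \<psi>"
  obtains J J' where "\<And>y. (\<psi> has_derivative (\<lambda>v. J y *v v)) (at y)" "\<And>y. invertible (J y)"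
    "\<And>y. (J has_derivative J' y) (at y)" "\<And>y v w. J' y v *v w = J' y w *v v"
proof -
  have bij: "bij \<psi>" and sm: "smooth_on \<psi> UNIV" and smi: "smooth_on (inv \<psi>) UNIV"
    using assms by (auto simp: diffeomorphism_def)
  let ?D = "\<lambda>v F. dir_deriv UNIV F v"
  define c where "c k y = \<psi> y $ k" for k y
  have c: "smooth_on (c k) UNIV" for k
    unfolding c_def[abs_def] by (rule smooth_on_bounded_linear[OF bounded_linear_vec_nth sm])
  note D = smooth_on_dir_deriv[OF axis_approachable_UNIV]
  define J where "J y = (\<chi> k i. ?D (axis i 1) (c k) y)" for y
  define J' where "J' y v = (\<chi> k i. ?D v (?D (axis i 1) (c k)) y)" for y v
  have lin: "?D v F y = (\<Sum>i\<in>UNIV. v $ i * ?D (axis i 1) F y)" if "smooth_on F UNIV" for v y and F :: "real^'n \<Rightarrow> real"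
    using linear_axis_sum[OF has_derivative_linear[OF D(1)[OF that UNIV_I]], of v y] by simp
  have d\<psi>: "(\<psi> has_derivative (\<lambda>v. J y *v v)) (at y)" for y
    unfolding has_derivative_vec_iff
  proof
    fix k
    have "(J y *v v) $ k = ?D v (c k) y" for v
      by (simp add: J_def matrix_vector_mult_def lin[OF c, of k v y] mult.commute)
    thus "((\<lambda>x. \<psi> x $ k) has_derivative (\<lambda>v. (J y *v v) $ k)) (at y)"
      using D(1)[OF c, of y k] by (simp add: c_def[abs_def])
  qed
  have dJ: "(J has_derivative J' y) (at y)" for y
    unfolding has_derivative_vec_iff J_def J'_def using D(1)[OF D(2)[OF c]] by simp
  have swap: "J' y v *v w = J' y w *v v" for y v w
  proof -
    have "(J' y v *v w) $ k = (\<Sum>i\<in>UNIV. \<Sum>j\<in>UNIV. v $ j * w $ i * ?D (axis j 1) (?D (axis i 1) (c k)) y)" for v w k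
      by (simp add: J'_def matrix_vector_mult_def lin[OF D(2)[OF c], of k _ v y] sum_distrib_left sum_distrib_right mult_ac)
    note e = this
    have "(J' y v *v w) $ k = (J' y w *v v) $ k" for k
    proof -
      have "(J' y v *v w) $ k = (\<Sum>j\<in>UNIV. \<Sum>i\<in>UNIV. v $ j * w $ i * ?D (axis j 1) (?D (axis i 1) (c k)) y)"
        unfolding e by (rule sum.swap)
      also have "\<dots> = (\<Sum>j\<in>UNIV. \<Sum>i\<in>UNIV. w $ i * v $ j * ?D (axis i 1) (?D (axis j 1) (c k)) y)"
        by (intro sum.cong[OF refl] arg_cong2[where f = "(*)", OF mult.commute mixed_dir_derivs_commute_UNIV[OF c]])
      finally show ?thesis unfolding e .
    qed
    thus ?thesis by (simp add: vec_eq_iff)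
  qed
  have "invertible (J y)" for y
  proof -
    define K where "K = (\<lambda>v. dir_deriv UNIV (inv \<psi>) v (\<psi> y))"
    have K: "(inv \<psi> has_derivative K) (at (\<psi> y))"
      using D(1)[OF smi UNIV_I] by (simp add: K_def)
    have "((\<lambda>y. inv \<psi> (\<psi> y)) has_derivative (\<lambda>v. K (J y *v v))) (at y)"
      by (rule has_derivative_compose[OF d\<psi> K])
    moreover have "(\<lambda>y. inv \<psi> (\<psi> y)) = (\<lambda>y. y)" using bij by (simp add: bij_def)
    ultimately have "(\<lambda>v. K (J y *v v)) = (\<lambda>v. v)"
      using has_derivative_unique has_derivative_ident by metis
    moreover have "matrix K *v w = K w" for w
      using has_derivative_linear[OF K] by (simp add: matrix_works)
    ultimately have "matrix K *v (J y *v v) = v" for v by metis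
    hence "matrix K ** J y = mat 1"
      by (simp add: matrix_eq matrix_vector_mul_assoc)
    thus ?thesis using invertible_left_inverse by blast
  qed
  thus ?thesis using that[of J J'] d\<psi> dJ swap by blast
qed

text \<open>
Derivatives are taken within the slab, so that every identity between them holds up to the initial time.
\<close>

locale smooth_spacetime_function =
  fixes u :: "real^'n \<Rightarrow> real \<Rightarrow> real" and T :: real
  assumes smooth: "smooth_on (\<lambda>(x, t). u x t) (UNIV \<times> {0..<T})"
begin

definition "slab = (UNIV :: (real^'n) set) \<times> {0..<T}"
definition "U = (\<lambda>(x, t). u x t)"
definition space_deriv :: "real^'n \<Rightarrow> ((real^'n) \<times> real \<Rightarrow> real) \<Rightarrow> (real^'n) \<times> real \<Rightarrow> real" where
  "space_deriv v F = dir_deriv slab F (v, 0)"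
definition time_deriv :: "((real^'n) \<times> real \<Rightarrow> real) \<Rightarrow> (real^'n) \<times> real \<Rightarrow> real" where
  "time_deriv F = dir_deriv slab F (0, 1)"
definition "hess p = (\<chi> i j. space_deriv (axis i 1) (space_deriv (axis j 1) U) p)"
definition "h s y v = (\<chi> i j. space_deriv v (space_deriv (axis i 1) (space_deriv (axis j 1) U)) (y, s))"
definition "k s y v w = (\<chi> i j. space_deriv w (space_deriv v (space_deriv (axis i 1) (space_deriv (axis j 1) U))) (y, s))"

lemma slab: "axis_approachable slab"
  unfolding slab_def by (rule axis_approachable_spacetime)

lemma U_smooth: "smooth_on U slab"
  using smooth by (simp add: U_def slab_def)

lemma space_deriv_smooth: "smooth_on F slab \<Longrightarrow> smooth_on (space_deriv v F) slab"
  and time_deriv_smooth: "smooth_on F slab \<Longrightarrow> smooth_on (time_deriv F) slab"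
  unfolding space_deriv_def time_deriv_def by (rule smooth_on_dir_deriv(2)[OF slab], assumption)+

lemma space_deriv_cong: "p \<in> slab \<Longrightarrow> (\<And>p. p \<in> slab \<Longrightarrow> F p = F' p) \<Longrightarrow> space_deriv v F p = space_deriv v F' p"
  unfolding space_deriv_def by (rule dir_deriv_cong)

lemma space_derivs_commute: "smooth_on F slab \<Longrightarrow> p \<in> slab \<Longrightarrow> space_deriv v (space_deriv w F) p = space_deriv w (space_deriv v F) p"
  unfolding space_deriv_def slab_def by (rule mixed_dir_derivs_commute_spacetime) auto

lemma time_space_derivs_commute: "smooth_on F slab \<Longrightarrow> p \<in> slab \<Longrightarrow> time_deriv (space_deriv w F) p = space_deriv w (time_deriv F) p"
  unfolding space_deriv_def time_deriv_def slab_def by (rule mixed_dir_derivs_commute_spacetime) auto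

lemma has_derivative_slice:
  assumes "smooth_on F slab" "s \<in> {0..<T}"
  shows "((\<lambda>y. F (y, s)) has_derivative (\<lambda>v. space_deriv v F (y, s))) (at y)"
  using assms unfolding space_deriv_def slab_def by (rule has_derivative_time_slice)

lemma space_deriv_sum:
  assumes "smooth_on F slab" "s \<in> {0..<T}"
  shows "space_deriv v F (y, s) = (\<Sum>i\<in>UNIV. v $ i * space_deriv (axis i 1) F (y, s))"
  using linear_axis_sum[OF has_derivative_linear[OF has_derivative_slice[OF assms]], of v y] by simp

lemma space_derivs_commute3:
  assumes F: "smooth_on F slab" and p: "p \<in> slab"
  shows "space_deriv v (space_deriv w (space_deriv z F)) p = space_deriv z (space_deriv w (space_deriv v F)) p"
proof -
  have "space_deriv v (space_deriv w (space_deriv z F)) p = space_deriv w (space_deriv v (space_deriv z F)) p" by (rule space_derivs_commute[OF space_deriv_smooth[OF F] p])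
  also have "\<dots> = space_deriv w (space_deriv z (space_deriv v F)) p" by (rule space_deriv_cong[OF p space_derivs_commute[OF F]])
  also have "\<dots> = space_deriv z (space_deriv w (space_deriv v F)) p" by (rule space_derivs_commute[OF space_deriv_smooth[OF F] p])
  finally show ?thesis .
qed

lemma space_derivs_commute4:
  assumes F: "smooth_on F slab" and p: "p \<in> slab"
  shows "space_deriv v (space_deriv w (space_deriv z (space_deriv z' F))) p = space_deriv z (space_deriv z' (space_deriv v (space_deriv w F))) p"
proof -
  have "space_deriv v (space_deriv w (space_deriv z (space_deriv z' F))) p = space_deriv v (space_deriv z' (space_deriv z (space_deriv w F))) p"
    by (rule space_deriv_cong[OF p space_derivs_commute3[OF F]])
  also have "\<dots> = space_deriv z (space_deriv z' (space_deriv v (space_deriv w F))) p"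
    by (rule space_derivs_commute3[OF space_deriv_smooth[OF F] p])
  finally show ?thesis .
qed

lemma grad_slice:
  assumes s: "s \<in> {0..<T}"
  shows "grad (\<lambda>y. u y s) y = (\<chi> j. space_deriv (axis j 1) U (y, s))"
proof -
  have "((\<lambda>y. u y s) has_derivative (\<lambda>v. space_deriv v U (y, s))) (at y)"
    using has_derivative_slice[OF U_smooth s] by (simp add: U_def)
  thus ?thesis by (rule grad_eq)
qed

lemma hessian_slice:
  assumes s: "s \<in> {0..<T}"
  shows "hessian (\<lambda>y. u y s) y = hess (y, s)"
proof -
  have p: "partial (\<lambda>y. u y s) j = (\<lambda>y. space_deriv (axis j 1) U (y, s))" for j
    using grad_slice[OF s] by (auto simp: grad_def vec_eq_iff fun_eq_iff)
  show ?thesis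
    unfolding hessian_def p hess_def by (simp add: partial_eq[OF has_derivative_slice[OF space_deriv_smooth[OF U_smooth] s]])
qed

lemma hess_sym:
  assumes "p \<in> slab"
  shows "transpose (hess p) = hess p"
  using space_derivs_commute[OF U_smooth assms] by (simp add: hess_def transpose_def vec_eq_iff)

text \<open>
Every symmetry of the third and fourth derivatives is a product of transpositions of adjacent derivatives.
\<close>

lemma jet:
  assumes s: "s \<in> {0..<T}"
  shows "hessian_jet (\<lambda>y. u y s) (\<lambda>y. hess (y, s)) (h s) (k s)"
proof
  have slabI: "(y, s) \<in> slab" for y using s by (simp add: slab_def)
  note sm = space_deriv_smooth U_smooth
  fix y v w :: "real^'n"
  show "(grad (\<lambda>y. u y s) has_derivative (\<lambda>v. hess (y, s) *v v)) (at y)"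
    unfolding has_derivative_vec_iff grad_slice[OF s]
  proof
    fix j
    have "(hess (y, s) *v v) $ j = space_deriv v (space_deriv (axis j 1) U) (y, s)" for v
      by (simp add: hess_def matrix_vector_mult_def space_deriv_sum[OF space_deriv_smooth[OF U_smooth] s, where v = v]
        space_derivs_commute[OF U_smooth slabI, of "axis j 1"] mult.commute)
    thus "((\<lambda>x. (\<chi> j. space_deriv (axis j 1) U (x, s)) $ j) has_derivative (\<lambda>v. (hess (y, s) *v v) $ j)) (at y)"
      using has_derivative_slice[OF space_deriv_smooth[OF U_smooth] s] by simp
  qed
  show "((\<lambda>y. hess (y, s)) has_derivative h s y) (at y)"
    unfolding has_derivative_vec_iff hess_def h_def by (auto intro!: has_derivative_slice sm s)
  show "((\<lambda>y. h s y v) has_derivative k s y v) (at y)"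
    unfolding has_derivative_vec_iff h_def k_def by (auto intro!: has_derivative_slice sm s)
  show "transpose (hess (y, s)) = hess (y, s)" by (rule hess_sym[OF slabI])
  have "space_deriv v (space_deriv (axis j 1) (space_deriv (axis i 1) U)) (y, s) = space_deriv v (space_deriv (axis i 1) (space_deriv (axis j 1) U)) (y, s)" for i j
    by (rule space_deriv_cong[OF slabI space_derivs_commute[OF U_smooth]])
  thus "transpose (h s y v) = h s y v" by (simp add: h_def transpose_def vec_eq_iff)
  have hvw: "(h s y v *v w) $ i = (\<Sum>j\<in>UNIV. \<Sum>l\<in>UNIV. v $ l * w $ j * space_deriv (axis l 1) (space_deriv (axis i 1) (space_deriv (axis j 1) U)) (y, s))" for v w i
    by (simp add: h_def matrix_vector_mult_def space_deriv_sum[OF space_deriv_smooth[OF space_deriv_smooth[OF U_smooth]] s, where v = v]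
      sum_distrib_left sum_distrib_right mult_ac)
  show "h s y v *v w = h s y w *v v"
  proof (rule vec_eq_iff[THEN iffD2], rule)
    fix i
    have "(h s y v *v w) $ i = (\<Sum>l\<in>UNIV. \<Sum>j\<in>UNIV. v $ l * w $ j * space_deriv (axis l 1) (space_deriv (axis i 1) (space_deriv (axis j 1) U)) (y, s))"
      unfolding hvw by (rule sum.swap)
    also have "\<dots> = (\<Sum>l\<in>UNIV. \<Sum>j\<in>UNIV. w $ j * v $ l * space_deriv (axis j 1) (space_deriv (axis i 1) (space_deriv (axis l 1) U)) (y, s))"
      by (intro sum.cong[OF refl] arg_cong2[where f = "(*)", OF mult.commute space_derivs_commute3[OF U_smooth slabI]])
    finally show "(h s y v *v w) $ i = (h s y w *v v) $ i" unfolding hvw .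
  qed
  fix p q i j :: 'n
  show "k s y (axis p 1) (axis q 1) $ j $ i = k s y (axis i 1) (axis j 1) $ q $ p"
  proof -
    have "space_deriv (axis q 1) (space_deriv (axis p 1) (space_deriv (axis j 1) (space_deriv (axis i 1) U))) (y, s) =
      space_deriv (axis j 1) (space_deriv (axis i 1) (space_deriv (axis q 1) (space_deriv (axis p 1) U))) (y, s)"
      by (rule space_derivs_commute4[OF U_smooth slabI])
    thus ?thesis by (simp add: k_def)
  qed
qed

text \<open>
\<open>\<partial>\<^sub>t D\<^sup>2u = D\<^sup>2u\<^sub>t\<close>, and \<open>u\<^sub>t\<close> is the continuous branch of the argument of the phase of \<open>D\<^sup>2u\<close>.
\<close>

lemma time_derivative_hessian:
  assumes flow: "lagrangian_flow_solution u T" and s: "s \<in> {0..<T}"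
  shows "time_deriv (space_deriv (axis q 1) (space_deriv (axis p 1) U)) (y, s) =
    hessian_jet.hess_angle (\<lambda>y. hess (y, s)) (h s) (k s) y (axis p 1) (axis q 1)"
proof -
  interpret hessian_jet "\<lambda>y. u y s" "\<lambda>y. hess (y, s)" "h s" "k s" by (rule jet[OF s])
  have slabI: "(y, s) \<in> slab" for y using s by (simp add: slab_def)
  have angle: "exp (\<i> * complex_of_real (time_deriv U (y, s))) = phase (hess (y, s))" for y
  proof -
    obtain u' where u': "((\<lambda>s. u y s) has_real_derivative u') (at s within {0..<T})"
      "complex_of_real u' = 1 / \<i> * log_phase (hessian (\<lambda>y. u y s) y)"
      using flow s unfolding lagrangian_flow_solution_def by blast
    have "((\<lambda>s. (y, s)) has_derivative (\<lambda>r. (0, r))) (at s within {0..<T})"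
      by (auto intro!: derivative_eq_intros)
    moreover have "(U has_derivative (\<lambda>v. dir_deriv slab U v (y, s))) (at (y, s) within (\<lambda>s. (y, s)) ` {0..<T})"
      by (rule has_derivative_subset[OF smooth_on_dir_deriv(1)[OF slab U_smooth slabI]]) (auto simp: slab_def)
    ultimately have "((\<lambda>s. U (y, s)) has_derivative (\<lambda>r. dir_deriv slab U (0, r) (y, s))) (at s within {0..<T})"
      by (rule has_derivative_in_compose)
    moreover have "dir_deriv slab U (0, r) (y, s) = r * time_deriv U (y, s)" for r
      using linear_scale[OF has_derivative_linear[OF smooth_on_dir_deriv(1)[OF slab U_smooth slabI[of y]]], of r "(0, 1)"]
      by (simp add: time_deriv_def)
    ultimately have "((\<lambda>s. u y s) has_vector_derivative time_deriv U (y, s)) (at s within {0..<T})"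
      by (simp add: has_vector_derivative_def U_def)
    moreover have "((\<lambda>s. u y s) has_vector_derivative u') (at s within {0..<T})"
      using u'(1) by (simp add: has_real_derivative_iff_has_vector_derivative)
    ultimately have "time_deriv U (y, s) = u'"
      by (rule vector_derivative_unique_within[OF at_within_half_open_ne_bot[OF s]])
    hence "complex_of_real (time_deriv U (y, s)) = complex_of_real (\<Sum>r\<in>#eigenvalues (hess (y, s)). arctan r)"
      using u'(2) by (simp only: hessian_slice[OF s] log_phase_eq_arctan[OF a_sym])
    thus ?thesis using phase_scaled[OF a_sym, where s = 1] by simp
  qed
  have d: "space_deriv v (time_deriv U) (y, s) = trace (G y ** h s y v)" for v y
    by (rule angle_derivative[OF has_derivative_slice[OF time_deriv_smooth[OF U_smooth] s] angle])
  have "time_deriv (space_deriv (axis q 1) (space_deriv (axis p 1) U)) (y, s) = space_deriv (axis q 1) (time_deriv (space_deriv (axis p 1) U)) (y, s)"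
    by (rule time_space_derivs_commute[OF space_deriv_smooth[OF U_smooth] slabI])
  also have "\<dots> = space_deriv (axis q 1) (space_deriv (axis p 1) (time_deriv U)) (y, s)"
    by (rule space_deriv_cong[OF slabI time_space_derivs_commute[OF U_smooth]])
  also have "\<dots> = hess_angle y (axis p 1) (axis q 1)"
  proof -
    have "((\<lambda>y. space_deriv (axis p 1) (time_deriv U) (y, s)) has_derivative (\<lambda>w. hess_angle y (axis p 1) w)) (at y)"
      unfolding d hess_angle_def by (rule d_Gh)
    from has_derivative_unique[OF has_derivative_slice[OF space_deriv_smooth[OF time_deriv_smooth[OF U_smooth]] s] this]
    show ?thesis by meson
  qed
  finally show ?thesis .
qed

end


section \<open>The evolution inequality\<close>

theorem proposition4p1:
  fixes u :: "real^'n \<Rightarrow> real \<Rightarrow> real"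
    and \<phi> :: "real^'n \<Rightarrow> real \<Rightarrow> real^'n"
    and T :: real
  assumes "lagrangian_flow_solution u T"
    and "\<And>t. t \<in> {0..<T} \<Longrightarrow> two_convex (\<lambda>x. u x t)"
    and "parametric_flow u \<phi> T"
  shows "\<forall>x. \<forall>t\<in>{0..<T}.
    (let g = induced_metric (\<lambda>y. parametric_position u \<phi> y t);
         f = (\<lambda>y. log_star_Omega u \<phi> y t)
     in vector_derivative (\<lambda>s. log_star_Omega u \<phi> x s) (at t within {0..<T}) - laplace_beltrami g f x
        \<ge> 1 / real CARD('n) * (metric_norm (g x) (metric_grad g f x))\<^sup>2)"
proof (intro allI ballI)
  fix x :: "real^'n" and t assume t: "t \<in> {0..<T}"
  interpret smooth_spacetime_function u T
    using assms(1) by unfold_locales (simp add: lagrangian_flow_solution_def)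
  interpret J: hessian_jet "\<lambda>y. u y t" "\<lambda>y. hess (y, t)" "h t" "k t" by (rule jet[OF t])
  let ?y = "\<phi> x t"
  let ?p = "(?y, t)"
  have slabI: "(y, s) \<in> slab" if "s \<in> {0..<T}" for y s using that by (simp add: slab_def)
  have lso: "log_star_Omega u \<phi> y s = - ln (det (mat 1 + hess (\<phi> y s, s) ** hess (\<phi> y s, s))) / 2" if s: "s \<in> {0..<T}" for y s
  proof -
    interpret hessian_jet "\<lambda>y. u y s" "\<lambda>y. hess (y, s)" "h s" "k s" by (rule jet[OF s])
    show ?thesis by (simp add: log_star_Omega_def ln_star_Omega log_Omega_def met_def)
  qed
  \<comment> \<open>The derivative of \<open>log *\<Omega>\<close> in time at a fixed parameter: transport by \<open>\<phi>'\<close> plus the change at a fixed base point.\<close>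
  define \<phi>' where "\<phi>' = fst (mean_curvature_vector (gradient_graph (\<lambda>y. u y t)) ?y)"
  have d\<phi>: "((\<lambda>s. \<phi> x s) has_derivative (\<lambda>r. r *\<^sub>R \<phi>')) (at t within {0..<T})"
  proof -
    have "((\<lambda>s. parametric_position u \<phi> x s) has_derivative
       (\<lambda>r. r *\<^sub>R mean_curvature_vector (gradient_graph (\<lambda>y. u y t)) ?y)) (at t within {0..<T})"
      using assms(3) t unfolding parametric_flow_def has_vector_derivative_def by blast
    from has_derivative_fst[OF this] show ?thesis by (simp add: parametric_position_def \<phi>'_def)
  qed
  define B where "B = (\<chi> i j. time_deriv (space_deriv (axis i 1) (space_deriv (axis j 1) U)) ?p)"
  have dhess: "((\<lambda>s. hess (\<phi> x s, s)) has_derivative (\<lambda>r. r *\<^sub>R (h t ?y \<phi>' + B))) (at t within {0..<T})"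
    unfolding has_derivative_vec_iff
  proof (intro allI)
    fix i j
    let ?F = "space_deriv (axis i 1) (space_deriv (axis j 1) U)"
    have sm: "smooth_on ?F slab" by (intro space_deriv_smooth U_smooth)
    have D: "(?F has_derivative (\<lambda>v. dir_deriv slab ?F v ?p)) (at ?p within slab)"
      by (rule smooth_on_dir_deriv(1)[OF slab sm slabI[OF t]])
    have "((\<lambda>s. (\<phi> x s, s)) has_derivative (\<lambda>r. (r *\<^sub>R \<phi>', r))) (at t within {0..<T})"
      by (intro has_derivative_Pair d\<phi> has_derivative_ident)
    moreover have "(?F has_derivative (\<lambda>v. dir_deriv slab ?F v ?p)) (at ?p within (\<lambda>s. (\<phi> x s, s)) ` {0..<T})"
      by (rule has_derivative_subset[OF D]) (auto simp: slab_def)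
    ultimately have "((\<lambda>s. ?F (\<phi> x s, s)) has_derivative (\<lambda>r. dir_deriv slab ?F (r *\<^sub>R \<phi>', r) ?p)) (at t within {0..<T})"
      by (rule has_derivative_in_compose)
    moreover have "dir_deriv slab ?F (r *\<^sub>R \<phi>', r) ?p = r * (space_deriv \<phi>' ?F ?p + time_deriv ?F ?p)" for r
    proof -
      note l = has_derivative_linear[OF D]
      have "(r *\<^sub>R \<phi>', r) = r *\<^sub>R ((\<phi>', 0) + (0, 1))" by simp
      hence "dir_deriv slab ?F (r *\<^sub>R \<phi>', r) ?p = dir_deriv slab ?F (r *\<^sub>R ((\<phi>', 0) + (0, 1))) ?p" by (rule arg_cong)
      also have "\<dots> = r * (dir_deriv slab ?F (\<phi>', 0) ?p + dir_deriv slab ?F (0, 1) ?p)"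
        unfolding linear_scale[OF l] linear_add[OF l] by simp
      finally show ?thesis by (simp add: space_deriv_def time_deriv_def)
    qed
    ultimately show "((\<lambda>s. hess (\<phi> x s, s) $ i $ j) has_derivative (\<lambda>r. (r *\<^sub>R (h t ?y \<phi>' + B)) $ i $ j)) (at t within {0..<T})"
      by (simp add: hess_def h_def B_def)
  qed
  have "((\<lambda>s. log_star_Omega u \<phi> x s) has_vector_derivative
      (- trace (J.G ?y ** hess ?p ** (h t ?y \<phi>' + B)))) (at t within {0..<T})"
  proof -
    have "((\<lambda>s. - ln (det (mat 1 + hess (\<phi> x s, s) ** hess (\<phi> x s, s))) / 2) has_derivative
       (\<lambda>r. - trace (matrix_inv (mat 1 + hess ?p ** hess ?p) ** hess ?p ** (r *\<^sub>R (h t ?y \<phi>' + B))))) (at t within {0..<T})"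
      by (rule has_derivative_ln_det_sum_square[OF dhess hess_sym[OF slabI[OF t]]])
    hence "((\<lambda>s. log_star_Omega u \<phi> x s) has_derivative
       (\<lambda>r. - trace (matrix_inv (mat 1 + hess ?p ** hess ?p) ** hess ?p ** (r *\<^sub>R (h t ?y \<phi>' + B))))) (at t within {0..<T})"
      by (rule has_derivative_transform[OF t, rotated]) (rule lso)
    thus ?thesis
      by (simp add: has_vector_derivative_def J.G_def J.met_def scaleR_matrix_mult trace_scaleR)
  qed
  hence "vector_derivative (\<lambda>s. log_star_Omega u \<phi> x s) (at t within {0..<T}) = - trace (J.G ?y ** hess ?p ** (h t ?y \<phi>' + B))"
    by (rule vector_derivative_within[OF at_within_half_open_ne_bot[OF t]])
  also have "\<dots> = grad J.log_Omega ?y \<bullet> \<phi>' - trace (J.G ?y ** hess ?p ** B)"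
    using has_derivative_grad[OF J.d_log_Omega, of ?y \<phi>'] by (simp add: matrix_add_ldistrib trace_add)
  also have "trace (J.G ?y ** hess ?p ** B) =
      (\<Sum>p\<in>UNIV. \<Sum>q\<in>UNIV. (J.G ?y ** hess ?p) $ p $ q * J.hess_angle ?y (axis p 1) (axis q 1))"
    using time_derivative_hessian[OF assms(1) t, of _ _ ?y]
    by (simp add: trace_def matrix_matrix_mult_def[of "J.G ?y ** hess ?p"] B_def)
  finally have time: "vector_derivative (\<lambda>s. log_star_Omega u \<phi> x s) (at t within {0..<T}) =
      - trace (J.G ?y ** h t ?y (hess ?p *v (J.G ?y *v grad J.log_Omega ?y)))
      - (\<Sum>p\<in>UNIV. \<Sum>q\<in>UNIV. (J.G ?y ** hess ?p) $ p $ q * J.hess_angle ?y (axis p 1) (axis q 1))"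
    unfolding \<phi>'_def J.drift_cancels .
  have "diffeomorphism (\<lambda>y. \<phi> y t)" using assms(3) t by (auto simp: parametric_flow_def)
  then obtain Ja Ja' where Ja: "\<And>y. ((\<lambda>y. \<phi> y t) has_derivative (\<lambda>v. Ja y *v v)) (at y)" "\<And>y. invertible (Ja y)"
    "\<And>y. (Ja has_derivative Ja' y) (at y)" "\<And>y v w. Ja' y v *v w = Ja' y w *v v"
    by (rule diffeomorphism_jacobian) blast
  \<comment> \<open>The induced metric in parametric coordinates is the pullback of the graph metric by \<open>\<phi>\<close>.\<close>
  interpret P: metric_pullback J.met J.log_Omega "\<lambda>y. \<phi> y t" Ja
    by unfold_locales (use Ja J.det_met_pos in \<open>auto simp: differentiable_def intro: J.d_log_Omega\<close>)
  have g: "induced_metric (\<lambda>y. parametric_position u \<phi> y t) = P.pullback"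
    unfolding parametric_position_def using J.induced_metric_reparametrised[OF Ja(1)] by (simp add: fun_eq_iff P.pullback_def)
  have f: "(\<lambda>y. log_star_Omega u \<phi> y t) = (\<lambda>y. J.log_Omega (\<phi> y t))"
    by (simp add: fun_eq_iff log_star_Omega_def J.ln_star_Omega)
  have lap: "laplace_beltrami P.pullback (\<lambda>y. J.log_Omega (\<phi> y t)) x = laplace_beltrami J.met J.log_Omega ?y"
    by (rule P.laplace_beltrami_pullback[OF Ja(3,4) J.d_grad_field[unfolded J.grad_field_def[abs_def]]])
  have cvx: "\<forall>l m. {#l, m#} \<subseteq># eigenvalues (hess ?p) \<longrightarrow> 1 + l * m \<ge> 0"
    using assms(2)[OF t] unfolding two_convex_def hessian_slice[OF t] by blast
  show "let g = induced_metric (\<lambda>y. parametric_position u \<phi> y t);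
         f = (\<lambda>y. log_star_Omega u \<phi> y t)
     in vector_derivative (\<lambda>s. log_star_Omega u \<phi> x s) (at t within {0..<T}) - laplace_beltrami g f x
        \<ge> 1 / real CARD('n) * (metric_norm (g x) (metric_grad g f x))\<^sup>2"
    unfolding Let_def g f lap time J.laplace_log_Omega P.metric_norm_pullback
    using J.evolution_inequality[OF cvx] by linarith
qed

end
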